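(* Suppose that $\theta$ is a random variable defined on a state space $\Theta$, with probability density $p(\theta)$. For any given $\theta\in\Theta$, let $y$ and $y'$ be two random variables that are independent conditional on $\theta$, and both follow the same distribution $p(y|\theta)$. Define $z=y-y'$, and let $p(z|\theta)$ denote the distribution of $z$ conditional on $\theta$. Suppose that $p(\theta)$ admits the form $$p(\theta)=\sum_{l=1}^{L}\omega_l f_l(\theta),$$ where $\omega_l\geq 0$ for $l=1,\dots,L$, $\sum_{l=1}^{L}\omega_l=1$, and the $f_l(\theta)$ are density functions. Then $$E_\theta[H(p(y|\theta))]\;\leq\;\sum_{l=1}^{L}\omega_l\, H\big(E_{\theta\sim f_l}[p(z|\theta)]\big)-\frac{\dim(y)}{2}\log 2\;\leq\; H\big(E_{\theta}[p(z|\theta)]\big)-\frac{\dim(y)}{2}\log 2,$$ where $\dim(y)$ is the dimensionality of $y$.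
   Context: For a distribution with density $p(\cdot)$, $H$ denotes its entropy, $H[p(y)]=-\int \log[p(y)]\,p(y)\,dy$. $H(p(y|\theta))$ is, for fixed $\theta$, the entropy of the distribution $y\mapsto p(y|\theta)$. $E_\theta[\cdot]$ denotes expectation over $\theta\sim p(\theta)$: $E_\theta[H(p(y|\theta))]=\int_\Theta p(\theta)H(p(y|\theta))\,d\theta$, and $E_\theta[p(z|\theta)]$ is the mixture $z\mapsto\int_\Theta p(\theta)p(z|\theta)\,d\theta$. Similarly, $E_{\theta\sim f_l}[p(z|\theta)]$ is the mixture $z\mapsto\int_\Theta f_l(\theta)p(z|\theta)\,d\theta$. *)

theory Defs
  imports "HOL-Probability.Probability"
begin

definition is_pdf :: "'a measure \<Rightarrow> ('a \<Rightarrow> real) \<Rightarrow> bool" where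
  "is_pdf \<mu> f \<longleftrightarrow> (\<forall>x\<in>space \<mu>. 0 \<le> f x) \<and> integrable \<mu> f \<and> (LINT x|\<mu>. f x) = 1"

definition has_pdf :: "'w measure \<Rightarrow> 'a measure \<Rightarrow> ('w \<Rightarrow> 'a) \<Rightarrow> ('a \<Rightarrow> real) \<Rightarrow> bool" where
  "has_pdf M \<mu> X f \<longleftrightarrow> is_pdf \<mu> f \<and> distributed M \<mu> X (\<lambda>x. ennreal (f x))"

text \<open>
  Differential entropy of a density on a Euclidean space, in nats. Where the density vanishes the
  integrand is \<open>0\<close>. The Bochner integral is \<open>0\<close> on non-integrable functions, so this
  number is the entropy only for densities satisfying \<open>finite_diff_entropy\<close>.
\<close>

definition diff_entropy :: "('a::euclidean_space \<Rightarrow> real) \<Rightarrow> real" where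
  "diff_entropy p = - (LINT y|lborel. ln (p y) * p y)"

definition finite_diff_entropy :: "('a::euclidean_space \<Rightarrow> real) \<Rightarrow> bool" where
  "finite_diff_entropy p \<longleftrightarrow> integrable lborel (\<lambda>y. ln (p y) * p y)"

definition mixture :: "'t measure \<Rightarrow> ('t \<Rightarrow> real) \<Rightarrow> ('t \<Rightarrow> 'a \<Rightarrow> real) \<Rightarrow> 'a \<Rightarrow> real" where
  "mixture \<mu> g q z = (LINT t|\<mu>. g t * q t z)"

lemma (in prob_space) diff_entropy_eq_entropy:
  fixes X :: "'a \<Rightarrow> 'b::euclidean_space"
  assumes "has_pdf M lborel X p"
  shows "diff_entropy p = entropy (exp 1) lborel X"
proof -
  interpret information_space M "exp 1"
    by unfold_locales simp
  have "entropy (exp 1) lborel X = - (LINT x|lborel. p x * log (exp 1) (p x))"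
    using assms by (intro entropy_distr) (auto simp: has_pdf_def is_pdf_def)
  then show ?thesis
    by (simp add: diff_entropy_def log_def mult.commute)
qed

end

theory Submission
  imports Defs
begin

text \<open>
  The first inequality rests on the entropy power inequality in the form
  $h(Y - Y') \ge h(Y) + \frac{d}{2}\log 2$ for independent $Y, Y'$ with the same density. It is proved
  in the dual form: for densities $f_1, f_2, g$, the integral of
  $f_1(x) f_2(y) \log g(x - y)$ is at most
  $\frac12 \int f_1 \log f_1 + \frac12 \int f_2 \log f_2 - \frac{d}{2}\log 2$.

  In dimension one, write $x = T_1(u)$, $y = T_2(v)$ with $T_i$ transporting the standard normal
  distribution to $f_i$, and rotate $(u, v)$ to $\alpha = (u - v)/\sqrt 2$, $\beta = (u + v)/\sqrt 2$.
  For fixed $\beta$ the map $\alpha \mapsto T_1(u) - T_2(v)$ is increasing with derivative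
  $(T_1'(u) + T_2'(v))/\sqrt 2$, which dominates $\sqrt{2\, T_1'(u)\, T_2'(v)}$; substitution, $\log r \le r - 1$
  and the identity $f_i(T_i) T_i' = \varphi$ give the claim. The dual form, written without
  normalization, passes to products by integrating out one factor, hence holds in every dimension.

  With $g$ the mixture of the $p(z|\theta)$ under $f_l$, integrating over $\theta \sim f_l$
  bounds the mean entropy by the entropy of that mixture; the second inequality is concavity
  of the entropy.
\<close>

section \<open>Transport from the standard normal distribution\<close>

text \<open>The dual form tests against an arbitrary density g, not the density of Y - Y'. This
  makes it fit mixtures: one g serves every \<theta>, so the bound can be averaged over \<theta>,
  and the cross entropies of the p(z|\<theta>) relative to g average to the entropy of g. The
  constant is log sqrt 2 per coordinate, from (a + b) / sqrt 2 \<ge> sqrt 2 * sqrt (a b). The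
  obstacle is analytic: logarithms are unbounded, \<open>ln 0 = 0\<close> stands where -\<infinity>
  is meant, and a divergent integral has the value 0. The core inequality is therefore proved where
  all logarithms are bounded. Tensorization takes place at an intermediate level of generality:
  bounded measurable f_1, f_2 supported in a fixed set of finite measure, and g between constant
  multiples of a Gaussian. This class is closed under slices and marginals; general densities are
  reached only once the dimension is.\<close>

lemma (in pair_sigma_finite)
  fixes f :: "_ \<Rightarrow> real"
  assumes f: "integrable M1 f" and g: "integrable M2 g"
  shows integrable_product: "integrable (M1 \<Otimes>\<^sub>M M2) (\<lambda>z. f (fst z) * g (snd z))"
    and integral_product: "(\<integral>z. f (fst z) * g (snd z) \<partial>(M1 \<Otimes>\<^sub>M M2)) = (\<integral>x. f x \<partial>M1) * (\<integral>y. g y \<partial>M2)"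
proof -
  have [measurable]: "f \<in> borel_measurable M1" "g \<in> borel_measurable M2" using f g by auto
  show *: "integrable (M1 \<Otimes>\<^sub>M M2) (\<lambda>z. f (fst z) * g (snd z))"
  proof (rule Fubini_integrable)
    have "integrable M1 (\<lambda>x. \<bar>f x\<bar> * (\<integral>y. \<bar>g y\<bar> \<partial>M2))"
      by (intro integrable_mult_left integrable_abs f)
    then show "integrable M1 (\<lambda>x. \<integral>y. norm (f (fst (x, y)) * g (snd (x, y))) \<partial>M2)"
      by (simp add: abs_mult)
    show "AE x in M1. integrable M2 (\<lambda>y. f (fst (x, y)) * g (snd (x, y)))"
      using g by (intro AE_I2) simp
  qed measurable
  show "(\<integral>z. f (fst z) * g (snd z) \<partial>(M1 \<Otimes>\<^sub>M M2)) = (\<integral>x. f x \<partial>M1) * (\<integral>y. g y \<partial>M2)"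
    using integral_fst'[OF *] by simp
qed

text \<open>Passes from the gauge integral, for which the fundamental theorem of calculus is
  available, to the Lebesgue integral that defines the measure of a set under a density.\<close>

lemma nn_integral_Icc_continuous:
  fixes \<rho> :: "real \<Rightarrow> real"
  assumes "continuous_on UNIV \<rho>" "\<And>x. 0 \<le> \<rho> x" "a \<le> b"
  shows "(\<integral>\<^sup>+x. ennreal (\<rho> x) * indicator {a..b} x \<partial>lborel) = ennreal (integral {a..b} \<rho>)"
proof -
  have [measurable]: "\<rho> \<in> borel_measurable borel"
    using assms(1) by (rule borel_measurable_continuous_onI)
  show ?thesis
    using nn_integral_has_integral_lebesgue'[of "{a..b}" \<rho> "integral {a..b} \<rho>"] assms
      integrable_continuous_interval[OF continuous_on_subset[OF assms(1)], of a b]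
    by (simp add: integrable_integral)
qed

lemma cdf_density_has_derivative:
  fixes \<rho> :: "real \<Rightarrow> real"
  assumes cont: "continuous_on UNIV \<rho>" and nonneg: "\<And>x. 0 \<le> \<rho> x"
    and fin: "real_distribution (density lborel \<rho>)"
  shows "(cdf (density lborel \<rho>) has_real_derivative \<rho> x) (at x)"
proof -
  interpret real_distribution "density lborel \<rho>" by fact
  define a b where "a = x - 1" and "b = x + 1"
  have [measurable]: "\<rho> \<in> borel_measurable borel"
    using cont by (rule borel_measurable_continuous_onI)
  have eq: "cdf (density lborel \<rho>) y = cdf (density lborel \<rho>) a + integral {a..y} \<rho>" if "y \<in> {a<..<b}" for y
  proof -
    \<comment> \<open>The half-open interval is what a difference of two values of
      \<open>cdf\<close> measures; its left endpoint is a null set.\<close>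
    have "emeasure (density lborel \<rho>) {a<..y} = (\<integral>\<^sup>+x. ennreal (\<rho> x) * indicator {a<..y} x \<partial>lborel)"
      by (subst emeasure_density) auto
    also have "\<dots> = (\<integral>\<^sup>+x. ennreal (\<rho> x) * indicator {a..y} x \<partial>lborel)"
      using AE_lborel_singleton[of a]
      by (intro nn_integral_cong_AE) (auto elim!: eventually_mono simp: indicator_def)
    also have "\<dots> = ennreal (integral {a..y} \<rho>)"
      using that by (intro nn_integral_Icc_continuous cont nonneg) auto
    finally have "measure (density lborel \<rho>) {a<..y} = integral {a..y} \<rho>"
      using nonneg by (simp add: measure_def integral_nonneg integrable_continuous_interval continuous_on_subset[OF cont])
    then show ?thesis using cdf_diff_eq[of a y] that by auto
  qed
  have "((\<lambda>y. integral {a..y} \<rho>) has_real_derivative \<rho> x) (at x within {a..b})"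
    by (intro integral_has_real_derivative continuous_on_subset[OF cont]) (auto simp: a_def b_def)
  then have "((\<lambda>y. integral {a..y} \<rho>) has_real_derivative \<rho> x) (at x)"
    using at_within_Icc_at[of a x b] by (simp add: a_def b_def)
  then have "((\<lambda>y. cdf (density lborel \<rho>) a + integral {a..y} \<rho>) has_real_derivative \<rho> x) (at x)"
    by (auto intro!: derivative_eq_intros)
  then show ?thesis
    by (rule has_field_derivative_transform_within_open[of _ _ _ "{a<..<b}"]) (auto simp: eq a_def b_def)
qed

lemma std_normal_cdf_has_derivative:
  "(cdf std_normal_distribution has_real_derivative std_normal_density x) (at x)"
proof (rule cdf_density_has_derivative)
  show "continuous_on UNIV std_normal_density"
    unfolding normal_density_def by (intro continuous_intros) auto
qed (simp_all add: real_dist_normal_dist)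

lemma std_normal_density_pos [simp]: "0 < std_normal_density x"
  by (rule normal_density_pos) simp

lemma std_normal_cdf_strict_mono: "strict_mono (cdf std_normal_distribution)"
proof (rule strict_monoI)
  fix x y :: real assume "x < y"
  then show "cdf std_normal_distribution x < cdf std_normal_distribution y"
    by (rule DERIV_pos_imp_increasing)
       (blast intro: std_normal_cdf_has_derivative std_normal_density_pos)
qed

lemma std_normal_cdf_bounds:
  "0 < cdf std_normal_distribution x" "cdf std_normal_distribution x < 1"
proof -
  interpret real_distribution std_normal_distribution by (rule real_dist_normal_dist)
  have "cdf std_normal_distribution (x - 1) < cdf std_normal_distribution x"
       "cdf std_normal_distribution x < cdf std_normal_distribution (x + 1)"
    using std_normal_cdf_strict_mono by (simp_all add: strict_mono_def)
  then show "0 < cdf std_normal_distribution x" "cdf std_normal_distribution x < 1"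
    using cdf_nonneg[of "x - 1"] cdf_bounded_prob[of "x + 1"] by linarith+
qed

lemma std_normal_cdf_surj:
  assumes "0 < q" "q < 1"
  obtains x where "cdf std_normal_distribution x = q"
proof -
  interpret real_distribution std_normal_distribution by (rule real_dist_normal_dist)
  let ?C = "cdf std_normal_distribution"
  have "eventually (\<lambda>x. ?C x < q) at_bot"
    using cdf_lim_at_bot assms by (auto intro: order_tendstoD)
  then obtain a where a: "?C a < q" by (auto simp: eventually_at_bot_linorder)
  have "eventually (\<lambda>x. q < ?C x) at_top"
    using cdf_lim_at_top_prob assms by (auto intro: order_tendstoD)
  then obtain b where b: "q < ?C b" by (auto simp: eventually_at_top_linorder)
  have "a \<le> b" using a b cdf_nondecreasing[of b a] by linarith
  have "isCont ?C t" for t using std_normal_cdf_has_derivative DERIV_isCont by blast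
  then obtain x where "?C x = q" using IVT[of ?C a q b] a b \<open>a \<le> b\<close> by auto
  then show thesis by (rule that)
qed

text \<open>\<open>T\<close> is \<open>G\<close> after the normal distribution function, where
  \<open>G\<close> inverts \<open>F\<close>, the primitive of \<open>f\<close> on [a, b]. The normal
  distribution function omits the values 0 and 1, so \<open>T\<close> stays in the open interval,
  where \<open>F\<close> has a positive two-sided derivative. The formula for \<open>T'\<close>
  comes from differentiating \<open>F (T u) = ?C u\<close>. The law of \<open>T\<close> is
  identified through its distribution function.\<close>

lemma transport_from_std_normal:
  fixes f :: "real \<Rightarrow> real"
  assumes cont: "continuous_on UNIV f" and pos: "\<And>x. 0 < f x" and "a < b"
    and int1: "integral {a..b} f = 1"
  obtains T T' where
    "\<And>u. (T has_real_derivative T' u) (at u)"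
    "\<And>u. 0 < T' u" "\<And>u. T u \<in> {a<..<b}"
    "\<And>u. f (T u) * T' u = std_normal_density u"
    "distr std_normal_distribution borel T = density lborel (\<lambda>x. ennreal (indicator {a..b} x * f x))"
proof -
  interpret N: real_distribution std_normal_distribution by (rule real_dist_normal_dist)
  let ?C = "cdf std_normal_distribution"
  define F where "F x = integral {a..x} f" for x
  have cI: "continuous_on {x..y} f" for x y using cont continuous_on_subset by blast
  have [measurable]: "f \<in> borel_measurable borel"
    using cont by (rule borel_measurable_continuous_onI)
  have dw: "(F has_real_derivative f t) (at t within {a..b})" if "t \<in> {a..b}" for t
    unfolding F_def using that by (intro integral_has_real_derivative cI)
  have d: "(F has_real_derivative f t) (at t)" if "t \<in> {a<..<b}" for t
    using dw[of t] at_within_Icc_at[of a t b] that by simp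
  have contF: "continuous_on {a..b} F"
    by (rule DERIV_continuous_on[OF dw])
  have mono: "F x < F y" if "a \<le> x" "x < y" "y \<le> b" for x y
  proof (rule DERIV_pos_imp_increasing_open[OF that(2)])
    show "continuous_on {x..y} F" using contF by (rule continuous_on_subset) (use that in auto)
    show "\<exists>r. (F has_real_derivative r) (at t) \<and> 0 < r" if "x < t" "t < y" for t
      using d[of t] pos[of t] that \<open>a \<le> x\<close> \<open>y \<le> b\<close> by (intro exI[of _ "f t"]) auto
  qed
  have Fa: "F a = 0" and Fb: "F b = 1" by (simp_all add: F_def int1)
  have "\<exists>x. x \<in> {a<..<b} \<and> F x = q" if q: "0 < q" "q < 1" for q
  proof -
    obtain x where "a \<le> x" "x \<le> b" "F x = q"
      using IVT'[of F a q b] q contF \<open>a < b\<close> Fa Fb by (metis less_imp_le)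
    moreover have "x \<noteq> a" "x \<noteq> b" using q \<open>F x = q\<close> Fa Fb by auto
    ultimately show ?thesis using \<open>F x = q\<close> by (intro exI[of _ x]) auto
  qed
  then obtain G where G: "\<And>q. 0 < q \<Longrightarrow> q < 1 \<Longrightarrow> G q \<in> {a<..<b} \<and> F (G q) = q" by metis
  have FI: "0 < F x \<and> F x < 1" if "x \<in> {a<..<b}" for x
    using mono[of a x] mono[of x b] that Fa Fb by auto
  have inj: "x = y" if "F x = F y" "x \<in> {a<..<b}" "y \<in> {a<..<b}" for x y
    using mono[of x y] mono[of y x] that by (cases x y rule: linorder_cases) auto
  have GF: "G (F x) = x" if "x \<in> {a<..<b}" for x
    using G[of "F x"] FI[OF that] inj that by auto
  define T where "T u = G (?C u)" for u
  have T: "T u \<in> {a<..<b}" "F (T u) = ?C u" for u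
    using G[of "?C u"] std_normal_cdf_bounds[of u] by (auto simp: T_def)
  define T' where "T' u = std_normal_density u / f (T u)" for u
  \<comment> \<open>The inverse function theorem at the interior point \<open>T u\<close>; the
    derivative there is invertible because \<open>f\<close> is positive.\<close>
  have G': "(G has_real_derivative inverse (f (T u))) (at (F (T u)))" for u
    unfolding has_field_derivative_def
  proof (rule has_derivative_inverse_strong[where S="{a<..<b}" and f=F])
    show "(F has_derivative (*) (f (T u))) (at (T u))"
      using d[OF T(1)] by (simp add: has_field_derivative_def)
    show "(*) (f (T u)) \<circ> (*) (inverse (f (T u))) = id"
      using pos[of "T u"] by (auto simp: fun_eq_iff)
    show "continuous_on {a<..<b} F" using contF by (rule continuous_on_subset) auto
  qed (use T GF in auto)
  have DT: "(T has_real_derivative T' u) (at u)" for u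
  proof -
    have "((\<lambda>u. G (?C u)) has_real_derivative inverse (f (T u)) * std_normal_density u) (at u)"
      using G'[of u] by (intro DERIV_chain2[OF _ std_normal_cdf_has_derivative]) (simp add: T(2))
    then show ?thesis by (simp add: T_def[abs_def] T'_def field_simps)
  qed
  have T'_pos: "0 < T' u" for u by (simp add: T'_def pos)
  have Tmono: "T u < T v" if "u < v" for u v
    using DERIV_pos_imp_increasing[OF that, of T] DT T'_pos by blast
  have [measurable]: "T \<in> borel_measurable borel"
    by (intro borel_measurable_continuous_onI continuous_at_imp_continuous_on ballI DERIV_isCont[OF DT])
  have D_Icc: "emeasure (density lborel (\<lambda>x. ennreal (indicator {a..b} x * f x))) {..x} = ennreal (F x)"
    if "a \<le> x" "x \<le> b" for x
  proof -
    have "emeasure (density lborel (\<lambda>x. ennreal (indicator {a..b} x * f x))) {..x}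
      = (\<integral>\<^sup>+t. ennreal (f t) * indicator {a..x} t \<partial>lborel)"
      using that by (subst emeasure_density) (auto intro!: nn_integral_cong simp: indicator_def)
    also have "\<dots> = ennreal (F x)"
      unfolding F_def using pos that by (intro nn_integral_Icc_continuous cont) (auto intro: less_imp_le)
    finally show ?thesis .
  qed
  have D_UNIV: "emeasure (density lborel (\<lambda>x. ennreal (indicator {a..b} x * f x))) UNIV = 1"
  proof -
    have "emeasure (density lborel (\<lambda>x. ennreal (indicator {a..b} x * f x))) UNIV
      = emeasure (density lborel (\<lambda>x. ennreal (indicator {a..b} x * f x))) {..b}"
      by (simp add: emeasure_density) (auto intro!: nn_integral_cong simp: indicator_def split: if_splits)
    then show ?thesis using D_Icc[of b] \<open>a < b\<close> by (simp add: Fb)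
  qed
  have rd: "real_distribution (density lborel (\<lambda>x. ennreal (indicator {a..b} x * f x)))" (is "real_distribution ?D")
    by (intro real_distribution.intro prob_spaceI) (auto simp: D_UNIV real_distribution_axioms_def)
  interpret D: real_distribution ?D by fact
  have "distr std_normal_distribution borel T = ?D"
  proof (rule cdf_unique[OF _ rd])
    show rT: "real_distribution (distr std_normal_distribution borel T)"
      by (rule N.real_distribution_distr) auto
    interpret TD: real_distribution "distr std_normal_distribution borel T" by (rule rT)
    show "cdf (distr std_normal_distribution borel T) = cdf ?D"
    proof
      fix x :: real
      have cT: "cdf (distr std_normal_distribution borel T) x = measure std_normal_distribution {u. T u \<le> x}"
        by (simp add: cdf_def measure_distr vimage_def)
      \<comment> \<open>Up to \<open>a\<close> both distribution functions are 0 and from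
        \<open>b\<close> on both are 1, because \<open>T\<close> stays inside (a, b) and the density
        vanishes outside [a, b].\<close>
      consider "x \<le> a" | "b \<le> x" | "x \<in> {a<..<b}" by (meson greaterThanLessThan_iff not_le)
      then show "cdf (distr std_normal_distribution borel T) x = cdf ?D x"
      proof cases
        case 1
        then have e: "{u. T u \<le> x} = {}" using T(1) by (auto simp: not_le intro: le_less_trans)
        have "cdf ?D x \<le> cdf ?D a" using 1 by (rule D.cdf_nondecreasing)
        also have "\<dots> = 0" using D_Icc[of a] \<open>a < b\<close> by (simp add: cdf_def measure_def Fa)
        finally show ?thesis using D.cdf_nonneg[of x] cT e by simp
      next
        case 2
        then have e: "{u. T u \<le> x} = UNIV" using T(1) by (auto intro: order_trans less_imp_le)
        have "cdf ?D b \<le> cdf ?D x" using 2 by (rule D.cdf_nondecreasing)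
        moreover have "cdf ?D b = 1" using D_Icc[of b] \<open>a < b\<close> by (simp add: cdf_def measure_def Fb)
        ultimately show ?thesis using D.cdf_bounded_prob[of x] cT e N.prob_space by simp
      next
        case 3
        \<comment> \<open>The normal distribution function takes every value in (0, 1), so the
          interior point \<open>x\<close> is some \<open>T v\<close>, and monotonicity turns the
          sublevel set of \<open>T\<close> into a half-line.\<close>
        obtain v where v: "?C v = F x" using std_normal_cdf_surj FI[OF 3] by metis
        then have "T v = x" using T[of v] 3 inj by auto
        then have "{u. T u \<le> x} = {..v}"
          using strict_mono_less_eq[of T] Tmono by (auto simp: strict_mono_def)
        then have "cdf (distr std_normal_distribution borel T) x = ?C v" using cT by (simp add: cdf_def)
        also have "\<dots> = cdf ?D x"
          using v D_Icc[of x] 3 FI[OF 3] by (simp add: cdf_def measure_def)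
        finally show ?thesis .
      qed
    qed
  qed
  moreover have "f (T u) * T' u = std_normal_density u" for u
    using pos[of "T u"] by (simp add: T'_def)
  ultimately show thesis using that[of T T'] DT T'_pos T(1) by blast
qed

section \<open>The one-dimensional inequality for continuous densities\<close>

text \<open>Only an inequality, since \<open>\<Theta>\<close> need not be onto: the change of
  variables gives the integral of \<open>g\<close> over the range of \<open>\<Theta>\<close>, and
  nonnegativity bounds it by the integral over the line.\<close>

lemma nn_integral_substitution_le:
  fixes \<Theta> \<Theta>' g :: "real \<Rightarrow> real"
  assumes D: "\<And>u. (\<Theta> has_real_derivative \<Theta>' u) (at u)" and pos: "\<And>u. 0 < \<Theta>' u"
    and g: "integrable lborel g" "\<And>x. 0 \<le> g x"
  shows "(\<integral>\<^sup>+u. ennreal (g (\<Theta> u) * \<Theta>' u) \<partial>lborel) \<le> ennreal (LINT x|lborel. g x)"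
proof -
  have "\<Theta> u < \<Theta> v" if "u < v" for u v
    by (rule DERIV_pos_imp_increasing[OF that]) (use D pos in blast)
  then have inj: "inj \<Theta>" by (auto simp: inj_on_def) (metis linorder_neqE_linordered_idom order_less_irrefl)
  \<comment> \<open>A connected subset of the line is an interval, which settles measurability of
    the range.\<close>
  have "connected (range \<Theta>)"
    by (intro connected_continuous_image continuous_at_imp_continuous_on ballI DERIV_isCont[OF D] connected_UNIV)
  then have "is_interval (range \<Theta>)" by (simp add: is_interval_connected_1)
  then have S: "range \<Theta> \<in> sets lebesgue" by (simp add: real_interval_borel_measurable)
  have gl: "integrable lebesgue g" using g(1) by (simp add: integrable_completion)
  then have gU: "g absolutely_integrable_on UNIV" by (simp add: set_integrable_def)
  have gR: "g absolutely_integrable_on range \<Theta>"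
    by (rule set_integrable_subset[OF gU S]) auto
  have *: "(\<lambda>x. \<bar>\<Theta>' x\<bar> * g (\<Theta> x)) absolutely_integrable_on UNIV \<and>
     integral UNIV (\<lambda>x. \<bar>\<Theta>' x\<bar> * g (\<Theta> x)) = integral (range \<Theta>) g"
    using gR inj by (subst has_absolute_integral_change_of_variables_1'[of UNIV \<Theta> \<Theta>' g]) (auto intro: D)
  have eq: "\<bar>\<Theta>' x\<bar> * g (\<Theta> x) = g (\<Theta> x) * \<Theta>' x" for x using pos[of x] by simp
  have hi: "((\<lambda>x. g (\<Theta> x) * \<Theta>' x) has_integral integral (range \<Theta>) g) UNIV"
    using * unfolding eq by (metis integrable_integral set_lebesgue_integral_eq_integral(1))
  have "(\<integral>\<^sup>+u. ennreal (g (\<Theta> u) * \<Theta>' u) \<partial>lborel) = ennreal (integral (range \<Theta>) g)"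
    using nn_integral_has_integral_lebesgue'[OF _ hi] g(2) pos by (simp add: less_imp_le)
  also have "\<dots> \<le> ennreal (integral UNIV g)"
    using gR gU g(2) by (intro ennreal_leI integral_subset_le) (auto simp: set_lebesgue_integral_eq_integral(1))
  also have "integral UNIV g = (LINT x|lborel. g x)"
    by (rule integral_lborel[OF g(1)])
  finally show ?thesis .
qed

text \<open>The rotation is split into two affine substitutions in one variable each: u = v + sqrt 2
  * \<alpha> at fixed v, then v = (\<beta> - \<alpha>) / sqrt 2 at fixed \<alpha>. Their factors
  sqrt 2 and 1 / sqrt 2 cancel. With values in \<open>ennreal\<close> the order of integration can
  be exchanged without integrability.\<close>

lemma nn_integral_lborel_rotate:
  fixes H :: "real \<Rightarrow> real \<Rightarrow> ennreal"
  assumes [measurable]: "case_prod H \<in> borel_measurable (borel \<Otimes>\<^sub>M borel)"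
  shows "(\<integral>\<^sup>+u. \<integral>\<^sup>+v. H u v \<partial>lborel \<partial>lborel)
    = (\<integral>\<^sup>+\<beta>. \<integral>\<^sup>+\<alpha>. H ((\<beta> + \<alpha>) / sqrt 2) ((\<beta> - \<alpha>) / sqrt 2) \<partial>lborel \<partial>lborel)"
proof -
  have m: "case_prod H \<in> borel_measurable (lborel \<Otimes>\<^sub>M lborel)" by simp
  have "(\<integral>\<^sup>+u. \<integral>\<^sup>+v. H u v \<partial>lborel \<partial>lborel) = (\<integral>\<^sup>+v. \<integral>\<^sup>+u. H u v \<partial>lborel \<partial>lborel)"
    by (rule lborel_pair.Fubini'[OF m, symmetric])
  also have "\<dots> = (\<integral>\<^sup>+v. \<integral>\<^sup>+\<alpha>. ennreal (sqrt 2) * H (v + sqrt 2 * \<alpha>) v \<partial>lborel \<partial>lborel)"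
  proof (rule nn_integral_cong)
    fix v :: real
    show "(\<integral>\<^sup>+u. H u v \<partial>lborel) = (\<integral>\<^sup>+\<alpha>. ennreal (sqrt 2) * H (v + sqrt 2 * \<alpha>) v \<partial>lborel)"
      by (subst nn_integral_real_affine[where c="sqrt 2" and t=v]) (auto simp: nn_integral_cmult)
  qed
  also have "\<dots> = (\<integral>\<^sup>+\<alpha>. \<integral>\<^sup>+v. ennreal (sqrt 2) * H (v + sqrt 2 * \<alpha>) v \<partial>lborel \<partial>lborel)"
    by (rule lborel_pair.Fubini') simp
  also have "\<dots> = (\<integral>\<^sup>+\<alpha>. \<integral>\<^sup>+\<beta>. H ((\<beta> + \<alpha>) / sqrt 2) ((\<beta> - \<alpha>) / sqrt 2) \<partial>lborel \<partial>lborel)"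
  proof (rule nn_integral_cong)
    fix \<alpha> :: real
    have e: "- \<alpha> / sqrt 2 + 1 / sqrt 2 * \<beta> + sqrt 2 * \<alpha> = (\<beta> + \<alpha>) / sqrt 2" for \<beta>
      by (simp add: field_simps)
    have e': "- \<alpha> / sqrt 2 + 1 / sqrt 2 * \<beta> = (\<beta> - \<alpha>) / sqrt 2" for \<beta>
      by (simp add: field_simps)
    have c: "ennreal (1 / sqrt 2) * (ennreal (sqrt 2) * z) = z" for z
      by (simp add: mult.assoc[symmetric] ennreal_mult[symmetric])
    show "(\<integral>\<^sup>+v. ennreal (sqrt 2) * H (v + sqrt 2 * \<alpha>) v \<partial>lborel)
      = (\<integral>\<^sup>+\<beta>. H ((\<beta> + \<alpha>) / sqrt 2) ((\<beta> - \<alpha>) / sqrt 2) \<partial>lborel)"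
      unfolding nn_integral_real_affine[where c="1 / sqrt 2" and t="- \<alpha> / sqrt 2"
        and f="\<lambda>v. ennreal (sqrt 2) * H (v + sqrt 2 * \<alpha>) v", simplified e e', simplified]
      using e e' by (simp add: nn_integral_cmult c add.commute add_divide_distrib diff_divide_distrib)
  qed
  also have "\<dots> = (\<integral>\<^sup>+\<beta>. \<integral>\<^sup>+\<alpha>. H ((\<beta> + \<alpha>) / sqrt 2) ((\<beta> - \<alpha>) / sqrt 2) \<partial>lborel \<partial>lborel)"
    by (rule lborel_pair.Fubini') simp
  finally show ?thesis .
qed

text \<open>Since \<^term>\<open>ln 0 = (0::real)\<close>, the integrand vanishes where \<open>f1\<close> or \<open>f2\<close> does.\<close>

definition epi_integrand ::
  "('x \<Rightarrow> 'x \<Rightarrow> 'x) \<Rightarrow> real \<Rightarrow> ('x \<Rightarrow> real) \<Rightarrow> ('x \<Rightarrow> real) \<Rightarrow> ('x \<Rightarrow> real) \<Rightarrow> 'x \<times> 'x \<Rightarrow> real" where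
  "epi_integrand d k f1 f2 g =
    (\<lambda>(x, y). f1 x * f2 y * (ln (g (d x y)) - ln (f1 x) / 2 - ln (f2 y) / 2 + k))"

lemma std_normal_density_nonzero [simp]: "std_normal_density w \<noteq> 0"
  using std_normal_density_pos[of w] by linarith

text \<open>\<open>A\<close> and \<open>B\<close> stand for the derivatives of the two transport
  maps, so the quotients under the logarithms are the densities at the transported points. The
  arithmetic-geometric mean inequality bounds (ln A + ln B) / 2 by ln ((A + B) / 2), and ln R \<le>
  R - 1 for the quotient \<open>R\<close> on the right does the rest. The normal factors combine
  through ln \<phi>((u - v) / sqrt 2) = (ln \<phi>(u) + ln \<phi>(v)) / 2 + u v / 2; the term u v /
  2 has mean zero for independent centred u and v.\<close>

lemma ln_le_transport:
  fixes u v G A B :: real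
  assumes "0 < G" "0 < A" "0 < B"
  shows "ln G - ln (std_normal_density u / A) / 2 - ln (std_normal_density v / B) / 2 + ln 2 / 2
    \<le> G * ((A + B) / sqrt 2) / std_normal_density ((u - v) / sqrt 2) - 1 + u * v / 2"
proof -
  define R where "R = G * ((A + B) / sqrt 2) / std_normal_density ((u - v) / sqrt 2)"
  have "(sqrt A - sqrt B)\<^sup>2 \<ge> 0" by simp
  then have "sqrt A * sqrt B \<le> (A + B) / 2"
    using assms by (simp add: power2_diff)
  then have "ln (sqrt A * sqrt B) \<le> ln ((A + B) / 2)" using assms by simp
  then have am: "ln A / 2 + ln B / 2 \<le> ln ((A + B) / 2)"
    using assms by (simp add: ln_mult ln_sqrt)
  have s2: "ln (sqrt 2) = ln (2::real) / 2" by (simp add: ln_sqrt)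
  have lnphi: "ln (std_normal_density w) = - ln (sqrt (2 * pi)) - w\<^sup>2 / 2" for w
    by (simp add: std_normal_density_def ln_mult ln_div)
  have "ln R = ln G + (ln (A + B) - ln (sqrt 2)) - ln (std_normal_density ((u - v) / sqrt 2))"
    using assms by (simp add: R_def ln_mult ln_div)
  also have "\<dots> = ln G + (ln ((A + B) / 2) + ln 2 / 2) - ln (std_normal_density ((u - v) / sqrt 2))"
    using assms by (simp add: ln_div s2)
  finally have lnR: "ln R = ln G + ln ((A + B) / 2) + ln 2 / 2 + ln (sqrt (2 * pi)) + (u - v)\<^sup>2 / 4"
    unfolding lnphi by (simp add: power_divide)
  have "ln R \<le> R - 1" using assms by (intro ln_le_minus_one) (simp add: R_def)
  moreover have "ln (std_normal_density u / A) = - ln (sqrt (2 * pi)) - u\<^sup>2 / 2 - ln A"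
    "ln (std_normal_density v / B) = - ln (sqrt (2 * pi)) - v\<^sup>2 / 2 - ln B"
    using assms lnphi by (simp_all add: ln_div)
  moreover have "(u - v)\<^sup>2 = u\<^sup>2 - 2 * (u * v) + v\<^sup>2" by (simp add: power2_diff)
  ultimately show ?thesis
    using am lnR unfolding R_def[symmetric] by linarith
qed

text \<open>Cutting positive continuous functions off at a compact interval, with
  \<open>ln g\<close> bounded on its differences, bounds all three logarithms at the transported
  points. The transported integrand is then a bounded function on a probability space, hence
  integrable. The entropies of both densities and the constant sit inside the integrand, which is
  why the bound is 0.\<close>

lemma epi_continuous:
  fixes f1 f2 g :: "real \<Rightarrow> real"
  assumes f1: "continuous_on UNIV f1" "\<And>x. 0 < f1 x" "integral {a..b} f1 = 1"
    and f2: "continuous_on UNIV f2" "\<And>x. 0 < f2 x" "integral {a..b} f2 = 1"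
    and ab: "a < b"
    and g: "integrable lborel g" "\<And>x. 0 < g x" "(\<integral>x. g x \<partial>lborel) \<le> 1"
    and bnd: "\<And>x. x \<in> {a - b..b - a} \<Longrightarrow> \<bar>ln (g x)\<bar> \<le> c"
  shows "(LINT z|(lborel \<Otimes>\<^sub>M lborel). epi_integrand (-) (ln 2 / 2)
    (\<lambda>x. indicator {a..b} x * f1 x) (\<lambda>x. indicator {a..b} x * f2 x) g z) \<le> 0"
proof -
  let ?N = std_normal_distribution
  let ?\<phi> = std_normal_density
  define h1 h2 where "h1 x = indicator {a..b} x * f1 x" and "h2 x = indicator {a..b} x * f2 x" for x
  obtain T1 T1' where T1: "\<And>u. (T1 has_real_derivative T1' u) (at u)" "\<And>u. 0 < T1' u"
    "\<And>u. T1 u \<in> {a<..<b}" "\<And>u. f1 (T1 u) * T1' u = ?\<phi> u"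
    "distr ?N borel T1 = density lborel (\<lambda>x. ennreal (h1 x))"
    by (rule transport_from_std_normal[OF f1(1,2) ab f1(3), folded h1_def], rule that)
  obtain T2 T2' where T2: "\<And>u. (T2 has_real_derivative T2' u) (at u)" "\<And>u. 0 < T2' u"
    "\<And>u. T2 u \<in> {a<..<b}" "\<And>u. f2 (T2 u) * T2' u = ?\<phi> u"
    "distr ?N borel T2 = density lborel (\<lambda>x. ennreal (h2 x))"
    by (rule transport_from_std_normal[OF f2(1,2) ab f2(3), folded h2_def], rule that)
  have T': "f1 (T1 u) = ?\<phi> u / T1' u" "f2 (T2 u) = ?\<phi> u / T2' u"
    "T1' u = ?\<phi> u / f1 (T1 u)" "T2' u = ?\<phi> u / f2 (T2 u)" for u
  proof -
    have "0 < T1' u" "0 < f1 (T1 u)" by (rule T1(2), rule f1(2))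
    then show "f1 (T1 u) = ?\<phi> u / T1' u" "T1' u = ?\<phi> u / f1 (T1 u)"
      unfolding T1(4)[symmetric] by simp_all
    have "0 < T2' u" "0 < f2 (T2 u)" by (rule T2(2), rule f2(2))
    then show "f2 (T2 u) = ?\<phi> u / T2' u" "T2' u = ?\<phi> u / f2 (T2 u)"
      unfolding T2(4)[symmetric] by simp_all
  qed
  have mf[measurable]: "f1 \<in> borel_measurable borel" "f2 \<in> borel_measurable borel"
    using f1(1) f2(1) by (auto intro: borel_measurable_continuous_onI)
  have mg[measurable]: "g \<in> borel_measurable borel" using g(1) by auto
  have mh[measurable]: "h1 \<in> borel_measurable borel" "h2 \<in> borel_measurable borel"
    unfolding h1_def[abs_def] h2_def[abs_def] by measurable
  have mT[measurable]: "T1 \<in> borel_measurable borel" "T2 \<in> borel_measurable borel"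
    by (intro borel_measurable_continuous_onI continuous_at_imp_continuous_on ballI DERIV_isCont[OF T1(1)]
        DERIV_isCont[OF T2(1)])+
  have mT'[measurable]: "T1' \<in> borel_measurable borel" "T2' \<in> borel_measurable borel"
    unfolding T'(3,4)[abs_def] by measurable
  interpret N: prob_space ?N by (rule prob_space_normal_density) simp
  interpret NN: pair_prob_space ?N ?N ..
  define Q where "Q x y = ln (g (x - y)) - ln (f1 x) / 2 - ln (f2 y) / 2 + ln 2 / 2" for x y
  have mQ[measurable]: "case_prod Q \<in> borel_measurable (borel \<Otimes>\<^sub>M borel)"
    unfolding Q_def[abs_def] by measurable
  \<comment> \<open>The quotient of \<open>ln_le_transport\<close> at the transported points. Its
    mean under two independent standard normals is at most 1, which offsets the -1 in the pointwise
    bound \<open>QR\<close>.\<close>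
  define R where "R u v = g (T1 u - T2 v) * ((T1' u + T2' v) / sqrt 2) / ?\<phi> ((u - v) / sqrt 2)" for u v
  have R0: "0 \<le> R u v" for u v
    unfolding R_def using g(2) T1(2) T2(2) by (simp add: less_imp_le add_nonneg_nonneg)
  have mR[measurable]: "case_prod R \<in> borel_measurable (borel \<Otimes>\<^sub>M borel)"
    unfolding R_def[abs_def] by measurable
  have QR: "Q (T1 u) (T2 v) \<le> R u v - 1 + u * v / 2" for u v
    unfolding Q_def R_def T'(1,2) using ln_le_transport[of "g (T1 u - T2 v)" "T1' u" "T2' v" u v] g(2) T1(2) T2(2)
    by simp
  \<comment> \<open>After the rotation the normal weight is \<phi>(\<beta>) \<phi>(\<alpha>), by
    rotation invariance, and \<phi>(\<alpha>) cancels the denominator of \<open>R\<close>. For fixed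
    \<beta> this leaves the integral of \<open>g (\<Theta> \<alpha>) * \<Theta>' \<alpha>\<close>,
    which is at most the mass of \<open>g\<close>.\<close>
  have nnR: "(\<integral>\<^sup>+z. ennreal (case_prod R z) \<partial>(?N \<Otimes>\<^sub>M ?N)) \<le> 1"
  proof -
    have "(\<integral>\<^sup>+z. ennreal (case_prod R z) \<partial>(?N \<Otimes>\<^sub>M ?N)) = (\<integral>\<^sup>+u. \<integral>\<^sup>+v. ennreal (R u v) \<partial>?N \<partial>?N)"
      by (subst N.nn_integral_fst[symmetric]) auto
    also have "\<dots> = (\<integral>\<^sup>+u. \<integral>\<^sup>+v. ennreal (?\<phi> u) * (ennreal (?\<phi> v) * ennreal (R u v)) \<partial>lborel \<partial>lborel)"
      by (simp add: nn_integral_density nn_integral_cmult[symmetric])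
    also have "\<dots> = (\<integral>\<^sup>+\<beta>. \<integral>\<^sup>+\<alpha>. ennreal (?\<phi> ((\<beta> + \<alpha>) / sqrt 2)) * (ennreal (?\<phi> ((\<beta> - \<alpha>) / sqrt 2))
        * ennreal (R ((\<beta> + \<alpha>) / sqrt 2) ((\<beta> - \<alpha>) / sqrt 2))) \<partial>lborel \<partial>lborel)"
      by (rule nn_integral_lborel_rotate) measurable
    also have "\<dots> \<le> (\<integral>\<^sup>+\<beta>. ennreal (?\<phi> \<beta>) \<partial>lborel)"
    proof (rule nn_integral_mono)
      fix \<beta> :: real
      define \<Theta> where "\<Theta> \<alpha> = T1 ((\<beta> + \<alpha>) / sqrt 2) - T2 ((\<beta> - \<alpha>) / sqrt 2)" for \<alpha>
      define \<Theta>' where "\<Theta>' \<alpha> = (T1' ((\<beta> + \<alpha>) / sqrt 2) + T2' ((\<beta> - \<alpha>) / sqrt 2)) / sqrt 2" for \<alpha>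
      have D: "(\<Theta> has_real_derivative \<Theta>' \<alpha>) (at \<alpha>)" for \<alpha>
      proof -
        have "((\<lambda>\<alpha>. T1 ((\<beta> + \<alpha>) / sqrt 2)) has_real_derivative T1' ((\<beta> + \<alpha>) / sqrt 2) * (1 / sqrt 2)) (at \<alpha>)"
        proof (rule DERIV_chain2[OF T1(1)])
          show "((\<lambda>\<alpha>. (\<beta> + \<alpha>) / sqrt 2) has_real_derivative 1 / sqrt 2) (at \<alpha>)"
            by (rule DERIV_cdivide) (auto intro!: derivative_eq_intros)
        qed
        moreover have "((\<lambda>\<alpha>. T2 ((\<beta> - \<alpha>) / sqrt 2)) has_real_derivative T2' ((\<beta> - \<alpha>) / sqrt 2) * (- 1 / sqrt 2)) (at \<alpha>)"
        proof (rule DERIV_chain2[OF T2(1)])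
          show "((\<lambda>\<alpha>. (\<beta> - \<alpha>) / sqrt 2) has_real_derivative - 1 / sqrt 2) (at \<alpha>)"
            by (rule DERIV_cdivide) (auto intro!: derivative_eq_intros)
        qed
        ultimately have "(\<Theta> has_real_derivative T1' ((\<beta> + \<alpha>) / sqrt 2) * (1 / sqrt 2)
            - T2' ((\<beta> - \<alpha>) / sqrt 2) * (- 1 / sqrt 2)) (at \<alpha>)"
          unfolding \<Theta>_def[abs_def] by (rule DERIV_diff)
        then show ?thesis by (simp add: \<Theta>'_def add_divide_distrib)
      qed
      have pos: "0 < \<Theta>' \<alpha>" for \<alpha> unfolding \<Theta>'_def using T1(2) T2(2) by (simp add: add_pos_pos)
      have phi: "?\<phi> ((\<beta> + \<alpha>) / sqrt 2) * ?\<phi> ((\<beta> - \<alpha>) / sqrt 2) = ?\<phi> \<beta> * ?\<phi> \<alpha>" for \<alpha>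
      proof -
        have "((\<beta> + \<alpha>) / sqrt 2)\<^sup>2 + ((\<beta> - \<alpha>) / sqrt 2)\<^sup>2 = \<beta>\<^sup>2 + \<alpha>\<^sup>2"
          by (simp add: power_divide power2_sum power2_diff field_simps)
        then have "- ((\<beta> + \<alpha>) / sqrt 2)\<^sup>2 / 2 + - ((\<beta> - \<alpha>) / sqrt 2)\<^sup>2 / 2 = - \<beta>\<^sup>2 / 2 + - \<alpha>\<^sup>2 / 2" by simp
        then have "exp (- ((\<beta> + \<alpha>) / sqrt 2)\<^sup>2 / 2) * exp (- ((\<beta> - \<alpha>) / sqrt 2)\<^sup>2 / 2)
          = exp (- \<beta>\<^sup>2 / 2) * exp (- \<alpha>\<^sup>2 / 2)" unfolding exp_add[symmetric] by simp
        then show ?thesis unfolding std_normal_density_def by (simp only: mult.assoc mult.left_commute)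
      qed
      have "ennreal (?\<phi> ((\<beta> + \<alpha>) / sqrt 2)) * (ennreal (?\<phi> ((\<beta> - \<alpha>) / sqrt 2))
        * ennreal (R ((\<beta> + \<alpha>) / sqrt 2) ((\<beta> - \<alpha>) / sqrt 2)))
        = ennreal (?\<phi> \<beta>) * ennreal (g (\<Theta> \<alpha>) * \<Theta>' \<alpha>)" for \<alpha>
      proof -
        have "R ((\<beta> + \<alpha>) / sqrt 2) ((\<beta> - \<alpha>) / sqrt 2) = g (\<Theta> \<alpha>) * \<Theta>' \<alpha> / ?\<phi> \<alpha>"
          by (simp add: R_def \<Theta>_def \<Theta>'_def diff_divide_distrib[symmetric])
        then have "?\<phi> ((\<beta> + \<alpha>) / sqrt 2) * (?\<phi> ((\<beta> - \<alpha>) / sqrt 2) * R ((\<beta> + \<alpha>) / sqrt 2) ((\<beta> - \<alpha>) / sqrt 2))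
          = ?\<phi> \<beta> * (g (\<Theta> \<alpha>) * \<Theta>' \<alpha>)"
          using phi[of \<alpha>] std_normal_density_pos[of \<alpha>] by (simp add: mult.assoc[symmetric])
        moreover have "ennreal x * (ennreal y * ennreal r) = ennreal (x * (y * r))"
          if "0 \<le> x" "0 \<le> y" "0 \<le> r" for x y r
          using that by (simp add: ennreal_mult)
        moreover have "ennreal (?\<phi> \<beta>) * ennreal (g (\<Theta> \<alpha>) * \<Theta>' \<alpha>) = ennreal (?\<phi> \<beta> * (g (\<Theta> \<alpha>) * \<Theta>' \<alpha>))"
          by (rule ennreal_mult'[symmetric]) simp
        ultimately show ?thesis
          by (simp only: R0 normal_density_nonneg)
      qed
      then have "(\<integral>\<^sup>+\<alpha>. ennreal (?\<phi> ((\<beta> + \<alpha>) / sqrt 2)) * (ennreal (?\<phi> ((\<beta> - \<alpha>) / sqrt 2))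
        * ennreal (R ((\<beta> + \<alpha>) / sqrt 2) ((\<beta> - \<alpha>) / sqrt 2))) \<partial>lborel)
        = (\<integral>\<^sup>+\<alpha>. ennreal (?\<phi> \<beta>) * ennreal (g (\<Theta> \<alpha>) * \<Theta>' \<alpha>) \<partial>lborel)" by simp
      also have "\<dots> = ennreal (?\<phi> \<beta>) * (\<integral>\<^sup>+\<alpha>. ennreal (g (\<Theta> \<alpha>) * \<Theta>' \<alpha>) \<partial>lborel)"
        unfolding \<Theta>_def \<Theta>'_def by (rule nn_integral_cmult) measurable
      also have "\<dots> \<le> ennreal (?\<phi> \<beta>) * 1"
      proof (rule mult_left_mono)
        have "(\<integral>\<^sup>+\<alpha>. ennreal (g (\<Theta> \<alpha>) * \<Theta>' \<alpha>) \<partial>lborel) \<le> ennreal (\<integral>x. g x \<partial>lborel)"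
          by (rule nn_integral_substitution_le[OF D pos g(1) less_imp_le[OF g(2)]])
        also have "\<dots> \<le> 1" using g(3) by simp
        finally show "(\<integral>\<^sup>+\<alpha>. ennreal (g (\<Theta> \<alpha>) * \<Theta>' \<alpha>) \<partial>lborel) \<le> 1" .
      qed simp
      finally show "(\<integral>\<^sup>+\<alpha>. ennreal (?\<phi> ((\<beta> + \<alpha>) / sqrt 2)) * (ennreal (?\<phi> ((\<beta> - \<alpha>) / sqrt 2))
        * ennreal (R ((\<beta> + \<alpha>) / sqrt 2) ((\<beta> - \<alpha>) / sqrt 2))) \<partial>lborel) \<le> ennreal (?\<phi> \<beta>)" by simp
    qed
    also have "\<dots> = 1"
      using nn_integral_eq_integral[of lborel std_normal_density] by simp
    finally show ?thesis .
  qed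
  have iR: "integrable (?N \<Otimes>\<^sub>M ?N) (case_prod R)"
  proof (rule integrableI_nonneg)
    have "(\<integral>\<^sup>+z. ennreal (case_prod R z) \<partial>(?N \<Otimes>\<^sub>M ?N)) < 2"
      using nnR by (rule le_less_trans) simp
    then show "(\<integral>\<^sup>+z. ennreal (case_prod R z) \<partial>(?N \<Otimes>\<^sub>M ?N)) < \<infinity>"
      by (rule less_le_trans) simp
  qed (use R0 in auto)
  have IR: "(LINT z|(?N \<Otimes>\<^sub>M ?N). case_prod R z) \<le> 1"
  proof -
    have "(\<integral>\<^sup>+z. ennreal (case_prod R z) \<partial>(?N \<Otimes>\<^sub>M ?N)) = ennreal (LINT z|(?N \<Otimes>\<^sub>M ?N). case_prod R z)"
      by (rule nn_integral_eq_integral[OF iR]) (use R0 in auto)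
    with nnR show ?thesis by (simp add: ennreal_le_1)
  qed
  have iid: "integrable ?N (\<lambda>u. u)" and Iid: "(LINT u|?N. u) = 0"
    using integrable_std_normal_distribution_moment[of 1] integral_std_normal_distribution_moment_odd[of 1] by simp_all
  have iuv: "integrable (?N \<Otimes>\<^sub>M ?N) (\<lambda>(u, v). u * v)"
    using NN.integrable_product[OF iid iid] by (simp add: case_prod_unfold)
  have Iuv: "(LINT z|(?N \<Otimes>\<^sub>M ?N). (\<lambda>(u, v). u * v) z) = 0"
    using NN.integral_product[OF iid iid] Iid by (simp add: case_prod_unfold)
  have bounded_ln: "\<exists>B. \<forall>x\<in>{a..b}. \<bar>ln (f x)\<bar> \<le> B" if "continuous_on UNIV f" "\<And>x. 0 < f x" for f :: "real \<Rightarrow> real"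
  proof -
    have "continuous_on {a..b} (\<lambda>x. ln (f x))"
    proof (intro continuous_on_ln continuous_on_subset[OF that(1)] ballI)
      show "f x \<noteq> 0" for x using that(2)[of x] by linarith
    qed simp
    then have "bounded ((\<lambda>x. ln (f x)) ` {a..b})"
      by (intro compact_imp_bounded compact_continuous_image) auto
    then show ?thesis by (auto simp: bounded_iff)
  qed
  obtain B1 where B1: "\<And>x. x \<in> {a..b} \<Longrightarrow> \<bar>ln (f1 x)\<bar> \<le> B1" using bounded_ln[OF f1(1,2)] by blast
  obtain B2 where B2: "\<And>x. x \<in> {a..b} \<Longrightarrow> \<bar>ln (f2 x)\<bar> \<le> B2" using bounded_ln[OF f2(1,2)] by blast
  have Qb: "\<bar>Q (T1 u) (T2 v)\<bar> \<le> c + B1 / 2 + B2 / 2 + ln 2 / 2" for u v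
  proof -
    have "T1 u - T2 v \<in> {a - b..b - a}" using T1(3)[of u] T2(3)[of v] by auto
    moreover have "T1 u \<in> {a..b}" "T2 v \<in> {a..b}" using T1(3)[of u] T2(3)[of v] by auto
    moreover have "0 \<le> ln (2::real)" by simp
    ultimately show ?thesis
      using bnd[of "T1 u - T2 v"] B1[of "T1 u"] B2[of "T2 v"] unfolding Q_def by linarith
  qed
  have iQ: "integrable (?N \<Otimes>\<^sub>M ?N) (\<lambda>(u, v). Q (T1 u) (T2 v))"
    using Qb by (intro NN.integrable_const_bound[where B="c + B1 / 2 + B2 / 2 + ln 2 / 2"]) (auto intro!: AE_I2)
  have D2: "prob_space (density lborel (\<lambda>x. ennreal (h2 x)))"
    unfolding T2(5)[symmetric] by (rule N.prob_space_distr) simp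
  interpret D2: prob_space "density lborel (\<lambda>x. ennreal (h2 x))" by (rule D2)
  have h0: "0 \<le> h1 x" "0 \<le> h2 x" for x
    using f1(2) f2(2) by (auto simp: h1_def h2_def less_imp_le)
  \<comment> \<open>The weights \<open>h1\<close> and \<open>h2\<close> turn the integral into the
    mean of \<open>Q\<close> under a product of two densities, which is the image of the product of
    two standard normals under (T1, T2). Where a weight vanishes the value of the logarithms does
    not matter.\<close>
  have "(LINT z|(lborel \<Otimes>\<^sub>M lborel). epi_integrand (-) (ln 2 / 2) h1 h2 g z)
    = (LINT z|(lborel \<Otimes>\<^sub>M lborel). (h1 (fst z) * h2 (snd z)) *\<^sub>R case_prod Q z)"
    by (intro Bochner_Integration.integral_cong) (auto simp: epi_integrand_def Q_def h1_def h2_def indicator_def)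
  also have "\<dots> = (LINT z|(density (lborel \<Otimes>\<^sub>M lborel) (\<lambda>z. ennreal (h1 (fst z) * h2 (snd z)))). case_prod Q z)"
    using h0 by (subst integral_density) auto
  also have "(\<lambda>z. ennreal (h1 (fst z) * h2 (snd z))) = (\<lambda>(x, y). ennreal (h1 x) * ennreal (h2 y))"
    using h0 by (auto simp: ennreal_mult)
  also have "density (lborel \<Otimes>\<^sub>M lborel) (\<lambda>(x, y). ennreal (h1 x) * ennreal (h2 y))
    = density lborel (\<lambda>x. ennreal (h1 x)) \<Otimes>\<^sub>M density lborel (\<lambda>x. ennreal (h2 x))"
    by (rule pair_measure_density[symmetric])
       (auto intro: D2.sigma_finite_measure_axioms lborel.sigma_finite_measure_axioms)
  also have "\<dots> = distr ?N borel T1 \<Otimes>\<^sub>M distr ?N borel T2" unfolding T1(5) T2(5) ..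
  also have "\<dots> = distr (?N \<Otimes>\<^sub>M ?N) (borel \<Otimes>\<^sub>M borel) (\<lambda>(u, v). (T1 u, T2 v))"
    by (rule pair_measure_distr) (auto simp: T2(5) D2.sigma_finite_measure_axioms)
  also have "(LINT z|\<dots>. case_prod Q z) = (LINT z|(?N \<Otimes>\<^sub>M ?N). (\<lambda>(u, v). Q (T1 u) (T2 v)) z)"
    by (subst integral_distr) (auto simp: case_prod_unfold)
  also have "\<dots> \<le> (LINT z|(?N \<Otimes>\<^sub>M ?N). case_prod R z - 1 + (\<lambda>(u, v). u * v) z / 2)"
  proof (rule integral_mono[OF iQ])
    show "integrable (?N \<Otimes>\<^sub>M ?N) (\<lambda>z. case_prod R z - 1 + (\<lambda>(u, v). u * v) z / 2)"
      using iR iuv by simp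
  qed (use QR in \<open>simp add: case_prod_unfold\<close>)
  also have "\<dots> = (LINT z|(?N \<Otimes>\<^sub>M ?N). case_prod R z) - 1"
    using iR iuv Iuv by (simp add: NN.prob_space)
  also have "\<dots> \<le> 0" using IR by simp
  finally show ?thesis unfolding h1_def[abs_def] h2_def[abs_def] .
qed

section \<open>Spaces with an entropy power inequality\<close>

text \<open>The two terms control the two signs: ln x \<le> x bounds x ln x by the square, and ln (1
  / r) \<le> 1 / r with r = sqrt x gives -x ln x \<le> 2 sqrt x.\<close>

lemma abs_x_ln_x_le:
  fixes x :: real
  assumes "0 \<le> x"
  shows "\<bar>x * ln x\<bar> \<le> 2 * sqrt x + x\<^sup>2"
proof (cases "x = 0")
  case False
  with assms have x: "0 < x" by simp
  have "ln x \<le> x" using ln_less_self[OF x] by simp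
  then have "x * ln x \<le> x * x" using x by (intro mult_left_mono) auto
  moreover have "- (x * ln x) \<le> 2 * sqrt x"
  proof -
    define r where "r = sqrt x"
    have r: "0 < r" "x = r * r" using x by (simp_all add: r_def)
    have "- ln r \<le> 1 / r" using ln_less_self[of "1 / r"] r by (simp add: ln_div)
    then have "2 * (r * r) * - ln r \<le> 2 * (r * r) * (1 / r)" using r by (intro mult_left_mono) auto
    moreover have "2 * (r * r) * (1 / r) = 2 * r" using r by simp
    moreover have "ln x = 2 * ln r" using r by (simp add: ln_mult)
    ultimately show ?thesis using r unfolding r_def[symmetric] by simp
  qed
  moreover have "0 \<le> sqrt x" "0 \<le> x * x" using x by auto
  ultimately show ?thesis unfolding power2_eq_square by linarith
qed simp

text \<open>With \<open>ln 0 = 0\<close> the function x ln x is continuous on the nonnegative reals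
  although \<open>ln\<close> is discontinuous at 0. Limits of the densities are therefore taken in
  integrands that are expanded into x ln x.\<close>

lemma tendsto_x_ln_x:
  fixes X :: "nat \<Rightarrow> real"
  assumes "X \<longlonglongrightarrow> x" "\<And>n. 0 \<le> X n"
  shows "(\<lambda>n. X n * ln (X n)) \<longlonglongrightarrow> x * ln x"
proof (cases "x = 0")
  case True
  have "(\<lambda>n. 2 * sqrt (X n) + (X n)\<^sup>2) \<longlonglongrightarrow> 2 * sqrt x + x\<^sup>2"
    by (intro tendsto_intros assms)
  then have "(\<lambda>n. 2 * sqrt (X n) + (X n)\<^sup>2) \<longlonglongrightarrow> 0" by (simp add: True)
  then have "(\<lambda>n. X n * ln (X n)) \<longlonglongrightarrow> 0"
    by (rule Lim_null_comparison[rotated]) (auto intro!: always_eventually abs_x_ln_x_le assms)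
  then show ?thesis by (simp add: True)
next
  case False
  then show ?thesis by (intro tendsto_intros assms)
qed

lemma AE_fst_pair_measure:
  assumes "sigma_finite_measure M2" "AE x in M1. P x"
  shows "AE z in M1 \<Otimes>\<^sub>M M2. P (fst z)"
proof -
  interpret M2: sigma_finite_measure M2 by fact
  obtain N where N: "{x \<in> space M1. \<not> P x} \<subseteq> N" "emeasure M1 N = 0" "N \<in> sets M1"
    using assms(2) by (rule AE_E)
  have "emeasure (M1 \<Otimes>\<^sub>M M2) (N \<times> space M2) = 0"
    using N by (simp add: M2.emeasure_pair_measure_Times)
  then show ?thesis
    by (intro AE_I[of _ _ "N \<times> space M2"]) (use N in \<open>auto simp: space_pair_measure\<close>)
qed

lemma AE_snd_pair_measure:
  assumes "sigma_finite_measure M2" "AE x in M2. P x"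
  shows "AE z in M1 \<Otimes>\<^sub>M M2. P (snd z)"
proof -
  interpret M2: sigma_finite_measure M2 by fact
  obtain N where N: "{x \<in> space M2. \<not> P x} \<subseteq> N" "emeasure M2 N = 0" "N \<in> sets M2"
    using assms(2) by (rule AE_E)
  have "emeasure (M1 \<Otimes>\<^sub>M M2) (space M1 \<times> N) = 0"
    using N by (simp add: M2.emeasure_pair_measure_Times)
  then show ?thesis
    by (intro AE_I[of _ _ "space M1 \<times> N"]) (use N in \<open>auto simp: space_pair_measure\<close>)
qed

section \<open>Abstract spaces with a difference and a reference density\<close>

definition bdd_supp :: "'x measure \<Rightarrow> 'x set \<Rightarrow> ('x \<Rightarrow> real) \<Rightarrow> bool" where
  "bdd_supp M A f \<longleftrightarrow> f \<in> borel_measurable M \<and>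
    (\<exists>C. \<forall>x\<in>space M. 0 \<le> f x \<and> f x \<le> C \<and> (x \<notin> A \<longrightarrow> f x = 0))"

definition comparable :: "'x measure \<Rightarrow> ('x \<Rightarrow> real) \<Rightarrow> ('x \<Rightarrow> real) \<Rightarrow> bool" where
  "comparable M w g \<longleftrightarrow> g \<in> borel_measurable M \<and>
    (\<exists>c>0. \<forall>x\<in>space M. c * w x \<le> g x \<and> g x \<le> w x / c)"

text \<open>The difference \<open>d\<close> is abstract so that products and coordinate spaces are
  covered alike. \<open>w_bounds\<close> makes \<open>ln w\<close>, and with it \<open>ln g\<close>
  for every comparable \<open>g\<close>, bounded on differences of points of one \<open>B n\<close>.
  Exhaustion of the space by the sets \<open>B n\<close> enters separately, as the hypothesis
  \<open>exh\<close> of the lemma on general densities.\<close>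

locale reference_space = sigma_finite_measure M
  for M :: "'x measure" and d :: "'x \<Rightarrow> 'x \<Rightarrow> 'x" and w :: "'x \<Rightarrow> real" and B :: "nat \<Rightarrow> 'x set" +
  assumes d_measurable[measurable]: "(\<lambda>(x, y). d x y) \<in> M \<Otimes>\<^sub>M M \<rightarrow>\<^sub>M M"
    and w_integrable: "integrable M w" and w_integral: "(\<integral>x. w x \<partial>M) = 1"
    and w_pos: "\<And>x. x \<in> space M \<Longrightarrow> 0 < w x"
    and B_sets[measurable]: "\<And>n. B n \<in> sets M" and B_finite: "\<And>n. emeasure M (B n) < \<top>"
    and w_bounds: "\<And>n. \<exists>c>0. \<forall>x\<in>B n. \<forall>y\<in>B n. c \<le> w (d x y) \<and> w (d x y) \<le> 1 / c"
begin

lemma w_measurable[measurable]: "w \<in> borel_measurable M"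
  using w_integrable by auto

lemma bdd_supp_integrable:
  assumes "bdd_supp M (B n) f"
  shows "integrable M f"
proof -
  obtain C where [measurable]: "f \<in> borel_measurable M"
    and C: "\<And>x. x \<in> space M \<Longrightarrow> 0 \<le> f x \<and> f x \<le> C \<and> (x \<notin> B n \<longrightarrow> f x = 0)"
    using assms unfolding bdd_supp_def by blast
  show ?thesis
    using C by (intro integrableI_bounded_set[where A="B n" and B=C] AE_I2) (auto simp: B_finite)
qed

lemma comparable_integrable:
  assumes "comparable M w g"
  shows "integrable M g" "0 < (\<integral>x. g x \<partial>M)"
proof -
  obtain c where [measurable]: "g \<in> borel_measurable M" and "0 < c"
    and c: "\<And>x. x \<in> space M \<Longrightarrow> c * w x \<le> g x \<and> g x \<le> w x / c"
    using assms unfolding comparable_def by blast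
  have g0: "0 \<le> g x" if "x \<in> space M" for x
    using c[OF that] mult_pos_pos[OF \<open>0 < c\<close> w_pos[OF that]] by linarith
  show ig: "integrable M g"
  proof (rule Bochner_Integration.integrable_bound)
    show "integrable M (\<lambda>x. w x / c)" using w_integrable by simp
    show "AE x in M. norm (g x) \<le> norm (w x / c)"
    proof (rule AE_I2)
      fix x assume "x \<in> space M"
      then show "norm (g x) \<le> norm (w x / c)" using c[OF \<open>x \<in> space M\<close>] g0[OF \<open>x \<in> space M\<close>] unfolding real_norm_def by linarith
    qed
  qed measurable
  have "c * 1 \<le> (\<integral>x. g x \<partial>M)"
    unfolding w_integral[symmetric] integral_mult_right_zero[symmetric]
    using c by (intro integral_mono ig integrable_mult_right w_integrable) auto
  then show "0 < (\<integral>x. g x \<partial>M)" using \<open>0 < c\<close> by simp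
qed

text \<open>\<open>ln (f1 x)\<close> is unbounded where \<open>f1\<close> is small, but it occurs
  only multiplied by \<open>f1 x\<close>, and x ln x is bounded on bounded sets; likewise for
  \<open>f2\<close>. The factor \<open>ln (g (d x y))\<close> is bounded for points of
  \<open>B n\<close> by comparability.\<close>

lemma epi_integrand_bounded:
  assumes "bdd_supp M (B n) f1" "bdd_supp M (B n) f2" "comparable M w g"
  obtains K where "\<And>z. z \<in> space (M \<Otimes>\<^sub>M M) \<Longrightarrow> \<bar>epi_integrand d k f1 f2 g z\<bar> \<le> K"
    "\<And>z. z \<in> space (M \<Otimes>\<^sub>M M) \<Longrightarrow> z \<notin> B n \<times> B n \<Longrightarrow> epi_integrand d k f1 f2 g z = 0"
proof -
  obtain C1 where C1: "\<And>x. x \<in> space M \<Longrightarrow> 0 \<le> f1 x \<and> f1 x \<le> C1 \<and> (x \<notin> B n \<longrightarrow> f1 x = 0)"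
    using assms(1) unfolding bdd_supp_def by blast
  obtain C2 where C2: "\<And>x. x \<in> space M \<Longrightarrow> 0 \<le> f2 x \<and> f2 x \<le> C2 \<and> (x \<notin> B n \<longrightarrow> f2 x = 0)"
    using assms(2) unfolding bdd_supp_def by blast
  obtain c where "0 < c" and c: "\<And>x. x \<in> space M \<Longrightarrow> c * w x \<le> g x \<and> g x \<le> w x / c"
    using assms(3) unfolding comparable_def by blast
  obtain c' where "0 < c'" and c': "\<And>x y. x \<in> B n \<Longrightarrow> y \<in> B n \<Longrightarrow> c' \<le> w (d x y) \<and> w (d x y) \<le> 1 / c'"
    using w_bounds[of n] by blast
  \<comment> \<open>On differences of points of \<open>B n\<close> the values of \<open>g\<close>
    lie between c * c' and its reciprocal, so one logarithm bounds both sides.\<close>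
  define L where "L = \<bar>ln (c * c')\<bar>"
  have lng: "\<bar>ln (g (d x y))\<bar> \<le> L" if "x \<in> B n" "y \<in> B n" "d x y \<in> space M" for x y
  proof -
    have l: "c * c' \<le> g (d x y)"
      using c[OF that(3)] c'[OF that(1,2)] mult_left_mono[of c' "w (d x y)" c] \<open>0 < c\<close> by linarith
    have "g (d x y) \<le> (1 / c') / c"
      using c[OF that(3)] c'[OF that(1,2)] divide_right_mono[of "w (d x y)" "1 / c'" c] \<open>0 < c\<close> by linarith
    then have u: "g (d x y) \<le> 1 / (c * c')" by (simp add: mult.commute)
    have p: "0 < c * c'" using \<open>0 < c\<close> \<open>0 < c'\<close> by simp
    have "ln (c * c') \<le> ln (g (d x y))" using l p by (subst ln_le_cancel_iff) auto
    moreover have "ln (g (d x y)) \<le> ln (1 / (c * c'))" using l u p by (subst ln_le_cancel_iff) auto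
    then have "ln (g (d x y)) \<le> - ln (c * c')" using \<open>0 < c\<close> \<open>0 < c'\<close> by (simp add: ln_div)
    ultimately show ?thesis unfolding L_def by linarith
  qed
  define D1 D2 where "D1 = 2 * sqrt C1 + C1\<^sup>2" and "D2 = 2 * sqrt C2 + C2\<^sup>2"
  have xlnx: "\<bar>x * ln x\<bar> \<le> 2 * sqrt C + C\<^sup>2" if "0 \<le> x" "x \<le> C" for x C :: real
    using abs_x_ln_x_le[OF that(1)] real_sqrt_le_mono[OF that(2)] power_mono[OF that(2,1), of 2] by linarith
  define K where "K = \<bar>C1 * C2\<bar> * (L + \<bar>k\<bar>) + D1 * \<bar>C2\<bar> / 2 + \<bar>C1\<bar> * D2 / 2"
  have z: "epi_integrand d k f1 f2 g (x, y) = 0" if "x \<in> space M" "y \<in> space M" "x \<notin> B n \<or> y \<notin> B n" for x y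
    using C1[OF that(1)] C2[OF that(2)] that(3) by (auto simp: epi_integrand_def)
  have D0: "0 \<le> D1" "0 \<le> D2" if "x \<in> space M" for x
    using C1[OF that] C2[OF that] by (auto simp: D1_def D2_def)
  have bd: "\<bar>epi_integrand d k f1 f2 g (x, y)\<bar> \<le> K" if xy: "x \<in> space M" "y \<in> space M" for x y
  proof (cases "x \<in> B n \<and> y \<in> B n")
    case False
    have "0 \<le> K" unfolding K_def L_def using D0[OF xy(1)] by simp
    then show ?thesis using z[OF xy] False by auto
  next
    case True
    have dM: "d x y \<in> space M"
      using measurable_space[OF d_measurable, of "(x, y)"] xy by (simp add: space_pair_measure)
    have e: "epi_integrand d k f1 f2 g (x, y) = f1 x * f2 y * (ln (g (d x y)) + k)
        - (f1 x * ln (f1 x)) * f2 y / 2 - f1 x * (f2 y * ln (f2 y)) / 2"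
      by (simp add: epi_integrand_def algebra_simps)
    have a1: "\<bar>f1 x\<bar> \<le> \<bar>C1\<bar>" "\<bar>f2 y\<bar> \<le> \<bar>C2\<bar>" using C1[OF xy(1)] C2[OF xy(2)] by auto
    have a2: "\<bar>f1 x * ln (f1 x)\<bar> \<le> D1" "\<bar>f2 y * ln (f2 y)\<bar> \<le> D2"
      using xlnx C1[OF xy(1)] C2[OF xy(2)] by (simp_all add: D1_def D2_def)
    have "\<bar>f1 x * f2 y * (ln (g (d x y)) + k)\<bar> \<le> \<bar>C1 * C2\<bar> * (L + \<bar>k\<bar>)"
      unfolding abs_mult using lng[of x y] True dM a1
      by (intro mult_mono) (auto intro: order_trans[OF abs_triangle_ineq])
    moreover have "\<bar>(f1 x * ln (f1 x)) * f2 y\<bar> \<le> D1 * \<bar>C2\<bar>"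
      unfolding abs_mult[of "f1 x * ln (f1 x)"] using a1 a2 D0[OF xy(1)] by (intro mult_mono) auto
    moreover have "\<bar>f1 x * (f2 y * ln (f2 y))\<bar> \<le> \<bar>C1\<bar> * D2"
      unfolding abs_mult[of "f1 x"] using a1 a2 by (intro mult_mono) auto
    ultimately show ?thesis unfolding e K_def by linarith
  qed
  show thesis
  proof (rule that[of K])
    fix z assume "z \<in> space (M \<Otimes>\<^sub>M M)"
    then show "\<bar>epi_integrand d k f1 f2 g z\<bar> \<le> K"
      using bd[of "fst z" "snd z"] by (auto simp: space_pair_measure)
  next
    fix u assume "u \<in> space (M \<Otimes>\<^sub>M M)" "u \<notin> B n \<times> B n"
    then show "epi_integrand d k f1 f2 g u = 0"
      using z[of "fst u" "snd u"] by (auto simp: space_pair_measure mem_Times_iff)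
  qed
qed

lemma epi_integrand_measurable[measurable]:
  assumes [measurable]: "f1 \<in> borel_measurable M" "f2 \<in> borel_measurable M" "g \<in> borel_measurable M"
  shows "epi_integrand d k f1 f2 g \<in> borel_measurable (M \<Otimes>\<^sub>M M)"
  unfolding epi_integrand_def by measurable

lemma emeasure_B_Times: "emeasure (M \<Otimes>\<^sub>M M) (B n \<times> B n) < \<top>"
  using B_finite[of n] by (simp add: emeasure_pair_measure_Times ennreal_mult_less_top)

lemma epi_integrand_integrable:
  assumes "bdd_supp M (B n) f1" "bdd_supp M (B n) f2" "comparable M w g"
  shows "integrable (M \<Otimes>\<^sub>M M) (epi_integrand d k f1 f2 g)"
proof -
  obtain K where K: "\<And>z. z \<in> space (M \<Otimes>\<^sub>M M) \<Longrightarrow> \<bar>epi_integrand d k f1 f2 g z\<bar> \<le> K"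
    "\<And>z. z \<in> space (M \<Otimes>\<^sub>M M) \<Longrightarrow> z \<notin> B n \<times> B n \<Longrightarrow> epi_integrand d k f1 f2 g z = 0"
    using epi_integrand_bounded[OF assms] by blast
  have [measurable]: "f1 \<in> borel_measurable M" "f2 \<in> borel_measurable M" "g \<in> borel_measurable M"
    using assms by (auto simp: bdd_supp_def comparable_def)
  show ?thesis
    using K emeasure_B_Times[of n] by (intro integrableI_bounded_set[where A="B n \<times> B n" and B=K] AE_I2) auto
qed

end

text \<open>
  The total masses of \<open>f1\<close>, \<open>f2\<close> and \<open>g\<close> are arbitrary because the slices of a density on a product
  space are not normalized. The reference density \<open>w\<close> controls \<open>g\<close> from both sides in a way that is
  inherited by slices and marginals.
\<close>

locale epi_space = reference_space M d w B
  for M :: "'x measure" and d w B +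
  fixes k :: real
  assumes epi: "\<And>n f1 f2 g. bdd_supp M (B n) f1 \<Longrightarrow> bdd_supp M (B n) f2 \<Longrightarrow> comparable M w g \<Longrightarrow>
    (\<integral>z. epi_integrand d k f1 f2 g z \<partial>(M \<Otimes>\<^sub>M M)) \<le>
      (\<integral>x. f1 x \<partial>M) * (\<integral>x. f2 x \<partial>M) *
      (ln (\<integral>x. g x \<partial>M) - ln (\<integral>x. f1 x \<partial>M) / 2 - ln (\<integral>x. f2 x \<partial>M) / 2)"

section \<open>The inequality on the real line for bounded measurable functions\<close>

lemma std_normal_density_le_1: "std_normal_density x \<le> 1"
proof -
  have "1 * 1 \<le> sqrt (2 * pi)" using pi_gt3 by (simp add: real_le_rsqrt)
  then have "1 / sqrt (2 * pi) \<le> 1" by simp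
  moreover have "exp (- x\<^sup>2 / 2) \<le> 1" by simp
  ultimately show ?thesis unfolding std_normal_density_def
    by (intro mult_le_one) auto
qed

lemma std_normal_density_antimono:
  assumes "\<bar>x\<bar> \<le> y"
  shows "std_normal_density y \<le> std_normal_density x"
proof -
  have "x\<^sup>2 \<le> y\<^sup>2" using assms by (metis abs_ge_zero power2_abs power_mono)
  then show ?thesis unfolding std_normal_density_def by (intro mult_left_mono) auto
qed

lemma std_normal_density_bounds:
  "\<exists>c>0. \<forall>x\<in>{-real n..real n}. \<forall>y\<in>{-real n..real n}.
    c \<le> std_normal_density (x - y) \<and> std_normal_density (x - y) \<le> 1 / c"
proof (intro exI conjI ballI)
  \<comment> \<open>Differences of points of [-n, n] lie in [-2n, 2n], where the normal density is
    smallest at the ends. Since it never exceeds 1, the reciprocal of \<open>?c\<close> is an upper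
    bound.\<close>
  let ?c = "std_normal_density (2 * real n)"
  show "0 < ?c" by simp
  fix x y assume "x \<in> {-real n..real n}" "y \<in> {-real n..real n}"
  then have "\<bar>x - y\<bar> \<le> 2 * real n" by auto
  then show "?c \<le> std_normal_density (x - y)" by (rule std_normal_density_antimono)
  have "1 \<le> 1 / ?c" using std_normal_density_le_1[of "2 * real n"] by simp
  then show "std_normal_density (x - y) \<le> 1 / ?c"
    using std_normal_density_le_1[of "x - y"] by linarith
qed

interpretation std_normal_space: reference_space lborel "(-)" std_normal_density "\<lambda>n. {-real n..real n}"
proof unfold_locales
  show "\<exists>c>0. \<forall>x\<in>{- real n..real n}. \<forall>y\<in>{- real n..real n}.
    c \<le> std_normal_density (x - y) \<and> std_normal_density (x - y) \<le> 1 / c" for n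
    by (rule std_normal_density_bounds)
qed (auto simp: case_prod_unfold)

text \<open>Dividing \<open>h1\<close>, \<open>h2\<close> and \<open>g\<close> by their masses
  rescales the integrand and shifts it by a multiple of h1 h2, whose integral is the product of the
  masses; this produces the logarithms of the masses on the right. The hypothesis
  \<open>0 < n\<close> gives a nondegenerate interval, hence positive masses.\<close>

lemma epi_continuous_unnormalized:
  fixes f1 f2 g :: "real \<Rightarrow> real"
  assumes f1: "continuous_on UNIV f1" "\<And>x. 0 < f1 x" "\<And>x. f1 x \<le> C1"
    and f2: "continuous_on UNIV f2" "\<And>x. 0 < f2 x" "\<And>x. f2 x \<le> C2"
    and n: "0 < n" and g: "comparable lborel std_normal_density g"
  defines "h1 \<equiv> \<lambda>x. indicator {-real n..real n} x * f1 x"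
    and "h2 \<equiv> \<lambda>x. indicator {-real n..real n} x * f2 x"
  shows "(\<integral>z. epi_integrand (-) (ln 2 / 2) h1 h2 g z \<partial>(lborel \<Otimes>\<^sub>M lborel)) \<le>
      (\<integral>x. h1 x \<partial>lborel) * (\<integral>x. h2 x \<partial>lborel) *
      (ln (\<integral>x. g x \<partial>lborel) - ln (\<integral>x. h1 x \<partial>lborel) / 2 - ln (\<integral>x. h2 x \<partial>lborel) / 2)"
proof -
  let ?I = "{-real n..real n}"
  define F1 F2 G where "F1 = (\<integral>x. h1 x \<partial>lborel)" and "F2 = (\<integral>x. h2 x \<partial>lborel)" and "G = (\<integral>x. g x \<partial>lborel)"
  obtain c where "0 < c" and c: "\<And>x. c * std_normal_density x \<le> g x"
    using g by (auto simp: comparable_def)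
  have g_pos: "0 < g x" for x using mult_pos_pos[OF \<open>0 < c\<close> std_normal_density_pos] c[of x] by (rule less_le_trans)
  have ig: "integrable lborel g" and G: "0 < G"
    using std_normal_space.comparable_integrable[OF g] by (simp_all add: G_def)
  have int_pos: "0 < integral ?I f \<and> (\<integral>x. indicator ?I x * f x \<partial>lborel) = integral ?I f"
    if "continuous_on UNIV f" "\<And>x. 0 < f x" for f :: "real \<Rightarrow> real"
  proof -
    have co: "continuous_on ?I f" by (rule continuous_on_subset[OF that(1)]) simp
    have "set_integrable lborel ?I f" by (rule borel_integrable_atLeastAtMost') (rule co)
    then have "(LINT x:?I|lborel. f x) = integral ?I f"
      by (rule set_borel_integral_eq_integral)
    moreover have "integral ?I f \<noteq> 0"
    proof
      assume "integral ?I f = 0"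
      then have "\<forall>x\<in>?I. f x = 0"
        using integral_eq_0_iff[OF co _ less_imp_le[OF that(2)]] n by simp
      then have "f 0 = 0" by simp
      then show False using that(2)[of 0] by simp
    qed
    moreover have "0 \<le> integral ?I f"
      by (intro integral_nonneg integrable_continuous_interval co less_imp_le that(2))
    ultimately show ?thesis by (simp add: set_lebesgue_integral_def)
  qed
  have F1: "0 < F1" "integral ?I f1 = F1" using int_pos[OF f1(1,2)] by (simp_all add: F1_def h1_def)
  have F2: "0 < F2" "integral ?I f2 = F2" using int_pos[OF f2(1,2)] by (simp_all add: F2_def h2_def)
  have [measurable]: "f1 \<in> borel_measurable borel" "f2 \<in> borel_measurable borel"
    using f1(1) f2(1) by (auto intro: borel_measurable_continuous_onI)
  have bs1: "bdd_supp lborel ?I h1" unfolding bdd_supp_def h1_def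
    using f1(2,3) by (intro conjI exI[of _ "C1"]) (auto simp: indicator_def less_imp_le intro: order_trans[OF less_imp_le])
  have bs2: "bdd_supp lborel ?I h2" unfolding bdd_supp_def h2_def
    using f2(2,3) by (intro conjI exI[of _ "C2"]) (auto simp: indicator_def less_imp_le intro: order_trans[OF less_imp_le])
  have ie: "integrable (lborel \<Otimes>\<^sub>M lborel) (epi_integrand (-) (ln 2 / 2) h1 h2 g)"
    using bs1 bs2 g by (rule std_normal_space.epi_integrand_integrable)
  have ih: "integrable lborel h1" "integrable lborel h2"
    using std_normal_space.bdd_supp_integrable bs1 bs2 by auto
  have ihh: "integrable (lborel \<Otimes>\<^sub>M lborel) (\<lambda>z. h1 (fst z) * h2 (snd z))"
    and Ihh: "(\<integral>z. h1 (fst z) * h2 (snd z) \<partial>(lborel \<Otimes>\<^sub>M lborel)) = F1 * F2"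
    using lborel_pair.integrable_product[OF ih] lborel_pair.integral_product[OF ih] by (simp_all add: F1_def F2_def)
  have eq: "epi_integrand (-) (ln 2 / 2) (\<lambda>x. h1 x / F1) (\<lambda>x. h2 x / F2) (\<lambda>x. g x / G) z
    = (epi_integrand (-) (ln 2 / 2) h1 h2 g z
        - (ln G - ln F1 / 2 - ln F2 / 2) * (h1 (fst z) * h2 (snd z))) / (F1 * F2)" for z
  proof (cases "h1 (fst z) = 0 \<or> h2 (snd z) = 0")
    case True
    then show ?thesis by (auto simp: epi_integrand_def case_prod_unfold)
  next
    case False
    then show ?thesis
      using F1 F2 G less_imp_neq[OF g_pos[of "fst z - snd z"]]
      by (simp add: epi_integrand_def case_prod_unfold ln_div) (simp add: field_simps)
  qed
  have "(\<integral>z. epi_integrand (-) (ln 2 / 2) (\<lambda>x. h1 x / F1) (\<lambda>x. h2 x / F2) (\<lambda>x. g x / G) z \<partial>(lborel \<Otimes>\<^sub>M lborel)) \<le> 0"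
  proof -
    obtain e where "0 < e" and e: "\<And>x. g x \<le> std_normal_density x / e"
      using g by (auto simp: comparable_def)
    \<comment> \<open>On the differences in question \<open>g\<close> is at least c \<phi>(2n) and
      at most 1 / e; the last summand accounts for the normalization by \<open>G\<close>.\<close>
    define L where "L = \<bar>ln (c * std_normal_density (2 * real n))\<bar> + \<bar>ln (1 / e)\<bar> + \<bar>ln G\<bar>"
    have bnd: "\<bar>ln (g x / G)\<bar> \<le> L" if "x \<in> {-real n - real n..real n - (-real n)}" for x
    proof -
      have "\<bar>x\<bar> \<le> 2 * real n" using that by auto
      then have "c * std_normal_density (2 * real n) \<le> g x"
        using mult_left_mono[OF std_normal_density_antimono[of x "2 * real n"], of c] c[of x] \<open>0 < c\<close> by linarith
      then have 1: "ln (c * std_normal_density (2 * real n)) \<le> ln (g x)"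
        using \<open>0 < c\<close> g_pos[of x] by simp
      have "g x \<le> 1 / e"
        using e[of x] divide_right_mono[OF std_normal_density_le_1[of x], of e] \<open>0 < e\<close> by simp
      then have 2: "ln (g x) \<le> ln (1 / e)"
        using \<open>0 < e\<close> g_pos[of x] by (subst ln_le_cancel_iff) auto
      have "ln (g x / G) = ln (g x) - ln G" using g_pos[of x] G by (simp add: ln_div)
      then show ?thesis using 1 2 unfolding L_def by linarith
    qed
    have cd: "continuous_on UNIV (\<lambda>x. f1 x / F1)" "continuous_on UNIV (\<lambda>x. f2 x / F2)"
      using f1(1) f2(1) F1 F2 by (auto intro!: continuous_intros)
    have e1: "(\<lambda>x. h1 x / F1) = (\<lambda>x. indicator ?I x * (f1 x / F1))"
      and e2: "(\<lambda>x. h2 x / F2) = (\<lambda>x. indicator ?I x * (f2 x / F2))" by (simp_all add: h1_def h2_def)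
    show ?thesis unfolding e1 e2
    proof (rule epi_continuous[where c=L])
      show "integral ?I (\<lambda>x. f1 x / F1) = 1" "integral ?I (\<lambda>x. f2 x / F2) = 1"
        using F1 F2 by simp_all
      show "(\<integral>x. g x / G \<partial>lborel) \<le> 1" using G by (simp add: G_def)
      show "\<bar>ln (g x / G)\<bar> \<le> L" if "x \<in> {- real n - real n..real n - - real n}" for x
        using bnd that by simp
      show "0 < f1 x / F1" "0 < f2 x / F2" "0 < g x / G" for x
        using f1(2) f2(2) F1(1) F2(1) g_pos G by simp_all
    qed (use cd n ig in auto)
  qed
  then have "((\<integral>z. epi_integrand (-) (ln 2 / 2) h1 h2 g z \<partial>(lborel \<Otimes>\<^sub>M lborel))
      - (ln G - ln F1 / 2 - ln F2 / 2) * (F1 * F2)) / (F1 * F2) \<le> 0"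
    unfolding eq using ie ihh by (simp add: Ihh)
  then show ?thesis
    using mult_pos_pos[OF F1(1) F2(1)] unfolding F1_def[symmetric] F2_def[symmetric] G_def[symmetric]
    by (simp add: divide_le_0_iff mult.commute)
qed

text \<open>A measurable function is almost everywhere a limit of continuous functions. Clamping
  these between 1 / (j + 1) and \<open>C\<close> makes them positive and bounded without changing
  the limit; \<open>1 \<le> C\<close> keeps the lower clamp below the upper one.\<close>

lemma AE_continuous_approximation:
  fixes h :: "real \<Rightarrow> real"
  assumes [measurable]: "h \<in> borel_measurable borel" and h: "\<And>x. 0 \<le> h x" "\<And>x. h x \<le> C" and C: "1 \<le> C"
  obtains f where "\<And>j. continuous_on UNIV (f j)" "\<And>j x. 0 < f j x" "\<And>j x. f j x \<le> C"
    "AE x in lborel. (\<lambda>j. f j x) \<longlonglongrightarrow> h x"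
proof -
  have "h \<in> borel_measurable lebesgue" by (simp add: measurable_completion)
  then have "h measurable_on UNIV"
    using h(1) by (rule lebesgue_measurable_imp_measurable_on_nnreal_UNIV)
  then obtain N g where N: "negligible N" and g: "\<And>j. continuous_on UNIV (g j)"
    and lim: "\<And>x. x \<notin> N \<Longrightarrow> (\<lambda>j. g j x) \<longlonglongrightarrow> h x"
    unfolding measurable_on_def by auto
  define f where "f j x = max (1 / (real j + 1)) (min C (g j x))" for j :: nat and x
  show thesis
  proof (rule that[of f])
    show "continuous_on UNIV (f j)" for j
      unfolding f_def by (intro continuous_intros g)
    show "0 < f j x" for j x
      unfolding f_def by (simp add: less_max_iff_disj)
    show "f j x \<le> C" for j x
    proof -
      have "1 / (real j + 1) \<le> 1" by simp
      with C show ?thesis unfolding f_def by linarith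
    qed
    have "(\<lambda>j. f j x) \<longlonglongrightarrow> h x" if "x \<notin> N" for x
    proof -
      have "(\<lambda>j. f j x) \<longlonglongrightarrow> max 0 (min C (h x))"
        unfolding f_def using lim[OF that] LIMSEQ_Suc[OF lim_1_over_n]
        by (intro tendsto_intros) (simp_all add: add.commute)
      then show ?thesis using h[of x] by simp
    qed
    moreover have "AE x in lebesgue. x \<notin> N"
      using N by (intro AE_not_in) (simp add: negligible_iff_null_sets)
    ultimately have "AE x in lebesgue. (\<lambda>j. f j x) \<longlonglongrightarrow> h x" by (auto elim: eventually_mono)
    then show "AE x in lborel. (\<lambda>j. f j x) \<longlonglongrightarrow> h x"
      by (simp add: AE_completion_iff)
  qed
qed

text \<open>Dominated convergence leads from continuous to bounded measurable functions.
  \<open>g\<close> stays fixed throughout, and comparability with the normal density bounds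
  \<open>ln g\<close> on the square where the integrand lives, so \<open>ln g\<close> may enter the
  dominating function.\<close>

lemma epi_space_real: "epi_space lborel (-) std_normal_density (\<lambda>n. {-real n..real n}) (ln 2 / 2)"
proof (intro epi_space.intro epi_space_axioms.intro std_normal_space.reference_space_axioms)
  fix n :: nat and h1 h2 g :: "real \<Rightarrow> real"
  let ?I = "{-real n..real n}"
  let ?J = "\<lambda>h1 h2. \<integral>z. epi_integrand (-) (ln 2 / 2) h1 h2 g z \<partial>(lborel \<Otimes>\<^sub>M lborel)"
  let ?R = "\<lambda>h1 h2. (\<integral>x. h1 x \<partial>lborel) * (\<integral>x. h2 x \<partial>lborel) *
      (ln (\<integral>x. g x \<partial>lborel) - ln (\<integral>x. h1 x \<partial>lborel) / 2 - ln (\<integral>x. h2 x \<partial>lborel) / 2)"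
  assume h1: "bdd_supp lborel ?I h1" and h2: "bdd_supp lborel ?I h2"
    and g: "comparable lborel std_normal_density g"
  have m[measurable]: "h1 \<in> borel_measurable borel" "h2 \<in> borel_measurable borel"
    using h1 h2 by (auto simp: bdd_supp_def)
  have ih: "integrable lborel h1" "integrable lborel h2"
    using h1 h2 std_normal_space.bdd_supp_integrable by auto
  have nn: "0 \<le> h1 x" "0 \<le> h2 x" for x using h1 h2 by (auto simp: bdd_supp_def)
  have out: "x \<notin> ?I \<Longrightarrow> h1 x = 0" "x \<notin> ?I \<Longrightarrow> h2 x = 0" for x using h1 h2 by (auto simp: bdd_supp_def)
  show "?J h1 h2 \<le> ?R h1 h2"
  \<comment> \<open>If a mass is 0, the right side is 0 because of the product in front, whatever
    \<open>ln 0\<close> is, and the integrand vanishes almost everywhere.\<close>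
  proof (cases "(\<integral>x. h1 x \<partial>lborel) = 0 \<or> (\<integral>x. h2 x \<partial>lborel) = 0")
    case True
    then have "(AE x in lborel. h1 x = 0) \<or> (AE x in lborel. h2 x = 0)"
      using integral_nonneg_eq_0_iff_AE[OF ih(1)] integral_nonneg_eq_0_iff_AE[OF ih(2)] nn by auto
    then have "(AE z in lborel \<Otimes>\<^sub>M lborel. h1 (fst z) = 0) \<or> (AE z in lborel \<Otimes>\<^sub>M lborel. h2 (snd z) = 0)"
      using AE_fst_pair_measure[OF lborel.sigma_finite_measure_axioms]
        AE_snd_pair_measure[OF lborel.sigma_finite_measure_axioms] by blast
    then have "AE z in lborel \<Otimes>\<^sub>M lborel. h1 (fst z) * h2 (snd z) = 0"
      by (auto elim!: eventually_mono)
    then have "AE z in lborel \<Otimes>\<^sub>M lborel. epi_integrand (-) (ln 2 / 2) h1 h2 g z = 0"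
      by (rule eventually_mono) (auto simp: epi_integrand_def case_prod_unfold)
    then have "?J h1 h2 = 0" by (rule integral_eq_zero_AE)
    then show ?thesis using True by auto
  next
    case False
    then have F: "0 < (\<integral>x. h1 x \<partial>lborel)" "0 < (\<integral>x. h2 x \<partial>lborel)"
      using Bochner_Integration.integral_nonneg[of lborel h1] Bochner_Integration.integral_nonneg[of lborel h2] nn by (auto simp: less_le)
    \<comment> \<open>For n = 0 the interval is a single point, hence null, and the masses would
      vanish.\<close>
    have n: "0 < n"
    proof (rule ccontr)
      assume "\<not> 0 < n"
      then have "h1 x = 0" if "x \<noteq> 0" for x using out(1)[of x] that by auto
      then have "AE x in lborel. h1 x = 0" using AE_lborel_singleton[of 0] by (auto elim: eventually_mono)
      then show False using F(1) integral_eq_zero_AE[of h1 lborel] by simp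
    qed
    obtain C where C: "1 \<le> C" "\<And>x. h1 x \<le> C" "\<And>x. h2 x \<le> C"
    proof -
      obtain C1 C2 where "\<And>x. h1 x \<le> C1" "\<And>x. h2 x \<le> C2"
        using h1 h2 unfolding bdd_supp_def space_lborel space_borel by blast
      then show thesis
        by (intro that[of "max 1 (max C1 C2)"]) (auto simp: le_max_iff_disj)
    qed
    obtain f1 where f1: "\<And>j. continuous_on UNIV (f1 j)" "\<And>j x. 0 < f1 j x" "\<And>j x. f1 j x \<le> C"
      "AE x in lborel. (\<lambda>j. f1 j x) \<longlonglongrightarrow> h1 x"
      by (rule AE_continuous_approximation[OF m(1) nn(1) C(2,1)], rule that)
    obtain f2 where f2: "\<And>j. continuous_on UNIV (f2 j)" "\<And>j x. 0 < f2 j x" "\<And>j x. f2 j x \<le> C"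
      "AE x in lborel. (\<lambda>j. f2 j x) \<longlonglongrightarrow> h2 x"
      by (rule AE_continuous_approximation[OF m(2) nn(2) C(3,1)], rule that)
    define k1 k2 where "k1 j x = indicator ?I x * f1 j x" and "k2 j x = indicator ?I x * f2 j x" for j x
    have mk[measurable]: "k1 j \<in> borel_measurable borel" "k2 j \<in> borel_measurable borel" for j
    proof -
      have [measurable]: "f1 j \<in> borel_measurable borel" "f2 j \<in> borel_measurable borel"
        using f1(1) f2(1) by (auto intro: borel_measurable_continuous_onI)
      show "k1 j \<in> borel_measurable borel" "k2 j \<in> borel_measurable borel"
        unfolding k1_def k2_def by measurable
    qed
    have k0: "0 \<le> k1 j x" "0 \<le> k2 j x" "k1 j x \<le> C" "k2 j x \<le> C" for j x
      using f1(2,3)[of j x] f2(2,3)[of j x] C(1) by (auto simp: k1_def k2_def indicator_def)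
    have bk: "\<bar>k1 j x\<bar> \<le> C * indicator ?I x" "\<bar>k2 j x\<bar> \<le> C * indicator ?I x" for j x
      using k0[of j x] by (auto simp: k1_def k2_def indicator_def)
    have lim1: "AE x in lborel. (\<lambda>j. k1 j x) \<longlonglongrightarrow> h1 x"
    proof (rule eventually_mono[OF f1(4)])
      fix x assume "(\<lambda>j. f1 j x) \<longlonglongrightarrow> h1 x"
      then have "(\<lambda>j. k1 j x) \<longlonglongrightarrow> indicator ?I x * h1 x" unfolding k1_def by (intro tendsto_intros)
      then show "(\<lambda>j. k1 j x) \<longlonglongrightarrow> h1 x" using out(1)[of x] by (cases "x \<in> ?I") auto
    qed
    have lim2: "AE x in lborel. (\<lambda>j. k2 j x) \<longlonglongrightarrow> h2 x"
    proof (rule eventually_mono[OF f2(4)])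
      fix x assume "(\<lambda>j. f2 j x) \<longlonglongrightarrow> h2 x"
      then have "(\<lambda>j. k2 j x) \<longlonglongrightarrow> indicator ?I x * h2 x" unfolding k2_def by (intro tendsto_intros)
      then show "(\<lambda>j. k2 j x) \<longlonglongrightarrow> h2 x" using out(2)[of x] by (cases "x \<in> ?I") auto
    qed
    have iI: "integrable lborel (\<lambda>x. C * indicator ?I x)" by simp
    have L1: "(\<lambda>j. \<integral>x. k1 j x \<partial>lborel) \<longlonglongrightarrow> (\<integral>x. h1 x \<partial>lborel)"
      by (rule integral_dominated_convergence[OF _ _ iI lim1]) (use bk in auto)
    have L2: "(\<lambda>j. \<integral>x. k2 j x \<partial>lborel) \<longlonglongrightarrow> (\<integral>x. h2 x \<partial>lborel)"
      by (rule integral_dominated_convergence[OF _ _ iI lim2]) (use bk in auto)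
    have RL: "(\<lambda>j. ?R (k1 j) (k2 j)) \<longlonglongrightarrow> ?R h1 h2"
      using F by (intro tendsto_intros L1 L2) auto
    have mg[measurable]: "g \<in> borel_measurable borel" using g by (auto simp: comparable_def)
    \<comment> \<open>Expanded so that \<open>u\<close> and \<open>v\<close> meet a logarithm only
      as x ln x: in this form convergence carries over to the integrand also at points where a limit
      is 0.\<close>
    define Q where "Q u v z = u (fst z) * v (snd z) * (ln (g (fst z - snd z)) + ln 2 / 2)
      - (u (fst z) * ln (u (fst z))) * v (snd z) / 2 - u (fst z) * (v (snd z) * ln (v (snd z))) / 2"
      for u v :: "real \<Rightarrow> real" and z
    have Q: "epi_integrand (-) (ln 2 / 2) u v g = Q u v" for u v
      by (auto simp: epi_integrand_def Q_def algebra_simps)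
    obtain c1 where c1: "0 < c1" "\<And>x. c1 * std_normal_density x \<le> g x \<and> g x \<le> std_normal_density x / c1"
      using g by (auto simp: comparable_def)
    define D where "D = 2 * sqrt C + C\<^sup>2"
    have xl: "\<bar>x * ln x\<bar> \<le> D" if "0 \<le> x" "x \<le> C" for x
      using abs_x_ln_x_le[OF that(1)] real_sqrt_le_mono[OF that(2)] power_mono[OF that(2,1), of 2]
      unfolding D_def by linarith
    define b where "b z = indicator (?I \<times> ?I) z *
      (C * C * (\<bar>ln (g (fst z - snd z))\<bar> + ln 2 / 2) + D * C / 2 + C * D / 2)" for z
    have bQ: "\<bar>Q (k1 j) (k2 j) z\<bar> \<le> b z" for j z
    proof (cases "z \<in> ?I \<times> ?I")
      case False
      then have "k1 j (fst z) = 0 \<or> k2 j (snd z) = 0"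
        by (auto simp: k1_def k2_def mem_Times_iff)
      then show ?thesis using False by (auto simp: Q_def b_def)
    next
      case True
      have l2: "0 \<le> ln (2::real)" by simp
      have "\<bar>k1 j (fst z) * k2 j (snd z) * (ln (g (fst z - snd z)) + ln 2 / 2)\<bar>
          \<le> C * C * (\<bar>ln (g (fst z - snd z))\<bar> + ln 2 / 2)"
        unfolding abs_mult using k0 C(1) l2
        by (intro mult_mono) (auto intro: order_trans[OF abs_triangle_ineq])
      moreover have "\<bar>(k1 j (fst z) * ln (k1 j (fst z))) * k2 j (snd z)\<bar> \<le> D * C"
        unfolding abs_mult[of _ "k2 j (snd z)"]
        using xl[OF k0(1,3)] k0 C(1) by (intro mult_mono) (auto simp: D_def)
      moreover have "\<bar>k1 j (fst z) * (k2 j (snd z) * ln (k2 j (snd z)))\<bar> \<le> C * D"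
        unfolding abs_mult[of "k1 j (fst z)"]
        using xl[OF k0(2,4)] k0 C(1) by (intro mult_mono) (auto simp: D_def)
      moreover have "b z = C * C * (\<bar>ln (g (fst z - snd z))\<bar> + ln 2 / 2) + D * C / 2 + C * D / 2"
        using True by (simp add: b_def)
      ultimately show ?thesis unfolding Q_def by linarith
    qed
    have ib: "integrable (lborel \<Otimes>\<^sub>M lborel) b"
    proof -
      obtain c2 where c2: "0 < c2" "\<And>x y. x \<in> ?I \<Longrightarrow> y \<in> ?I \<Longrightarrow>
          c2 \<le> std_normal_density (x - y) \<and> std_normal_density (x - y) \<le> 1 / c2"
        using std_normal_density_bounds[of n] by blast
      have lb: "\<bar>ln (g (fst z - snd z))\<bar> \<le> \<bar>ln (c1 * c2)\<bar>" if "z \<in> ?I \<times> ?I" for z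
      proof -
        have c2z: "c2 \<le> std_normal_density (fst z - snd z)" "std_normal_density (fst z - snd z) \<le> 1 / c2"
          using c2(2)[of "fst z" "snd z"] that by (simp_all add: mem_Times_iff)
        have l: "c1 * c2 \<le> g (fst z - snd z)"
          using mult_left_mono[OF c2z(1), of c1] c1(1) c1(2)[of "fst z - snd z"] by linarith
        have u: "g (fst z - snd z) \<le> 1 / c2 / c1"
          using divide_right_mono[OF c2z(2), of c1] c1(1) c1(2)[of "fst z - snd z"] by linarith
        have p: "0 < c1 * c2" using c1(1) c2(1) by simp
        have "ln (c1 * c2) \<le> ln (g (fst z - snd z))" using l p by (subst ln_le_cancel_iff) auto
        moreover have "ln (g (fst z - snd z)) \<le> ln (1 / c2 / c1)"
          using u less_le_trans[OF p l] c1(1) c2(1) by (subst ln_le_cancel_iff) auto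
        moreover have "ln (1 / c2 / c1) = - ln (c1 * c2)"
          using c1(1) c2(1) by (simp add: ln_div ln_mult)
        ultimately show ?thesis by linarith
      qed
      let ?K = "C * C * (\<bar>ln (c1 * c2)\<bar> + ln 2 / 2) + D * C / 2 + C * D / 2"
      have D0: "0 \<le> D" using C(1) by (simp add: D_def)
      have "norm (b z) \<le> ?K" if "z \<in> ?I \<times> ?I" for z
      proof -
        have "C * C * (\<bar>ln (g (fst z - snd z))\<bar> + ln 2 / 2) \<le> C * C * (\<bar>ln (c1 * c2)\<bar> + ln 2 / 2)"
          using lb[OF that] by (intro mult_left_mono) auto
        moreover have "0 \<le> b z" using C(1) D0 by (simp add: b_def)
        ultimately show ?thesis using that by (simp add: b_def)
      qed
      moreover have "b z = 0" if "z \<notin> ?I \<times> ?I" for z using that by (simp add: b_def)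
      moreover have "b \<in> borel_measurable (lborel \<Otimes>\<^sub>M lborel)" unfolding b_def by measurable
      ultimately show ?thesis
        using std_normal_space.emeasure_B_Times[of n]
        by (intro integrableI_bounded_set[where A="?I \<times> ?I" and B="?K"] AE_I2) auto
    qed
    have limQ: "AE z in lborel \<Otimes>\<^sub>M lborel. (\<lambda>j. Q (k1 j) (k2 j) z) \<longlonglongrightarrow> Q h1 h2 z"
      using AE_fst_pair_measure[OF lborel.sigma_finite_measure_axioms lim1]
        AE_snd_pair_measure[OF lborel.sigma_finite_measure_axioms lim2]
    proof eventually_elim
      case (elim z)
      show ?case unfolding Q_def
        by (intro tendsto_intros tendsto_x_ln_x elim k0) auto
    qed
    have JL: "(\<lambda>j. ?J (k1 j) (k2 j)) \<longlonglongrightarrow> ?J h1 h2"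
      unfolding Q by (rule integral_dominated_convergence[OF _ _ ib limQ])
        (use bQ in \<open>auto simp: Q_def\<close>)
    have "?J (k1 j) (k2 j) \<le> ?R (k1 j) (k2 j)" for j
      unfolding k1_def k2_def by (rule epi_continuous_unnormalized[OF f1(1-3) f2(1-3) n g])
    then show ?thesis using LIMSEQ_le[OF JL RL] by blast
  qed
qed

section \<open>Products and Euclidean spaces\<close>

text \<open>Two points of product spaces are regrouped into the pair of first and the pair of second
  coordinates, so that one factor can be integrated out at a time. The measures are compared on
  rectangles \<open>A \<times> C\<close>; as \<open>A\<close> and \<open>C\<close> are themselves
  subsets of products, the integral is unfolded into four iterated ones.\<close>

lemma pair_measure_reorder:
  assumes "sigma_finite_measure M1" "sigma_finite_measure M2" "sigma_finite_measure M3" "sigma_finite_measure M4"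
  shows "(M1 \<Otimes>\<^sub>M M2) \<Otimes>\<^sub>M (M3 \<Otimes>\<^sub>M M4)
    = distr ((M1 \<Otimes>\<^sub>M M3) \<Otimes>\<^sub>M (M2 \<Otimes>\<^sub>M M4)) ((M1 \<Otimes>\<^sub>M M2) \<Otimes>\<^sub>M (M3 \<Otimes>\<^sub>M M4))
        (\<lambda>z. ((fst (fst z), fst (snd z)), (snd (fst z), snd (snd z))))"
proof -
  interpret M1: sigma_finite_measure M1 by fact
  interpret M2: sigma_finite_measure M2 by fact
  interpret M3: sigma_finite_measure M3 by fact
  interpret M4: sigma_finite_measure M4 by fact
  interpret P12: pair_sigma_finite M1 M2 ..
  interpret P34: pair_sigma_finite M3 M4 ..
  interpret P24: pair_sigma_finite M2 M4 ..
  let ?r = "\<lambda>z. ((fst (fst z), fst (snd z)), (snd (fst z), snd (snd z)))"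
  let ?P = "(M1 \<Otimes>\<^sub>M M3) \<Otimes>\<^sub>M (M2 \<Otimes>\<^sub>M M4)"
  let ?Q = "(M1 \<Otimes>\<^sub>M M2) \<Otimes>\<^sub>M (M3 \<Otimes>\<^sub>M M4)"
  have r[measurable]: "?r \<in> ?P \<rightarrow>\<^sub>M ?Q" by measurable
  show ?thesis
  proof (rule pair_measure_eqI)
    fix A C assume [measurable]: "A \<in> sets (M1 \<Otimes>\<^sub>M M2)" "C \<in> sets (M3 \<Otimes>\<^sub>M M4)"
    have "emeasure (distr ?P ?Q ?r) (A \<times> C) = (\<integral>\<^sup>+z. indicator (A \<times> C) z \<partial>distr ?P ?Q ?r)"
      by simp
    also have "\<dots> = (\<integral>\<^sup>+z. indicator (A \<times> C) (?r z) \<partial>?P)"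
      by (subst nn_integral_distr) auto
    also have "\<dots> = (\<integral>\<^sup>+z. indicator A (fst (fst z), fst (snd z)) * indicator C (snd (fst z), snd (snd z)) \<partial>?P)"
      by (intro nn_integral_cong) (auto simp: indicator_def)
    also have "\<dots> = (\<integral>\<^sup>+u. \<integral>\<^sup>+v. indicator A (fst u, fst v) * indicator C (snd u, snd v) \<partial>(M2 \<Otimes>\<^sub>M M4) \<partial>(M1 \<Otimes>\<^sub>M M3))"
      by (subst P24.nn_integral_fst[symmetric]) auto
    also have "\<dots> = (\<integral>\<^sup>+x. \<integral>\<^sup>+y. \<integral>\<^sup>+v. indicator A (x, fst v) * indicator C (y, snd v) \<partial>(M2 \<Otimes>\<^sub>M M4) \<partial>M3 \<partial>M1)"
      by (subst M3.nn_integral_fst[symmetric]) auto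
    also have "\<dots> = (\<integral>\<^sup>+x. \<integral>\<^sup>+y. \<integral>\<^sup>+s. \<integral>\<^sup>+t. indicator A (x, s) * indicator C (y, t) \<partial>M4 \<partial>M2 \<partial>M3 \<partial>M1)"
      by (intro nn_integral_cong, subst M4.nn_integral_fst[symmetric]) auto
    also have "\<dots> = (\<integral>\<^sup>+x. \<integral>\<^sup>+y. (\<integral>\<^sup>+s. indicator A (x, s) \<partial>M2) * (\<integral>\<^sup>+t. indicator C (y, t) \<partial>M4) \<partial>M3 \<partial>M1)"
      by (intro nn_integral_cong) (simp add: nn_integral_cmult nn_integral_multc)
    also have "\<dots> = (\<integral>\<^sup>+x. (\<integral>\<^sup>+s. indicator A (x, s) \<partial>M2) \<partial>M1) * (\<integral>\<^sup>+y. \<integral>\<^sup>+t. indicator C (y, t) \<partial>M4 \<partial>M3)"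
      by (simp add: nn_integral_cmult nn_integral_multc)
    also have "\<dots> = emeasure (M1 \<Otimes>\<^sub>M M2) A * emeasure (M3 \<Otimes>\<^sub>M M4) C"
      by (simp add: M2.nn_integral_fst M4.nn_integral_fst)
    finally show "emeasure (M1 \<Otimes>\<^sub>M M2) A * emeasure (M3 \<Otimes>\<^sub>M M4) C = emeasure (distr ?P ?Q ?r) (A \<times> C)" ..
  qed (auto intro: P12.sigma_finite_measure_axioms P34.sigma_finite_measure_axioms)
qed

lemma mult_between_inverse:
  fixes a b c d :: real
  assumes "0 < c" "0 < d" "c \<le> a" "a \<le> 1 / c" "d \<le> b" "b \<le> 1 / d"
  shows "c * d \<le> a * b \<and> a * b \<le> 1 / (c * d)"
proof
  show "c * d \<le> a * b" using assms by (intro mult_mono) auto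
  have "a * b \<le> (1 / c) * (1 / d)" using assms by (intro mult_mono) auto
  then show "a * b \<le> 1 / (c * d)" by simp
qed

lemma reference_space_pair:
  assumes "reference_space M1 d1 w1 B1" "reference_space M2 d2 w2 B2"
  shows "reference_space (M1 \<Otimes>\<^sub>M M2) (\<lambda>u v. (d1 (fst u) (fst v), d2 (snd u) (snd v)))
    (\<lambda>u. w1 (fst u) * w2 (snd u)) (\<lambda>n. B1 n \<times> B2 n)"
proof -
  interpret M1: reference_space M1 d1 w1 B1 by fact
  interpret M2: reference_space M2 d2 w2 B2 by fact
  interpret P: pair_sigma_finite M1 M2 ..
  have iw: "integrable (M1 \<Otimes>\<^sub>M M2) (\<lambda>u. w1 (fst u) * w2 (snd u))"
    by (rule P.integrable_product[OF M1.w_integrable M2.w_integrable])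
  show ?thesis
  proof unfold_locales
    have [measurable]: "(\<lambda>z. d1 (fst (fst z)) (fst (snd z))) \<in> (M1 \<Otimes>\<^sub>M M2) \<Otimes>\<^sub>M (M1 \<Otimes>\<^sub>M M2) \<rightarrow>\<^sub>M M1"
      "(\<lambda>z. d2 (snd (fst z)) (snd (snd z))) \<in> (M1 \<Otimes>\<^sub>M M2) \<Otimes>\<^sub>M (M1 \<Otimes>\<^sub>M M2) \<rightarrow>\<^sub>M M2"
      using measurable_compose[OF _ M1.d_measurable, of "\<lambda>z. (fst (fst z), fst (snd z))" "(M1 \<Otimes>\<^sub>M M2) \<Otimes>\<^sub>M (M1 \<Otimes>\<^sub>M M2)"]
        measurable_compose[OF _ M2.d_measurable, of "\<lambda>z. (snd (fst z), snd (snd z))" "(M1 \<Otimes>\<^sub>M M2) \<Otimes>\<^sub>M (M1 \<Otimes>\<^sub>M M2)"]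
      by simp_all
    show "(\<lambda>(u, v). (d1 (fst u) (fst v), d2 (snd u) (snd v)))
        \<in> (M1 \<Otimes>\<^sub>M M2) \<Otimes>\<^sub>M (M1 \<Otimes>\<^sub>M M2) \<rightarrow>\<^sub>M M1 \<Otimes>\<^sub>M M2"
      unfolding case_prod_unfold by measurable
    show "integrable (M1 \<Otimes>\<^sub>M M2) (\<lambda>u. w1 (fst u) * w2 (snd u))" by (rule iw)
    show "(\<integral>u. w1 (fst u) * w2 (snd u) \<partial>(M1 \<Otimes>\<^sub>M M2)) = 1"
      by (simp add: P.integral_product M1.w_integrable M2.w_integrable M1.w_integral M2.w_integral)
    show "0 < w1 (fst u) * w2 (snd u)" if "u \<in> space (M1 \<Otimes>\<^sub>M M2)" for u
      using that M1.w_pos M2.w_pos by (auto simp: space_pair_measure)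
    show "B1 n \<times> B2 n \<in> sets (M1 \<Otimes>\<^sub>M M2)" for n by measurable
    show "emeasure (M1 \<Otimes>\<^sub>M M2) (B1 n \<times> B2 n) < \<top>" for n
      using M1.B_finite[of n] M2.B_finite[of n] by (simp add: M2.emeasure_pair_measure_Times ennreal_mult_less_top)
    fix n
    obtain c1 where c1: "0 < c1" "\<And>x y. x \<in> B1 n \<Longrightarrow> y \<in> B1 n \<Longrightarrow> c1 \<le> w1 (d1 x y) \<and> w1 (d1 x y) \<le> 1 / c1"
      using M1.w_bounds[of n] by blast
    obtain c2 where c2: "0 < c2" "\<And>x y. x \<in> B2 n \<Longrightarrow> y \<in> B2 n \<Longrightarrow> c2 \<le> w2 (d2 x y) \<and> w2 (d2 x y) \<le> 1 / c2"
      using M2.w_bounds[of n] by blast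
    show "\<exists>c>0. \<forall>u\<in>B1 n \<times> B2 n. \<forall>v\<in>B1 n \<times> B2 n.
        c \<le> w1 (fst (d1 (fst u) (fst v), d2 (snd u) (snd v))) * w2 (snd (d1 (fst u) (fst v), d2 (snd u) (snd v)))
        \<and> w1 (fst (d1 (fst u) (fst v), d2 (snd u) (snd v))) * w2 (snd (d1 (fst u) (fst v), d2 (snd u) (snd v))) \<le> 1 / c"
    proof (intro exI[of _ "c1 * c2"] conjI[of "0 < c1 * c2"] ballI)
      fix u v assume "u \<in> B1 n \<times> B2 n" "v \<in> B1 n \<times> B2 n"
      then show "c1 * c2 \<le> w1 (fst (d1 (fst u) (fst v), d2 (snd u) (snd v))) * w2 (snd (d1 (fst u) (fst v), d2 (snd u) (snd v)))
        \<and> w1 (fst (d1 (fst u) (fst v), d2 (snd u) (snd v))) * w2 (snd (d1 (fst u) (fst v), d2 (snd u) (snd v))) \<le> 1 / (c1 * c2)"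
        using mult_between_inverse[of c1 c2 "w1 (d1 (fst u) (fst v))" "w2 (d2 (snd u) (snd v))"] c1 c2
        by (simp add: mem_Times_iff)
    qed (use c1 c2 in simp)
  qed
qed

text \<open>With the second coordinates s and t fixed, the inequality of the first factor, applied
  to slices, has on its right the masses of these slices in exactly the form of the integrand of the
  second factor for the marginals \<open>F1\<close>, \<open>F2\<close>, \<open>G\<close>. The
  inequality of the second factor then finishes. The constants add because \<open>k2\<close>
  multiplies f1 f2, which integrates to \<open>F1 s * F2 t\<close> over the first
  coordinates.\<close>

lemma epi_space_pair:
  assumes "epi_space M1 d1 w1 B1 k1" "epi_space M2 d2 w2 B2 k2"
  shows "epi_space (M1 \<Otimes>\<^sub>M M2) (\<lambda>u v. (d1 (fst u) (fst v), d2 (snd u) (snd v)))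
    (\<lambda>u. w1 (fst u) * w2 (snd u)) (\<lambda>n. B1 n \<times> B2 n) (k1 + k2)"
proof -
  interpret M1: epi_space M1 d1 w1 B1 k1 by fact
  interpret M2: epi_space M2 d2 w2 B2 k2 by fact
  interpret P: pair_sigma_finite M1 M2 ..
  interpret P1: pair_sigma_finite M1 M1 ..
  interpret P2: pair_sigma_finite M2 M2 ..
  interpret PP: pair_sigma_finite "M1 \<Otimes>\<^sub>M M1" "M2 \<Otimes>\<^sub>M M2" ..
  let ?d = "\<lambda>u v. (d1 (fst u) (fst v), d2 (snd u) (snd v))"
  let ?r = "\<lambda>z. ((fst (fst z), fst (snd z)), (snd (fst z), snd (snd z)))"
  interpret R: reference_space "M1 \<Otimes>\<^sub>M M2" ?d "\<lambda>u. w1 (fst u) * w2 (snd u)" "\<lambda>n. B1 n \<times> B2 n"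
    by (rule reference_space_pair[OF M1.reference_space_axioms M2.reference_space_axioms])
  have slice: "bdd_supp M1 (B1 n) (\<lambda>x. f (x, s))" if f: "bdd_supp (M1 \<Otimes>\<^sub>M M2) (B1 n \<times> B2 n) f" and s: "s \<in> space M2" for n f s
  proof -
    obtain C where [measurable]: "f \<in> borel_measurable (M1 \<Otimes>\<^sub>M M2)"
      and C: "\<And>u. u \<in> space (M1 \<Otimes>\<^sub>M M2) \<Longrightarrow> 0 \<le> f u \<and> f u \<le> C \<and> (u \<notin> B1 n \<times> B2 n \<longrightarrow> f u = 0)"
      using f unfolding bdd_supp_def by blast
    show ?thesis unfolding bdd_supp_def
    proof (intro conjI exI[of _ C] ballI)
      show "(\<lambda>x. f (x, s)) \<in> borel_measurable M1" using s by measurable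
    qed (use C s in \<open>auto simp: space_pair_measure\<close>)
  qed
  have marginal: "bdd_supp M2 (B2 n) (\<lambda>s. \<integral>x. f (x, s) \<partial>M1)" if f: "bdd_supp (M1 \<Otimes>\<^sub>M M2) (B1 n \<times> B2 n) f" for n f
  proof -
    obtain C where [measurable]: "f \<in> borel_measurable (M1 \<Otimes>\<^sub>M M2)"
      and C: "\<And>u. u \<in> space (M1 \<Otimes>\<^sub>M M2) \<Longrightarrow> 0 \<le> f u \<and> f u \<le> C \<and> (u \<notin> B1 n \<times> B2 n \<longrightarrow> f u = 0)"
      using f unfolding bdd_supp_def by blast
    show ?thesis unfolding bdd_supp_def
    proof (intro conjI exI[of _ "C * measure M1 (B1 n)"] ballI impI)
      show "(\<lambda>s. \<integral>x. f (x, s) \<partial>M1) \<in> borel_measurable M2" by measurable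
      fix s assume s: "s \<in> space M2"
      have Cs: "0 \<le> f (x, s) \<and> f (x, s) \<le> C \<and> (x \<notin> B1 n \<or> s \<notin> B2 n \<longrightarrow> f (x, s) = 0)" if "x \<in> space M1" for x
        using C[of "(x, s)"] that s by (auto simp: space_pair_measure)
      show "0 \<le> (\<integral>x. f (x, s) \<partial>M1)" using Cs by (intro integral_nonneg_AE AE_I2) auto
      have "(\<integral>x. f (x, s) \<partial>M1) \<le> (\<integral>x. C * indicator (B1 n) x \<partial>M1)"
      proof (rule integral_mono)
        show "integrable M1 (\<lambda>x. f (x, s))" by (rule M1.bdd_supp_integrable[OF slice[OF f s]])
        show "integrable M1 (\<lambda>x. C * indicator (B1 n) x)" using M1.B_finite[of n] by simp
        show "f (x, s) \<le> C * indicator (B1 n) x" if "x \<in> space M1" for x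
          using Cs[OF that] by (auto simp: indicator_def)
      qed
      then show "(\<integral>x. f (x, s) \<partial>M1) \<le> C * measure M1 (B1 n)"
        using sets.sets_into_space[OF M1.B_sets[of n]] by (simp add: Int_absorb2)
      assume "s \<notin> B2 n"
      then have "f (x, s) = 0" if "x \<in> space M1" for x using Cs[OF that] by simp
      then have "(\<integral>x. f (x, s) \<partial>M1) = (\<integral>x. 0 \<partial>M1)"
        by (intro Bochner_Integration.integral_cong) auto
      then show "(\<integral>x. f (x, s) \<partial>M1) = 0" by simp
    qed
  qed
  show ?thesis
  proof (intro epi_space.intro epi_space_axioms.intro R.reference_space_axioms)
    fix n f1 f2 g
    assume f1: "bdd_supp (M1 \<Otimes>\<^sub>M M2) (B1 n \<times> B2 n) f1" and f2: "bdd_supp (M1 \<Otimes>\<^sub>M M2) (B1 n \<times> B2 n) f2"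
      and g: "comparable (M1 \<Otimes>\<^sub>M M2) (\<lambda>u. w1 (fst u) * w2 (snd u)) g"
    define F1 F2 G where "F1 s = (\<integral>x. f1 (x, s) \<partial>M1)" and "F2 s = (\<integral>x. f2 (x, s) \<partial>M1)"
      and "G s = (\<integral>x. g (x, s) \<partial>M1)" for s
    have m[measurable]: "f1 \<in> borel_measurable (M1 \<Otimes>\<^sub>M M2)" "f2 \<in> borel_measurable (M1 \<Otimes>\<^sub>M M2)" "g \<in> borel_measurable (M1 \<Otimes>\<^sub>M M2)"
      using f1 f2 g by (auto simp: bdd_supp_def comparable_def)
    obtain c where c: "0 < c" "\<And>x s. x \<in> space M1 \<Longrightarrow> s \<in> space M2 \<Longrightarrow>
        c * (w1 x * w2 s) \<le> g (x, s) \<and> g (x, s) \<le> w1 x * w2 s / c"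
      using g by (auto simp: comparable_def space_pair_measure)
    \<comment> \<open>The witness depends on \<open>s\<close> and degenerates where
      \<open>w2\<close> is very small or very large. This is harmless, since the inequality itself
      does not involve it.\<close>
    have gs: "comparable M1 w1 (\<lambda>x. g (x, s))" if s: "s \<in> space M2" for s
      unfolding comparable_def
    proof (intro conjI exI[of _ "min (c * w2 s) (c / w2 s)"] ballI)
      show "(\<lambda>x. g (x, s)) \<in> borel_measurable M1" using s by measurable
      show p: "0 < min (c * w2 s) (c / w2 s)" using c(1) M2.w_pos[OF s] by simp
      fix x assume x: "x \<in> space M1"
      have "min (c * w2 s) (c / w2 s) * w1 x \<le> (c * w2 s) * w1 x"
        using M1.w_pos[OF x] by (intro mult_right_mono) auto
      then show "min (c * w2 s) (c / w2 s) * w1 x \<le> g (x, s)"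
        using c(2)[OF x s] by (simp add: mult.assoc mult.commute[of "w2 s"])
      have "w1 x / (c / w2 s) \<le> w1 x / min (c * w2 s) (c / w2 s)"
        using M1.w_pos[OF x] p by (intro frac_le) auto
      then show "g (x, s) \<le> w1 x / min (c * w2 s) (c / w2 s)"
        using c(2)[OF x s] by simp
    qed
    have ig: "integrable M1 (\<lambda>x. g (x, s))" if "s \<in> space M2" for s
      by (rule M1.comparable_integrable(1)[OF gs[OF that]])
    \<comment> \<open>The constant \<open>c\<close> survives for the marginal because
      \<open>w1\<close> has mass 1.\<close>
    have cG: "comparable M2 w2 G" unfolding comparable_def
    proof (intro conjI exI[of _ c] ballI c(1))
      show "G \<in> borel_measurable M2" unfolding G_def by measurable
      fix s assume s: "s \<in> space M2"
      have "(\<integral>x. (c * w2 s) * w1 x \<partial>M1) \<le> G s" unfolding G_def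
        using c(2)[OF _ s] by (intro integral_mono ig s integrable_mult_right M1.w_integrable)
          (simp add: mult.assoc mult.commute[of "w2 s"])
      then show "c * w2 s \<le> G s" by (simp add: M1.w_integral)
      have "G s \<le> (\<integral>x. (w2 s / c) * w1 x \<partial>M1)" unfolding G_def
        using c(2)[OF _ s] by (intro integral_mono ig s integrable_mult_right M1.w_integrable)
          (simp add: mult.commute)
      then show "G s \<le> w2 s / c" by (simp add: M1.w_integral)
    qed
    have bF: "bdd_supp M2 (B2 n) F1" "bdd_supp M2 (B2 n) F2"
      unfolding F1_def F2_def by (intro marginal f1 f2)+
    let ?\<Psi> = "epi_integrand ?d (k1 + k2) f1 f2 g"
    have i\<Psi>: "integrable ((M1 \<Otimes>\<^sub>M M2) \<Otimes>\<^sub>M (M1 \<Otimes>\<^sub>M M2)) ?\<Psi>"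
      by (rule R.epi_integrand_integrable[OF f1 f2 g])
    note reorder = pair_measure_reorder[OF M1.sigma_finite_measure_axioms M2.sigma_finite_measure_axioms
        M1.sigma_finite_measure_axioms M2.sigma_finite_measure_axioms]
    have rm: "?r \<in> (M1 \<Otimes>\<^sub>M M1) \<Otimes>\<^sub>M (M2 \<Otimes>\<^sub>M M2) \<rightarrow>\<^sub>M (M1 \<Otimes>\<^sub>M M2) \<Otimes>\<^sub>M (M1 \<Otimes>\<^sub>M M2)"
      by measurable
    have i\<Psi>r: "integrable ((M1 \<Otimes>\<^sub>M M1) \<Otimes>\<^sub>M (M2 \<Otimes>\<^sub>M M2)) (\<lambda>(z, u). ?\<Psi> (?r (z, u)))"
    proof -
      have "integrable ((M1 \<Otimes>\<^sub>M M1) \<Otimes>\<^sub>M (M2 \<Otimes>\<^sub>M M2)) (\<lambda>z. ?\<Psi> (?r z))"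
        using i\<Psi> by (subst (asm) reorder) (rule integrable_distr[OF rm])
      then show ?thesis by (simp add: case_prod_unfold)
    qed
    have "(\<integral>z. ?\<Psi> z \<partial>((M1 \<Otimes>\<^sub>M M2) \<Otimes>\<^sub>M (M1 \<Otimes>\<^sub>M M2))) = (\<integral>z. ?\<Psi> (?r z) \<partial>((M1 \<Otimes>\<^sub>M M1) \<Otimes>\<^sub>M (M2 \<Otimes>\<^sub>M M2)))"
      by (subst reorder, rule integral_distr[OF rm borel_measurable_integrable[OF i\<Psi>]])
    also have "\<dots> = (\<integral>u. \<integral>z. ?\<Psi> (?r (z, u)) \<partial>(M1 \<Otimes>\<^sub>M M1) \<partial>(M2 \<Otimes>\<^sub>M M2))"
      using PP.integral_snd[OF i\<Psi>r] by (simp add: case_prod_unfold)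
    also have "\<dots> \<le> (\<integral>u. epi_integrand d2 k2 F1 F2 G u \<partial>(M2 \<Otimes>\<^sub>M M2))"
    proof (rule integral_mono)
      show "integrable (M2 \<Otimes>\<^sub>M M2) (\<lambda>u. \<integral>z. ?\<Psi> (?r (z, u)) \<partial>(M1 \<Otimes>\<^sub>M M1))"
        by (rule PP.integrable_snd[OF i\<Psi>r])
      show "integrable (M2 \<Otimes>\<^sub>M M2) (epi_integrand d2 k2 F1 F2 G)"
        by (rule M2.epi_integrand_integrable[OF bF cG])
      fix u assume "u \<in> space (M2 \<Otimes>\<^sub>M M2)"
      then obtain s t where u: "u = (s, t)" and s: "s \<in> space M2" and t: "t \<in> space M2"
        by (auto simp: space_pair_measure)
      have st: "d2 s t \<in> space M2"
        using measurable_space[OF M2.d_measurable, of "(s, t)"] s t by (simp add: space_pair_measure)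
      let ?E = "epi_integrand d1 k1 (\<lambda>x. f1 (x, s)) (\<lambda>x. f2 (x, t)) (\<lambda>x. g (x, d2 s t))"
      have if12: "integrable M1 (\<lambda>x. f1 (x, s))" "integrable M1 (\<lambda>x. f2 (x, t))"
        by (rule M1.bdd_supp_integrable[OF slice[OF f1 s]], rule M1.bdd_supp_integrable[OF slice[OF f2 t]])
      have "(\<integral>z. ?\<Psi> (?r (z, u)) \<partial>(M1 \<Otimes>\<^sub>M M1))
          = (\<integral>z. ?E z + k2 * (f1 (fst z, s) * f2 (snd z, t)) \<partial>(M1 \<Otimes>\<^sub>M M1))"
        by (intro Bochner_Integration.integral_cong) (auto simp: epi_integrand_def u algebra_simps)
      also have "\<dots> = (\<integral>z. ?E z \<partial>(M1 \<Otimes>\<^sub>M M1)) + k2 * (F1 s * F2 t)"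
        unfolding F1_def F2_def P1.integral_product[OF if12, symmetric]
        using M1.epi_integrand_integrable[OF slice[OF f1 s] slice[OF f2 t] gs[OF st]] P1.integrable_product[OF if12]
        by simp
      also have "\<dots> \<le> F1 s * F2 t * (ln (G (d2 s t)) - ln (F1 s) / 2 - ln (F2 t) / 2) + k2 * (F1 s * F2 t)"
        using M1.epi[OF slice[OF f1 s] slice[OF f2 t] gs[OF st]] by (simp add: F1_def F2_def G_def)
      also have "\<dots> = epi_integrand d2 k2 F1 F2 G u"
        by (simp add: epi_integrand_def u algebra_simps)
      finally show "(\<integral>z. ?\<Psi> (?r (z, u)) \<partial>(M1 \<Otimes>\<^sub>M M1)) \<le> epi_integrand d2 k2 F1 F2 G u" .
    qed
    also have "\<dots> \<le> (\<integral>s. F1 s \<partial>M2) * (\<integral>s. F2 s \<partial>M2) *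
      (ln (\<integral>s. G s \<partial>M2) - ln (\<integral>s. F1 s \<partial>M2) / 2 - ln (\<integral>s. F2 s \<partial>M2) / 2)"
      by (rule M2.epi[OF bF cG])
    also have "(\<integral>s. F1 s \<partial>M2) = (\<integral>u. f1 u \<partial>(M1 \<Otimes>\<^sub>M M2))"
      unfolding F1_def using P.integral_snd[of "\<lambda>x s. f1 (x, s)"] R.bdd_supp_integrable[OF f1] by simp
    also have "(\<integral>s. F2 s \<partial>M2) = (\<integral>u. f2 u \<partial>(M1 \<Otimes>\<^sub>M M2))"
      unfolding F2_def using P.integral_snd[of "\<lambda>x s. f2 (x, s)"] R.bdd_supp_integrable[OF f2] by simp
    also have "(\<integral>s. G s \<partial>M2) = (\<integral>u. g u \<partial>(M1 \<Otimes>\<^sub>M M2))"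
      unfolding G_def using P.integral_snd[of "\<lambda>x s. g (x, s)"] R.comparable_integrable(1)[OF g] by simp
    finally show "(\<integral>z. ?\<Psi> z \<partial>((M1 \<Otimes>\<^sub>M M2) \<Otimes>\<^sub>M (M1 \<Otimes>\<^sub>M M2)))
      \<le> (\<integral>u. f1 u \<partial>(M1 \<Otimes>\<^sub>M M2)) * (\<integral>u. f2 u \<partial>(M1 \<Otimes>\<^sub>M M2)) *
        (ln (\<integral>u. g u \<partial>(M1 \<Otimes>\<^sub>M M2)) - ln (\<integral>u. f1 u \<partial>(M1 \<Otimes>\<^sub>M M2)) / 2 - ln (\<integral>u. f2 u \<partial>(M1 \<Otimes>\<^sub>M M2)) / 2)" .
  qed
qed

text \<open>Transfer along a measure preserving map that respects differences: integrals over
  \<open>N\<close> pull back to \<open>M\<close>. The right inverse \<open>\<psi>\<close> serves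
  pointwise, to find over a point of \<open>N\<close> a point of \<open>M\<close> at which
  positivity and bounds of \<open>w\<close> are known.\<close>

lemma epi_space_distr:
  assumes "epi_space M d w B k" and \<phi>[measurable]: "\<phi> \<in> M \<rightarrow>\<^sub>M N" and N: "distr M N \<phi> = N"
    and "sigma_finite_measure N"
    and \<psi>: "\<And>y. y \<in> space N \<Longrightarrow> \<psi> y \<in> space M \<and> \<phi> (\<psi> y) = y"
    and d': "(\<lambda>(x, y). d' x y) \<in> N \<Otimes>\<^sub>M N \<rightarrow>\<^sub>M N"
      "\<And>x y. x \<in> space M \<Longrightarrow> y \<in> space M \<Longrightarrow> \<phi> (d x y) = d' (\<phi> x) (\<phi> y)"
    and w': "w' \<in> borel_measurable N" "\<And>x. x \<in> space M \<Longrightarrow> w' (\<phi> x) = w x"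
    and B': "\<And>n. B' n \<in> sets N" "\<And>n x. x \<in> space M \<Longrightarrow> \<phi> x \<in> B' n \<longleftrightarrow> x \<in> B n"
  shows "epi_space N d' w' B' k"
proof -
  interpret M: epi_space M d w B k by fact
  interpret N: sigma_finite_measure N by fact
  note [measurable] = d'(1) w'(1) B'(1)
  have dM: "d x y \<in> space M" if "x \<in> space M" "y \<in> space M" for x y
    using measurable_space[OF M.d_measurable, of "(x, y)"] that by (simp add: space_pair_measure)
  have int_eq: "(\<integral>y. f y \<partial>N) = (\<integral>x. f (\<phi> x) \<partial>M)" if "f \<in> borel_measurable N" for f :: "_ \<Rightarrow> real"
    by (subst N[symmetric], rule integral_distr[OF \<phi> that])
  interpret R: reference_space N d' w' B'
  proof unfold_locales
    have "integrable M (\<lambda>x. w' (\<phi> x))"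
      using M.w_integrable w'(2) by (simp cong: Bochner_Integration.integrable_cong)
    then show "integrable N w'"
      by (subst N[symmetric]) (simp add: integrable_distr_eq)
    show "(\<integral>x. w' x \<partial>N) = 1"
      using M.w_integral w'(2) by (simp add: int_eq cong: Bochner_Integration.integral_cong)
    show "0 < w' y" if "y \<in> space N" for y
      using M.w_pos[of "\<psi> y"] w'(2)[of "\<psi> y"] \<psi>[OF that] by simp
    show "emeasure N (B' n) < \<top>" for n
    proof -
      have "emeasure N (B' n) = emeasure M (\<phi> -` B' n \<inter> space M)"
        by (subst N[symmetric]) (simp add: emeasure_distr)
      also have "\<phi> -` B' n \<inter> space M = B n"
        using B'(2) sets.sets_into_space[OF M.B_sets[of n]] by auto
      finally show ?thesis using M.B_finite by simp
    qed
    show "\<exists>c>0. \<forall>x\<in>B' n. \<forall>y\<in>B' n. c \<le> w' (d' x y) \<and> w' (d' x y) \<le> 1 / c" for n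
    proof -
      obtain c where c: "0 < c" "\<And>x y. x \<in> B n \<Longrightarrow> y \<in> B n \<Longrightarrow> c \<le> w (d x y) \<and> w (d x y) \<le> 1 / c"
        using M.w_bounds[of n] by blast
      show ?thesis
      proof (intro exI[of _ c] conjI c(1) ballI)
        fix x y assume xy: "x \<in> B' n" "y \<in> B' n"
        then have s: "x \<in> space N" "y \<in> space N" using sets.sets_into_space[OF B'(1)] by auto
        have "\<psi> x \<in> B n" "\<psi> y \<in> B n" using B'(2)[of "\<psi> x" n] B'(2)[of "\<psi> y" n] \<psi>[OF s(1)] \<psi>[OF s(2)] xy by auto
        moreover have "w' (d' x y) = w (d (\<psi> x) (\<psi> y))"
          using w'(2)[OF dM, of "\<psi> x" "\<psi> y"] d'(2)[of "\<psi> x" "\<psi> y"] \<psi>[OF s(1)] \<psi>[OF s(2)] by simp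
        ultimately show "c \<le> w' (d' x y)" "w' (d' x y) \<le> 1 / c" using c(2)[of "\<psi> x" "\<psi> y"] by auto
      qed
    qed
  qed measurable
  show ?thesis
  proof (intro epi_space.intro epi_space_axioms.intro R.reference_space_axioms)
    fix n f1 f2 g
    assume f1: "bdd_supp N (B' n) f1" and f2: "bdd_supp N (B' n) f2" and g: "comparable N w' g"
    have m[measurable]: "f1 \<in> borel_measurable N" "f2 \<in> borel_measurable N" "g \<in> borel_measurable N"
      using f1 f2 g by (auto simp: bdd_supp_def comparable_def)
    have pull: "bdd_supp M (B n) (\<lambda>x. f (\<phi> x))" if f: "bdd_supp N (B' n) f" for f
    proof -
      obtain C where [measurable]: "f \<in> borel_measurable N"
        and C: "\<And>y. y \<in> space N \<Longrightarrow> 0 \<le> f y \<and> f y \<le> C \<and> (y \<notin> B' n \<longrightarrow> f y = 0)"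
        using f unfolding bdd_supp_def by blast
      show ?thesis unfolding bdd_supp_def
      proof (intro conjI exI[of _ C] ballI)
        show "(\<lambda>x. f (\<phi> x)) \<in> borel_measurable M" by measurable
      qed (use C measurable_space[OF \<phi>] B'(2) in auto)
    qed
    have pg: "comparable M w (\<lambda>x. g (\<phi> x))"
    proof -
      obtain c where "0 < c" and c: "\<And>y. y \<in> space N \<Longrightarrow> c * w' y \<le> g y \<and> g y \<le> w' y / c"
        using g unfolding comparable_def by blast
      show ?thesis unfolding comparable_def
      proof (intro conjI exI[of _ c] ballI \<open>0 < c\<close>)
        show "(\<lambda>x. g (\<phi> x)) \<in> borel_measurable M" by measurable
        show "c * w x \<le> g (\<phi> x)" "g (\<phi> x) \<le> w x / c" if "x \<in> space M" for x
          using c[OF measurable_space[OF \<phi> that]] w'(2)[OF that] by auto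
      qed
    qed
    have NN: "N \<Otimes>\<^sub>M N = distr (M \<Otimes>\<^sub>M M) (N \<Otimes>\<^sub>M N) (\<lambda>(x, y). (\<phi> x, \<phi> y))"
      using pair_measure_distr[of \<phi> M N \<phi> M N] N N.sigma_finite_measure_axioms by simp
    have "(\<integral>z. epi_integrand d' k f1 f2 g z \<partial>(N \<Otimes>\<^sub>M N))
      = (\<integral>z. epi_integrand d' k f1 f2 g ((\<lambda>(x, y). (\<phi> x, \<phi> y)) z) \<partial>(M \<Otimes>\<^sub>M M))"
    proof (subst NN, rule integral_distr)
      show "(\<lambda>(x, y). (\<phi> x, \<phi> y)) \<in> M \<Otimes>\<^sub>M M \<rightarrow>\<^sub>M N \<Otimes>\<^sub>M N" by measurable
      show "epi_integrand d' k f1 f2 g \<in> borel_measurable (N \<Otimes>\<^sub>M N)"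
        by (rule R.epi_integrand_measurable) (rule m)+
    qed
    also have "\<dots> = (\<integral>z. epi_integrand d k (\<lambda>x. f1 (\<phi> x)) (\<lambda>x. f2 (\<phi> x)) (\<lambda>x. g (\<phi> x)) z \<partial>(M \<Otimes>\<^sub>M M))"
      by (intro Bochner_Integration.integral_cong) (auto simp: epi_integrand_def space_pair_measure d'(2))
    also have "\<dots> \<le> (\<integral>x. f1 (\<phi> x) \<partial>M) * (\<integral>x. f2 (\<phi> x) \<partial>M) *
      (ln (\<integral>x. g (\<phi> x) \<partial>M) - ln (\<integral>x. f1 (\<phi> x) \<partial>M) / 2 - ln (\<integral>x. f2 (\<phi> x) \<partial>M) / 2)"
      by (rule M.epi[OF pull[OF f1] pull[OF f2] pg])
    finally show "(\<integral>z. epi_integrand d' k f1 f2 g z \<partial>(N \<Otimes>\<^sub>M N)) \<le>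
      (\<integral>x. f1 x \<partial>N) * (\<integral>x. f2 x \<partial>N) *
      (ln (\<integral>x. g x \<partial>N) - ln (\<integral>x. f1 x \<partial>N) / 2 - ln (\<integral>x. f2 x \<partial>N) / 2)"
      by (simp add: int_eq)
  qed
qed

text \<open>The zero-dimensional base case: on a single atom of mass 1 both sides of the inequality
  coincide.\<close>

lemma epi_space_singleton:
  "epi_space (count_space {u}) (\<lambda>x y. u) (\<lambda>x. 1) (\<lambda>n. {u}) 0"
proof -
  let ?M = "count_space {u}"
  have MM: "?M \<Otimes>\<^sub>M ?M = count_space ({u} \<times> {u})" by (rule pair_measure_count_space) auto
  interpret sigma_finite_measure ?M by (rule sigma_finite_measure_count_space_finite) simp
  interpret reference_space ?M "\<lambda>x y. u" "\<lambda>x. 1" "\<lambda>n. {u}"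
    by unfold_locales (auto simp: lebesgue_integral_count_space_finite integrable_count_space intro!: exI[of _ 1])
  show ?thesis
  proof (intro epi_space.intro epi_space_axioms.intro reference_space_axioms)
    fix f1 f2 g
    show "(\<integral>z. epi_integrand (\<lambda>x y. u) 0 f1 f2 g z \<partial>(?M \<Otimes>\<^sub>M ?M)) \<le> (\<integral>x. f1 x \<partial>?M) * (\<integral>x. f2 x \<partial>?M) *
      (ln (\<integral>x. g x \<partial>?M) - ln (\<integral>x. f1 x \<partial>?M) / 2 - ln (\<integral>x. f2 x \<partial>?M) / 2)"
      unfolding MM by (simp add: lebesgue_integral_count_space_finite epi_integrand_def)
  qed
qed

lemma distr_PiM_insert:
  assumes I: "finite I" "i \<notin> I"
  shows "distr (Pi\<^sub>M I (\<lambda>_. lborel) \<Otimes>\<^sub>M lborel) (Pi\<^sub>M (insert i I) (\<lambda>_. lborel)) (\<lambda>(s, x). s(i := x))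
    = Pi\<^sub>M (insert i I) (\<lambda>_. lborel :: real measure)"
proof -
  interpret product_sigma_finite "\<lambda>_. lborel :: real measure" by standard
  show ?thesis
  proof (rule measure_eqI)
    fix X assume "X \<in> sets (distr (Pi\<^sub>M I (\<lambda>_. lborel) \<Otimes>\<^sub>M lborel) (Pi\<^sub>M (insert i I) (\<lambda>_. lborel :: real measure)) (\<lambda>(s, x). s(i := x)))"
    then have [measurable]: "X \<in> sets (Pi\<^sub>M (insert i I) (\<lambda>_. lborel :: real measure))" by simp
    have m: "(\<lambda>(s, x). s(i := x)) \<in> Pi\<^sub>M I (\<lambda>_. lborel) \<Otimes>\<^sub>M lborel \<rightarrow>\<^sub>M Pi\<^sub>M (insert i I) (\<lambda>_. lborel :: real measure)"
      by (rule measurable_add_dim)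
    have m': "(\<lambda>z. indicator X ((\<lambda>(s, x). s(i := x)) z) :: ennreal) \<in> borel_measurable (Pi\<^sub>M I (\<lambda>_. lborel) \<Otimes>\<^sub>M (lborel :: real measure))"
      by (rule measurable_compose[OF m]) simp
    have "emeasure (distr (Pi\<^sub>M I (\<lambda>_. lborel) \<Otimes>\<^sub>M lborel) (Pi\<^sub>M (insert i I) (\<lambda>_. lborel)) (\<lambda>(s, x). s(i := x))) X
      = (\<integral>\<^sup>+z. indicator X ((\<lambda>(s, x). s(i := x)) z) \<partial>(Pi\<^sub>M I (\<lambda>_. lborel) \<Otimes>\<^sub>M lborel))"
      by (subst nn_integral_distr[OF m, symmetric]) simp_all
    also have "\<dots> = (\<integral>\<^sup>+s. \<integral>\<^sup>+x. indicator X (s(i := x)) \<partial>lborel \<partial>Pi\<^sub>M I (\<lambda>_. lborel))"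
      using lborel.nn_integral_fst[OF m'] by simp
    also have "\<dots> = (\<integral>\<^sup>+s. indicator X s \<partial>Pi\<^sub>M (insert i I) (\<lambda>_. lborel))"
      by (subst product_nn_integral_insert[OF I]) simp_all
    finally show "emeasure (distr (Pi\<^sub>M I (\<lambda>_. lborel) \<Otimes>\<^sub>M lborel) (Pi\<^sub>M (insert i I) (\<lambda>_. lborel)) (\<lambda>(s, x). s(i := x))) X
      = emeasure (Pi\<^sub>M (insert i I) (\<lambda>_. lborel)) X" by simp
  qed simp
qed

text \<open>The induction runs over finite index sets, since the dimension of a Euclidean space is
  fixed by its type. Adjoining an index is a product with the real line followed by the update map,
  and contributes one more (ln 2) / 2.\<close>

lemma epi_space_PiM:
  assumes "finite I"
  shows "epi_space (Pi\<^sub>M I (\<lambda>_. lborel)) (\<lambda>s t. \<lambda>i\<in>I. s i - t i) (\<lambda>s. \<Prod>i\<in>I. std_normal_density (s i))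
    (\<lambda>n. Pi\<^sub>E I (\<lambda>_. {-real n..real n})) (real (card I) * (ln 2 / 2))"
  using assms
proof induction
  case empty
  \<comment> \<open>The product over no index is one point: the function that is
    \<open>undefined\<close> everywhere.\<close>
  show ?case
    using epi_space_singleton[of "\<lambda>_. undefined"] by (simp add: PiM_empty restrict_def)
next
  case (insert i I)
  interpret product_sigma_finite "\<lambda>_. lborel :: real measure" by standard
  have ne: "j \<noteq> i" if "j \<in> I" for j using that insert.hyps by auto
  have "epi_space (Pi\<^sub>M (insert i I) (\<lambda>_. lborel)) (\<lambda>s t. \<lambda>i\<in>insert i I. s i - t i) (\<lambda>s. \<Prod>i\<in>insert i I. std_normal_density (s i))
    (\<lambda>n. Pi\<^sub>E (insert i I) (\<lambda>_. {-real n..real n})) (real (card I) * (ln 2 / 2) + ln 2 / 2)"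
  proof (rule epi_space_distr[OF epi_space_pair[OF insert.IH epi_space_real], where \<phi>="\<lambda>(s, x). s(i := x)"
        and \<psi>="\<lambda>s. (restrict s I, s i)"])
    show "(\<lambda>(s, x). s(i := x)) \<in> Pi\<^sub>M I (\<lambda>_. lborel) \<Otimes>\<^sub>M lborel \<rightarrow>\<^sub>M Pi\<^sub>M (insert i I) (\<lambda>_. lborel :: real measure)"
      by (rule measurable_add_dim)
    show "distr (Pi\<^sub>M I (\<lambda>_. lborel) \<Otimes>\<^sub>M lborel) (Pi\<^sub>M (insert i I) (\<lambda>_. lborel)) (\<lambda>(s, x). s(i := x))
      = Pi\<^sub>M (insert i I) (\<lambda>_. lborel :: real measure)"
      by (rule distr_PiM_insert[OF insert.hyps])
    show "sigma_finite_measure (Pi\<^sub>M (insert i I) (\<lambda>_. lborel :: real measure))"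
      using insert.hyps by (intro sigma_finite) simp
    show "(\<lambda>(s, t). \<lambda>j\<in>insert i I. s j - t j) \<in> Pi\<^sub>M (insert i I) (\<lambda>_. lborel) \<Otimes>\<^sub>M Pi\<^sub>M (insert i I) (\<lambda>_. lborel)
        \<rightarrow>\<^sub>M Pi\<^sub>M (insert i I) (\<lambda>_. lborel :: real measure)"
      unfolding case_prod_unfold by (rule measurable_restrict) measurable
    show "(\<lambda>s. \<Prod>j\<in>insert i I. std_normal_density (s j)) \<in> borel_measurable (Pi\<^sub>M (insert i I) (\<lambda>_. lborel))"
      by measurable
    show "Pi\<^sub>E (insert i I) (\<lambda>_. {-real n..real n}) \<in> sets (Pi\<^sub>M (insert i I) (\<lambda>_. lborel))" for n
      using insert.hyps by (intro sets_PiM_I_finite) auto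
    show "(\<Prod>j\<in>insert i I. std_normal_density ((case z of (s, x) \<Rightarrow> s(i := x)) j))
        = (\<Prod>j\<in>I. std_normal_density (fst z j)) * std_normal_density (snd z)" for z
    proof -
      have "(\<Prod>j\<in>I. std_normal_density (((fst z)(i := snd z)) j)) = (\<Prod>j\<in>I. std_normal_density (fst z j))"
        using ne by (intro prod.cong) auto
      then show ?thesis using insert.hyps by (simp add: case_prod_unfold mult.commute)
    qed
  qed (use insert.hyps ne in \<open>auto simp: space_pair_measure space_PiM PiE_iff extensional_def fun_eq_iff restrict_def\<close>)
  moreover have "real (card (insert i I)) * (ln 2 / 2) = real (card I) * (ln 2 / 2) + ln 2 / 2"
    using insert.hyps by (simp add: distrib_right)
  ultimately show ?case by (simp only:)
qed

text \<open>Lebesgue measure is the image of the product of one-dimensional Lebesgue measures under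
  the map that assembles a vector from its coordinates; this map is linear, hence respects
  differences.\<close>

lemma epi_space_euclidean:
  "epi_space (lborel :: 'a::euclidean_space measure) (-) (\<lambda>x. \<Prod>b\<in>Basis. std_normal_density (x \<bullet> b))
    (\<lambda>n. {x. \<forall>b\<in>Basis. \<bar>x \<bullet> b\<bar> \<le> real n}) (real DIM('a) * (ln 2 / 2))"
proof (rule epi_space_distr[OF epi_space_PiM[OF finite_Basis], where \<phi>="\<lambda>s. \<Sum>b\<in>Basis. s b *\<^sub>R b"
      and \<psi>="\<lambda>x. \<lambda>b\<in>Basis. x \<bullet> b"])
  show "(\<lambda>s. \<Sum>b\<in>Basis. s b *\<^sub>R b) \<in> Pi\<^sub>M Basis (\<lambda>_. lborel) \<rightarrow>\<^sub>M (lborel :: 'a measure)"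
    by measurable
  show "distr (Pi\<^sub>M Basis (\<lambda>_. lborel)) lborel (\<lambda>s. \<Sum>b\<in>Basis. s b *\<^sub>R b) = (lborel :: 'a measure)"
    by (subst (2) lborel_eq, rule distr_cong) simp_all
  show "sigma_finite_measure (lborel :: 'a measure)" by (rule lborel.sigma_finite_measure_axioms)
  show "(\<lambda>(x, y). x - y) \<in> (lborel :: 'a measure) \<Otimes>\<^sub>M lborel \<rightarrow>\<^sub>M lborel"
    unfolding case_prod_unfold by simp
  show "(\<lambda>x :: 'a. \<Prod>b\<in>Basis. std_normal_density (x \<bullet> b)) \<in> borel_measurable lborel" by measurable
  show "{x :: 'a. \<forall>b\<in>Basis. \<bar>x \<bullet> b\<bar> \<le> real n} \<in> sets lborel" for n by measurable
  fix s t :: "'a \<Rightarrow> real"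
  show "(\<Sum>b\<in>Basis. (\<lambda>i\<in>Basis. s i - t i) b *\<^sub>R b) = (\<Sum>b\<in>Basis. s b *\<^sub>R b) - (\<Sum>b\<in>Basis. t b *\<^sub>R b)"
    by (simp add: sum_subtractf scaleR_diff_left)
next
  fix s :: "'a \<Rightarrow> real" and n assume "s \<in> space (Pi\<^sub>M Basis (\<lambda>_. lborel))"
  then show "(\<Sum>b\<in>Basis. s b *\<^sub>R b) \<in> {x. \<forall>b\<in>Basis. \<bar>x \<bullet> b\<bar> \<le> real n} \<longleftrightarrow> s \<in> Pi\<^sub>E Basis (\<lambda>_. {- real n..real n})"
    by (auto simp: space_PiM PiE_iff abs_le_iff)
qed (auto simp: space_PiM euclidean_representation)

section \<open>From bounded to general densities\<close>

text \<open>The clamping interval from w / j to j w contains \<open>w\<close>, so clamping can only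
  move \<open>ln g\<close> towards \<open>ln w\<close>. The bound is uniform in
  \<open>j\<close>.\<close>

lemma clamp_ln_dist:
  fixes g w j :: real
  assumes "0 < g" "0 < w" "1 \<le> j"
  shows "\<bar>ln (max (w / j) (min (j * w) g)) - ln w\<bar> \<le> \<bar>ln g - ln w\<bar>"
proof -
  have wj: "w / j \<le> w" "w \<le> j * w" using assms by (simp_all add: field_simps)
  have p: "0 < w / j" using assms by simp
  consider "g \<le> w / j" | "w / j \<le> g" "g \<le> j * w" | "j * w \<le> g" by linarith
  then show ?thesis
  proof cases
    case 1
    then have e: "max (w / j) (min (j * w) g) = w / j" using wj by linarith
    have "ln g \<le> ln (w / j)" "ln (w / j) \<le> ln w" using 1 wj p assms by simp_all
    then show ?thesis unfolding e by linarith
  next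
    case 2
    then have "max (w / j) (min (j * w) g) = g" by linarith
    then show ?thesis by simp
  next
    case 3
    then have e: "max (w / j) (min (j * w) g) = j * w" using wj by linarith
    have "0 < j * w" using assms by simp
    then have "ln (j * w) \<le> ln g" "ln w \<le> ln (j * w)"
      using 3 wj assms(1,2) by (simp_all only: ln_le_cancel_iff)
    then show ?thesis unfolding e by linarith
  qed
qed

context epi_space
begin

text \<open>Comparability of \<open>g\<close> is removed by clamping \<open>g\<close> between
  multiples of \<open>w\<close> and letting these open up. \<open>pos\<close> ensures that, wherever
  the weight is nonzero, the logarithms converge at a positive limit. The mass of \<open>g\<close>
  leaves no term on the right because ln 1 = 0.\<close>

lemma epi_bdd_supp:
  assumes f1: "bdd_supp M (B n) f1" and f2: "bdd_supp M (B n) f2"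
    and g: "integrable M g" "\<And>x. x \<in> space M \<Longrightarrow> 0 \<le> g x" "(\<integral>x. g x \<partial>M) = 1"
    and pos: "AE z in M \<Otimes>\<^sub>M M. f1 (fst z) * f2 (snd z) \<noteq> 0 \<longrightarrow> 0 < g (d (fst z) (snd z))"
    and int: "integrable (M \<Otimes>\<^sub>M M) (epi_integrand d k f1 f2 g)"
  shows "(\<integral>z. epi_integrand d k f1 f2 g z \<partial>(M \<Otimes>\<^sub>M M)) \<le>
      (\<integral>x. f1 x \<partial>M) * (\<integral>x. f2 x \<partial>M) * (- ln (\<integral>x. f1 x \<partial>M) / 2 - ln (\<integral>x. f2 x \<partial>M) / 2)"
proof -
  have m[measurable]: "f1 \<in> borel_measurable M" "f2 \<in> borel_measurable M" "g \<in> borel_measurable M"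
    using f1 f2 g by (auto simp: bdd_supp_def)
  define gj where "gj j x = max (w x / (real j + 1)) (min ((real j + 1) * w x) (g x))" for j :: nat and x
  have mgj[measurable]: "gj j \<in> borel_measurable M" for j unfolding gj_def by measurable
  have bg: "w x / (real j + 1) \<le> gj j x" "gj j x \<le> (real j + 1) * w x" "gj j x \<le> g x + w x" if x: "x \<in> space M" for j x
  proof -
    have "1 * w x \<le> (real j + 1) * w x" using w_pos[OF x] by (intro mult_right_mono) auto
    moreover have "w x / (real j + 1) \<le> w x / 1" using w_pos[OF x] by (intro divide_left_mono) auto
    ultimately show "w x / (real j + 1) \<le> gj j x" "gj j x \<le> (real j + 1) * w x" "gj j x \<le> g x + w x"
      using w_pos[OF x] g(2)[OF x] unfolding gj_def by linarith+
  qed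
  have cg: "comparable M w (gj j)" for j unfolding comparable_def
  proof (intro conjI exI[of _ "1 / (real j + 1)"] ballI mgj)
    show "1 / (real j + 1) * w x \<le> gj j x" if "x \<in> space M" for x using bg(1)[OF that] by simp
    show "gj j x \<le> w x / (1 / (real j + 1))" if "x \<in> space M" for x using bg(2)[OF that] by (simp add: mult.commute)
  qed simp
  have cw: "comparable M w w" unfolding comparable_def by (intro conjI exI[of _ 1]) auto
  have lim: "(\<lambda>j. gj j x) \<longlonglongrightarrow> g x" if x: "x \<in> space M" for x
  proof -
    have l0: "(\<lambda>j. w x / (real j + 1)) \<longlonglongrightarrow> 0"
      using tendsto_mult_right[OF LIMSEQ_inverse_real_of_nat, of "w x"] by (simp add: divide_inverse ac_simps)
    \<comment> \<open>Once j exceeds g x / w x the upper clamp is inactive.\<close>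
    obtain J :: nat where J: "g x / w x \<le> real J" using real_arch_simple by blast
    have "gj j x = max (w x / (real j + 1)) (g x)" if "J \<le> j" for j
    proof -
      have "g x / w x \<le> real j + 1" using J that by linarith
      then have "g x \<le> (real j + 1) * w x" using w_pos[OF x] by (simp add: pos_divide_le_eq)
      then show ?thesis unfolding gj_def by simp
    qed
    then have "eventually (\<lambda>j. max (w x / (real j + 1)) (g x) = gj j x) sequentially"
      by (intro eventually_sequentiallyI[of J]) simp
    moreover have "(\<lambda>j. max (w x / (real j + 1)) (g x)) \<longlonglongrightarrow> max 0 (g x)"
      by (intro tendsto_max l0 tendsto_const)
    ultimately have "(\<lambda>j. gj j x) \<longlonglongrightarrow> max 0 (g x)" by (rule Lim_transform_eventually[rotated])
    then show ?thesis using g(2)[OF x] by simp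
  qed
  have Glim: "(\<lambda>j. \<integral>x. gj j x \<partial>M) \<longlonglongrightarrow> (\<integral>x. g x \<partial>M)"
  proof (rule integral_dominated_convergence[where w="\<lambda>x. g x + w x"])
    show "integrable M (\<lambda>x. g x + w x)" using g(1) w_integrable by simp
    show "AE x in M. (\<lambda>j. gj j x) \<longlonglongrightarrow> g x" using lim by simp
    show "AE x in M. norm (gj j x) \<le> g x + w x" for j
    proof (rule AE_I2)
      fix x assume x: "x \<in> space M"
      have "0 \<le> w x / (real j + 1)" using w_pos[OF x] by simp
      then show "norm (gj j x) \<le> g x + w x" using bg[OF x, of j] by simp
    qed
  qed measurable
  have dM: "d (fst z) (snd z) \<in> space M" if "z \<in> space (M \<Otimes>\<^sub>M M)" for z
    using measurable_space[OF d_measurable that] by (simp add: case_prod_unfold)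
  let ?e = "epi_integrand d k f1 f2"
  have JL: "(\<lambda>j. \<integral>z. ?e (gj j) z \<partial>(M \<Otimes>\<^sub>M M)) \<longlonglongrightarrow> (\<integral>z. ?e g z \<partial>(M \<Otimes>\<^sub>M M))"
  \<comment> \<open>By \<open>clamp_ln_dist\<close> the clamped integrand is no further from the
    integrand with \<open>w\<close> than the integrand with \<open>g\<close> is, and both of these
    are integrable.\<close>
  proof (rule integral_dominated_convergence[where w="\<lambda>z. \<bar>?e w z\<bar> + \<bar>?e g z - ?e w z\<bar>"])
    show "integrable (M \<Otimes>\<^sub>M M) (\<lambda>z. \<bar>?e w z\<bar> + \<bar>?e g z - ?e w z\<bar>)"
      by (intro Bochner_Integration.integrable_add integrable_abs Bochner_Integration.integrable_diff
          epi_integrand_integrable[OF f1 f2 cw] int)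
    show "AE z in M \<Otimes>\<^sub>M M. (\<lambda>j. ?e (gj j) z) \<longlonglongrightarrow> ?e g z"
      using pos AE_space
    proof eventually_elim
      case (elim z)
      show ?case
      proof (cases "f1 (fst z) * f2 (snd z) = 0")
        case True
        then show ?thesis by (auto simp: epi_integrand_def case_prod_unfold)
      next
        case False
        then have "g (d (fst z) (snd z)) \<noteq> 0" using elim by auto
        then show ?thesis unfolding epi_integrand_def case_prod_unfold
          by (intro tendsto_intros lim dM elim)
      qed
    qed
    show "AE z in M \<Otimes>\<^sub>M M. norm (?e (gj j) z) \<le> \<bar>?e w z\<bar> + \<bar>?e g z - ?e w z\<bar>" for j
      using pos AE_space
    proof eventually_elim
      case (elim z)
      let ?p = "f1 (fst z) * f2 (snd z)" and ?x = "d (fst z) (snd z)"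
      have diff: "?e u z - ?e w z = ?p * (ln (u ?x) - ln (w ?x))" for u
        by (simp add: epi_integrand_def case_prod_unfold algebra_simps)
      have "\<bar>?p * (ln (gj j ?x) - ln (w ?x))\<bar> \<le> \<bar>?p * (ln (g ?x) - ln (w ?x))\<bar>"
      proof (cases "?p = 0")
        case False
        then have "0 < g ?x" using elim by auto
        then have "\<bar>ln (gj j ?x) - ln (w ?x)\<bar> \<le> \<bar>ln (g ?x) - ln (w ?x)\<bar>"
          unfolding gj_def using w_pos[OF dM[OF elim(2)]] by (intro clamp_ln_dist) auto
        then show ?thesis unfolding abs_mult by (intro mult_left_mono) auto
      qed auto
      then show ?case unfolding diff[symmetric] real_norm_def by linarith
    qed
    show "?e g \<in> borel_measurable (M \<Otimes>\<^sub>M M)" by (rule borel_measurable_integrable[OF int])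
    show "?e (gj j) \<in> borel_measurable (M \<Otimes>\<^sub>M M)" for j by (intro epi_integrand_measurable m mgj)
  qed
  have RL: "(\<lambda>j. (\<integral>x. f1 x \<partial>M) * (\<integral>x. f2 x \<partial>M) *
      (ln (\<integral>x. gj j x \<partial>M) - ln (\<integral>x. f1 x \<partial>M) / 2 - ln (\<integral>x. f2 x \<partial>M) / 2))
    \<longlonglongrightarrow> (\<integral>x. f1 x \<partial>M) * (\<integral>x. f2 x \<partial>M) *
      (ln (\<integral>x. g x \<partial>M) - ln (\<integral>x. f1 x \<partial>M) / 2 - ln (\<integral>x. f2 x \<partial>M) / 2)"
    using g(3) by (intro tendsto_intros Glim) simp
  have "(\<integral>z. ?e g z \<partial>(M \<Otimes>\<^sub>M M)) \<le> (\<integral>x. f1 x \<partial>M) * (\<integral>x. f2 x \<partial>M) *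
      (ln (\<integral>x. g x \<partial>M) - ln (\<integral>x. f1 x \<partial>M) / 2 - ln (\<integral>x. f2 x \<partial>M) / 2)"
    by (rule LIMSEQ_le[OF JL RL]) (use epi[OF f1 f2 cg] in blast)
  then show ?thesis using g(3) by simp
qed

text \<open>
  The hypothesis \<open>pos\<close> excludes the points where \<open>g\<close> vanishes: there the logarithm should be
  \<open>-\<infinity>\<close>, not \<open>0\<close>.
\<close>

lemma epi_density:
  assumes exh: "\<And>x. x \<in> space M \<Longrightarrow> \<forall>\<^sub>F n in sequentially. x \<in> B n"
    and f1: "integrable M f1" "\<And>x. x \<in> space M \<Longrightarrow> 0 \<le> f1 x" "(\<integral>x. f1 x \<partial>M) = 1" "integrable M (\<lambda>x. f1 x * ln (f1 x))"
    and f2: "integrable M f2" "\<And>x. x \<in> space M \<Longrightarrow> 0 \<le> f2 x" "(\<integral>x. f2 x \<partial>M) = 1" "integrable M (\<lambda>x. f2 x * ln (f2 x))"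
    and g: "integrable M g" "\<And>x. x \<in> space M \<Longrightarrow> 0 \<le> g x" "(\<integral>x. g x \<partial>M) = 1"
    and pos: "AE z in M \<Otimes>\<^sub>M M. f1 (fst z) * f2 (snd z) \<noteq> 0 \<longrightarrow> 0 < g (d (fst z) (snd z))"
    and int: "integrable (M \<Otimes>\<^sub>M M) (\<lambda>z. f1 (fst z) * f2 (snd z) * ln (g (d (fst z) (snd z))))"
  shows "(\<integral>z. f1 (fst z) * f2 (snd z) * ln (g (d (fst z) (snd z))) \<partial>(M \<Otimes>\<^sub>M M)) + k
    \<le> (\<integral>x. f1 x * ln (f1 x) \<partial>M) / 2 + (\<integral>x. f2 x * ln (f2 x) \<partial>M) / 2"
proof -
  interpret P: pair_sigma_finite M M ..
  have m[measurable]: "f1 \<in> borel_measurable M" "f2 \<in> borel_measurable M" "g \<in> borel_measurable M"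
    using f1 f2 g by auto
  \<comment> \<open>Truncation multiplies by the indicator of a sublevel set instead of taking a
    minimum: the truncated integrand is then at each point either the full one or 0, so the full one
    dominates.\<close>
  define t where "t n f x = indicator (B n \<inter> {x \<in> space M. f x \<le> real n}) x * f x" for n and f :: "'x \<Rightarrow> real" and x
  have bs: "bdd_supp M (B n) (t n f)" if [measurable]: "f \<in> borel_measurable M" and "\<And>x. x \<in> space M \<Longrightarrow> 0 \<le> f x" for n f
    unfolding bdd_supp_def t_def using that(2)
    by (intro conjI exI[of _ "real n"] ballI) (auto simp: indicator_def)
  have lim: "(\<lambda>n. t n f x) \<longlonglongrightarrow> f x" if x: "x \<in> space M" for f x
  proof -
    obtain N :: nat where N: "f x \<le> real N" using real_arch_simple by blast
    have "eventually (\<lambda>n. f x = t n f x) sequentially"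
      using exh[OF x] eventually_ge_at_top[of N]
    proof eventually_elim
      case (elim n)
      then show ?case using N x by (auto simp: t_def)
    qed
    then show ?thesis by (rule Lim_transform_eventually[rotated]) simp
  qed
  let ?e = "\<lambda>f1 f2. epi_integrand d k f1 f2 g"
  have e: "?e f1 f2 z = f1 (fst z) * f2 (snd z) * ln (g (d (fst z) (snd z))) + k * (f1 (fst z) * f2 (snd z))
      - (f1 (fst z) * ln (f1 (fst z))) * f2 (snd z) / 2 - f1 (fst z) * (f2 (snd z) * ln (f2 (snd z))) / 2" for z
    by (simp add: epi_integrand_def case_prod_unfold algebra_simps)
  note prods = P.integrable_product[OF f1(1) f2(1)] P.integrable_product[OF f1(4) f2(1)] P.integrable_product[OF f1(1) f2(4)]
  have ie: "integrable (M \<Otimes>\<^sub>M M) (?e f1 f2)"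
    unfolding e[abs_def] using int prods by simp
  have Ie: "(\<integral>z. ?e f1 f2 z \<partial>(M \<Otimes>\<^sub>M M)) = (\<integral>z. f1 (fst z) * f2 (snd z) * ln (g (d (fst z) (snd z))) \<partial>(M \<Otimes>\<^sub>M M)) + k
      - (\<integral>x. f1 x * ln (f1 x) \<partial>M) / 2 - (\<integral>x. f2 x * ln (f2 x) \<partial>M) / 2"
    unfolding e using int prods
    by (simp add: P.integral_product[OF f1(1) f2(1)] P.integral_product[OF f1(4) f2(1)] P.integral_product[OF f1(1) f2(4)] f1(3) f2(3))
  have et: "?e (t n f1) (t n f2) z = ?e f1 f2 z \<or> ?e (t n f1) (t n f2) z = 0" for n z
    by (auto simp: epi_integrand_def case_prod_unfold t_def indicator_def)
  have dom: "norm (?e (t n f1) (t n f2) z) \<le> norm (?e f1 f2 z)" for n z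
    using et[of n z] by auto
  have mt: "t n f1 \<in> borel_measurable M" "t n f2 \<in> borel_measurable M" for n
    using bs[OF m(1) f1(2)] bs[OF m(2) f2(2)] by (auto simp: bdd_supp_def)
  have mte: "?e (t n f1) (t n f2) \<in> borel_measurable (M \<Otimes>\<^sub>M M)" for n
    by (intro epi_integrand_measurable mt m)
  have ite: "integrable (M \<Otimes>\<^sub>M M) (?e (t n f1) (t n f2))" for n
    by (rule Bochner_Integration.integrable_bound[OF ie mte]) (use dom in simp)
  have JL: "(\<lambda>n. \<integral>z. ?e (t n f1) (t n f2) z \<partial>(M \<Otimes>\<^sub>M M)) \<longlonglongrightarrow> (\<integral>z. ?e f1 f2 z \<partial>(M \<Otimes>\<^sub>M M))"
  proof (rule integral_dominated_convergence[where w="\<lambda>z. norm (?e f1 f2 z)"])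
    show "AE z in M \<Otimes>\<^sub>M M. (\<lambda>n. ?e (t n f1) (t n f2) z) \<longlonglongrightarrow> ?e f1 f2 z"
    proof (rule AE_I2)
      fix z assume "z \<in> space (M \<Otimes>\<^sub>M M)"
      then have z: "fst z \<in> space M" "snd z \<in> space M" by (auto simp: space_pair_measure)
      obtain N1 N2 :: nat where N: "f1 (fst z) \<le> real N1" "f2 (snd z) \<le> real N2" using real_arch_simple by metis
      have "eventually (\<lambda>n. ?e f1 f2 z = ?e (t n f1) (t n f2) z) sequentially"
        using exh[OF z(1)] exh[OF z(2)] eventually_ge_at_top[of N1] eventually_ge_at_top[of N2]
      proof eventually_elim
        case (elim n)
        then show ?case using N z by (auto simp: t_def epi_integrand_def case_prod_unfold)
      qed
      then show "(\<lambda>n. ?e (t n f1) (t n f2) z) \<longlonglongrightarrow> ?e f1 f2 z"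
        by (rule Lim_transform_eventually[rotated]) simp
    qed
  qed (use dom ie mte in auto)
  have tl: "\<bar>t n f x\<bar> \<le> \<bar>f x\<bar>" for n f x by (auto simp: t_def indicator_def)
  have F1: "(\<lambda>n. \<integral>x. t n f1 x \<partial>M) \<longlonglongrightarrow> (\<integral>x. f1 x \<partial>M)"
    by (rule integral_dominated_convergence[where w="\<lambda>x. \<bar>f1 x\<bar>"]) (use f1(1) lim tl mt in auto)
  have F2: "(\<lambda>n. \<integral>x. t n f2 x \<partial>M) \<longlonglongrightarrow> (\<integral>x. f2 x \<partial>M)"
    by (rule integral_dominated_convergence[where w="\<lambda>x. \<bar>f2 x\<bar>"]) (use f2(1) lim tl mt in auto)
  have RL: "(\<lambda>n. (\<integral>x. t n f1 x \<partial>M) * (\<integral>x. t n f2 x \<partial>M) * (- ln (\<integral>x. t n f1 x \<partial>M) / 2 - ln (\<integral>x. t n f2 x \<partial>M) / 2))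
    \<longlonglongrightarrow> (\<integral>x. f1 x \<partial>M) * (\<integral>x. f2 x \<partial>M) * (- ln (\<integral>x. f1 x \<partial>M) / 2 - ln (\<integral>x. f2 x \<partial>M) / 2)"
    using f1(3) f2(3) by (intro tendsto_intros F1 F2) simp_all
  have "(\<integral>z. ?e (t n f1) (t n f2) z \<partial>(M \<Otimes>\<^sub>M M)) \<le>
      (\<integral>x. t n f1 x \<partial>M) * (\<integral>x. t n f2 x \<partial>M) * (- ln (\<integral>x. t n f1 x \<partial>M) / 2 - ln (\<integral>x. t n f2 x \<partial>M) / 2)" for n
  proof (rule epi_bdd_supp[OF bs[OF m(1) f1(2)] bs[OF m(2) f2(2)] g])
    show "AE z in M \<Otimes>\<^sub>M M. t n f1 (fst z) * t n f2 (snd z) \<noteq> 0 \<longrightarrow> 0 < g (d (fst z) (snd z))"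
      using pos by (rule eventually_mono) (auto simp: t_def)
  qed (auto intro: ite)
  then have "(\<integral>z. ?e f1 f2 z \<partial>(M \<Otimes>\<^sub>M M)) \<le> (\<integral>x. f1 x \<partial>M) * (\<integral>x. f2 x \<partial>M) * (- ln (\<integral>x. f1 x \<partial>M) / 2 - ln (\<integral>x. f2 x \<partial>M) / 2)"
    by (intro LIMSEQ_le[OF JL RL]) blast
  then show ?thesis unfolding Ie by (simp add: f1(3) f2(3))
qed

end

section \<open>Differences of random variables and mixtures\<close>

text \<open>The dual inequality with both densities equal to \<open>p\<close> and test density
  \<open>m\<close>. Integrals against \<open>q\<close> and against the joint density of (Y, Y') are
  both means over \<open>P\<close> of the same function of Y - Y', so integrability and positivity
  can be moved from one to the other.\<close>

lemma entropy_le_cross_entropy_diff: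
  fixes Y Y' :: "'w \<Rightarrow> 'a::euclidean_space"
  assumes P: "prob_space P" and indep: "prob_space.indep_var P borel Y borel Y'"
    and Y: "has_pdf P lborel Y p" and Y': "has_pdf P lborel Y' p"
    and Z: "has_pdf P lborel (\<lambda>w. Y w - Y' w) q"
    and fin: "finite_diff_entropy p"
    and m: "integrable lborel m" "\<And>z. 0 \<le> m z" "(\<integral>z. m z \<partial>lborel) = 1"
    and pos: "AE z in lborel. 0 < q z \<longrightarrow> 0 < m z"
    and int: "integrable lborel (\<lambda>z. q z * ln (m z))"
  shows "diff_entropy p + real DIM('a) / 2 * ln 2 \<le> - (\<integral>z. q z * ln (m z) \<partial>lborel)"
proof -
  interpret P: prob_space P by fact
  interpret E: epi_space "lborel :: 'a measure" "(-)" "\<lambda>x. \<Prod>b\<in>Basis. std_normal_density (x \<bullet> b)"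
    "\<lambda>n. {x. \<forall>b\<in>Basis. \<bar>x \<bullet> b\<bar> \<le> real n}" "real DIM('a) * (ln 2 / 2)"
    by (rule epi_space_euclidean)
  have p0: "0 \<le> p x" and q0: "0 \<le> q x" for x using Y Z by (auto simp: has_pdf_def is_pdf_def)
  have ip: "integrable lborel p" "(\<integral>x. p x \<partial>lborel) = 1" using Y by (auto simp: has_pdf_def is_pdf_def)
  have iq: "integrable lborel q" using Z by (auto simp: has_pdf_def is_pdf_def)
  have dY: "distributed P lborel Y (\<lambda>x. ennreal (p x))" and dY': "distributed P lborel Y' (\<lambda>x. ennreal (p x))"
    and dZ: "distributed P lborel (\<lambda>w. Y w - Y' w) (\<lambda>x. ennreal (q x))"
    using Y Y' Z by (auto simp: has_pdf_def)
  have [measurable]: "m \<in> borel_measurable borel" "p \<in> borel_measurable borel" "q \<in> borel_measurable borel"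
    using m ip iq by auto
  have rv[measurable]: "Y \<in> borel_measurable P" "Y' \<in> borel_measurable P"
    using dY dY' by (auto simp: distributed_def)
  have dl: "distr P lborel X = distr P borel X" for X :: "'w \<Rightarrow> 'a" by (rule distr_cong) auto
  have "distr P lborel Y \<Otimes>\<^sub>M distr P lborel Y' = distr P (lborel \<Otimes>\<^sub>M lborel) (\<lambda>w. (Y w, Y' w))"
    using P.indep_var_distribution_eq[of borel Y borel Y'] indep unfolding dl
    by (auto intro!: distr_cong sets_pair_measure_cong)
  from P.distributed_joint_indep'[OF lborel.sigma_finite_measure_axioms lborel.sigma_finite_measure_axioms dY dY' this]
  have "distributed P (lborel \<Otimes>\<^sub>M lborel) (\<lambda>w. (Y w, Y' w)) (\<lambda>(x, y). ennreal (p x) * ennreal (p y))" .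
  then have dYY: "distributed P (lborel \<Otimes>\<^sub>M lborel) (\<lambda>w. (Y w, Y' w)) (\<lambda>z. ennreal (p (fst z) * p (snd z)))"
    by (simp add: case_prod_unfold ennreal_mult p0)
  have iZ: "integrable P (\<lambda>w. ln (m (Y w - Y' w)))"
    using distributed_integrable[OF dZ, of "\<lambda>z. ln (m z)"] int q0 by simp
  have EZ: "(\<integral>z. q z * ln (m z) \<partial>lborel) = (\<integral>w. ln (m (Y w - Y' w)) \<partial>P)"
    using distributed_integral[OF dZ, of "\<lambda>z. ln (m z)"] q0 by simp
  have i: "integrable (lborel \<Otimes>\<^sub>M lborel) (\<lambda>z. p (fst z) * p (snd z) * ln (m (fst z - snd z)))"
    using distributed_integrable[OF dYY, of "\<lambda>z. ln (m (fst z - snd z))"] iZ p0 by simp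
  have EYY: "(\<integral>z. p (fst z) * p (snd z) * ln (m (fst z - snd z)) \<partial>(lborel \<Otimes>\<^sub>M lborel)) = (\<integral>w. ln (m (Y w - Y' w)) \<partial>P)"
    using distributed_integral[OF dYY, of "\<lambda>z. ln (m (fst z - snd z))"] p0 by simp
  \<comment> \<open>Positivity of \<open>m\<close> on the support of \<open>q\<close> means that
    \<open>m\<close> is almost surely positive at Y - Y', which is then read as a statement about
    almost all pairs.\<close>
  have "AE z in density lborel (\<lambda>z. ennreal (q z)). 0 < m z"
    using pos by (simp add: AE_density)
  then have "AE z in distr P lborel (\<lambda>w. Y w - Y' w). 0 < m z"
    unfolding distributed_distr_eq_density[OF dZ] .
  then have "AE w in P. 0 < m (Y w - Y' w)"
    by (subst (asm) AE_distr_iff) auto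
  then have "AE z in distr P (lborel \<Otimes>\<^sub>M lborel) (\<lambda>w. (Y w, Y' w)). 0 < m (fst z - snd z)"
  proof (subst AE_distr_iff)
    show "{z \<in> space (lborel \<Otimes>\<^sub>M lborel). 0 < m (fst z - snd z)} \<in> sets (lborel \<Otimes>\<^sub>M lborel)"
      by measurable
  qed auto
  then have "AE z in density (lborel \<Otimes>\<^sub>M lborel) (\<lambda>z. ennreal (p (fst z) * p (snd z))). 0 < m (fst z - snd z)"
    unfolding distributed_distr_eq_density[OF dYY] .
  then have pos': "AE z in lborel \<Otimes>\<^sub>M lborel. p (fst z) * p (snd z) \<noteq> 0 \<longrightarrow> 0 < m (fst z - snd z)"
    using p0 by (subst (asm) AE_density) (auto elim!: eventually_mono simp: less_le)
  have exh: "\<forall>\<^sub>F n in sequentially. x \<in> {x. \<forall>b\<in>Basis. \<bar>x \<bullet> b\<bar> \<le> real n}" for x :: 'a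
  proof -
    obtain N :: nat where N: "norm x \<le> real N" using real_arch_simple by blast
    show ?thesis
    proof (rule eventually_sequentiallyI[of N])
      fix n assume "N \<le> n"
      then have "\<bar>x \<bullet> b\<bar> \<le> real n" if "b \<in> Basis" for b
        using Basis_le_norm[OF that, of x] N by linarith
      then show "x \<in> {x. \<forall>b\<in>Basis. \<bar>x \<bullet> b\<bar> \<le> real n}" by simp
    qed
  qed
  have ipl: "integrable lborel (\<lambda>x. p x * ln (p x))"
    using fin by (simp add: finite_diff_entropy_def mult.commute)
  have "(\<integral>z. p (fst z) * p (snd z) * ln (m (fst z - snd z)) \<partial>(lborel \<Otimes>\<^sub>M lborel)) + real DIM('a) * (ln 2 / 2)
    \<le> (\<integral>x. p x * ln (p x) \<partial>lborel) / 2 + (\<integral>x. p x * ln (p x) \<partial>lborel) / 2"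
    by (rule E.epi_density[OF exh ip(1) p0 ip(2) ipl ip(1) p0 ip(2) ipl m pos' i])
  then show ?thesis unfolding EYY EZ[symmetric] by (simp add: diff_entropy_def mult.commute)
qed

text \<open>The domination u \<le> C v makes everything finite: |u ln v| is at most C |v ln v|, and
  u ln (u / v) lies between u - v and u |ln C|. Integrating the lower bound gives the inequality, as
  both masses are 1. For u a component of a mixture v, the reciprocal of its weight serves as
  C.\<close>

lemma gibbs_inequality:
  fixes u v :: "'a \<Rightarrow> real"
  assumes u: "integrable M u" "\<And>x. x \<in> space M \<Longrightarrow> 0 \<le> u x" "(\<integral>x. u x \<partial>M) = 1"
    and v: "integrable M v" "\<And>x. x \<in> space M \<Longrightarrow> 0 \<le> v x" "(\<integral>x. v x \<partial>M) = 1"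
    and C: "0 < C" "AE x in M. u x \<le> C * v x"
    and int: "integrable M (\<lambda>x. v x * ln (v x))"
  shows "integrable M (\<lambda>x. u x * ln (u x))" "integrable M (\<lambda>x. u x * ln (v x))"
    "(\<integral>x. u x * ln (v x) \<partial>M) \<le> (\<integral>x. u x * ln (u x) \<partial>M)"
proof -
  have [measurable]: "u \<in> borel_measurable M" "v \<in> borel_measurable M" using u v by auto
  show iuv: "integrable M (\<lambda>x. u x * ln (v x))"
  proof (rule Bochner_Integration.integrable_bound)
    show "integrable M (\<lambda>x. C * (v x * ln (v x)))" using int by simp
    show "AE x in M. norm (u x * ln (v x)) \<le> norm (C * (v x * ln (v x)))"
      using C(2) AE_space
    proof eventually_elim
      case (elim x)
      have "\<bar>u x\<bar> * \<bar>ln (v x)\<bar> \<le> \<bar>C * v x\<bar> * \<bar>ln (v x)\<bar>"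
        using elim u(2) C(1) by (intro mult_right_mono) auto
      then show ?case by (simp add: abs_mult)
    qed
  qed measurable
  define r where "r x = u x * (ln (u x) - ln (v x))" for x
  have r: "AE x in M. u x - v x \<le> r x \<and> r x \<le> u x * \<bar>ln C\<bar>"
    using C(2) AE_space
  proof eventually_elim
    case (elim x)
    show ?case
    proof (cases "u x = 0")
      case True
      then show ?thesis using v(2)[OF elim(2)] by (simp add: r_def)
    next
      case False
      then have ux: "0 < u x" using u(2)[OF elim(2)] by simp
      then have "0 < C * v x" using elim(1) by linarith
      then have vx: "0 < v x" using C(1) by (simp add: zero_less_mult_iff)
      have "ln (v x) - ln (u x) = ln (v x / u x)" using ux vx by (simp add: ln_div)
      also have "\<dots> \<le> v x / u x - 1" using ux vx by (intro ln_le_minus_one) simp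
      finally have "u x * (ln (v x) - ln (u x)) \<le> u x * (v x / u x - 1)"
        using ux by (intro mult_left_mono) auto
      also have "\<dots> = v x - u x" using ux by (simp add: field_simps)
      finally have 1: "u x - v x \<le> r x" by (simp add: r_def algebra_simps)
      have "ln (u x) \<le> ln (C * v x)" using elim(1) ux \<open>0 < C * v x\<close> by (simp only: ln_le_cancel_iff)
      also have "\<dots> = ln C + ln (v x)" using C(1) vx by (simp add: ln_mult)
      finally have "ln (u x) - ln (v x) \<le> \<bar>ln C\<bar>" by linarith
      then have "r x \<le> u x * \<bar>ln C\<bar>" unfolding r_def using ux by (intro mult_left_mono) auto
      with 1 show ?thesis by simp
    qed
  qed
  have ir: "integrable M r"
  proof (rule Bochner_Integration.integrable_bound)
    show "integrable M (\<lambda>x. u x + v x + u x * \<bar>ln C\<bar>)" using u v by simp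
    show "r \<in> borel_measurable M" unfolding r_def by measurable
    show "AE x in M. norm (r x) \<le> norm (u x + v x + u x * \<bar>ln C\<bar>)"
      using r AE_space
    proof eventually_elim
      case (elim x)
      have "0 \<le> u x * \<bar>ln C\<bar>" using u(2)[OF elim(2)] by simp
      then show ?case using elim(1) u(2)[OF elim(2)] v(2)[OF elim(2)] unfolding real_norm_def by linarith
    qed
  qed
  have eq: "u x * ln (u x) = r x + u x * ln (v x)" for x by (simp add: r_def algebra_simps)
  show "integrable M (\<lambda>x. u x * ln (u x))" unfolding eq using ir iuv by simp
  have "(\<integral>x. u x - v x \<partial>M) \<le> (\<integral>x. r x \<partial>M)"
    using r by (intro integral_mono_AE ir) (auto simp: u v elim: eventually_mono)
  then have "0 \<le> (\<integral>x. r x \<partial>M)" by (simp add: u v)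
  then show "(\<integral>x. u x * ln (v x) \<partial>M) \<le> (\<integral>x. u x * ln (u x) \<partial>M)"
    unfolding eq using ir iuv by simp
qed

section \<open>Mixtures of a kernel of densities\<close>

locale density_mixture =
  fixes \<mu> :: "'t measure" and g :: "'t \<Rightarrow> real" and K :: "'t \<Rightarrow> 'a::euclidean_space \<Rightarrow> real"
  assumes g: "is_pdf \<mu> g"
    and K_measurable: "(\<lambda>(t, z). K t z) \<in> borel_measurable (\<mu> \<Otimes>\<^sub>M lborel)"
    and K: "\<And>t. t \<in> space \<mu> \<Longrightarrow> is_pdf lborel (K t)"
begin

abbreviation "\<nu> \<equiv> density \<mu> (\<lambda>t. ennreal (g t))"
abbreviation "m \<equiv> mixture \<mu> g K"

lemma g_measurable[measurable]: "g \<in> borel_measurable \<mu>" and g_nonneg: "t \<in> space \<mu> \<Longrightarrow> 0 \<le> g t"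
  using g by (auto simp: is_pdf_def)

lemma K_nonneg: "t \<in> space \<mu> \<Longrightarrow> 0 \<le> K t z"
  using K by (auto simp: is_pdf_def)

sublocale N: prob_space \<nu>
proof (rule prob_spaceI)
  have "emeasure \<nu> (space \<nu>) = (\<integral>\<^sup>+t. ennreal (g t) \<partial>\<mu>)"
    by (simp add: emeasure_density cong: nn_integral_cong)
  also have "\<dots> = ennreal (\<integral>t. g t \<partial>\<mu>)"
    using g by (intro nn_integral_eq_integral AE_I2) (auto simp: is_pdf_def)
  finally show "emeasure \<nu> (space \<nu>) = 1" using g by (simp add: is_pdf_def)
qed

sublocale LN: pair_sigma_finite "lborel :: 'a measure" \<nu> ..

lemma K_swap_measurable[measurable]: "(\<lambda>(z, t). K t z) \<in> borel_measurable (lborel \<Otimes>\<^sub>M \<nu>)"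
proof -
  have "(\<lambda>(z, t). K t z) \<in> borel_measurable (lborel \<Otimes>\<^sub>M \<mu>)"
    using measurable_pair_swap[OF K_measurable] by (simp add: case_prod_unfold)
  also have "borel_measurable (lborel \<Otimes>\<^sub>M \<mu>) = borel_measurable (lborel \<Otimes>\<^sub>M \<nu> :: ('a \<times> 't) measure)"
    by (intro measurable_cong_sets sets_pair_measure_cong) simp_all
  finally show ?thesis .
qed

text \<open>Under the measure with density \<open>g\<close> the mixture is a mean over a probability
  space, and statements that hold almost everywhere under it disregard the parameters where
  \<open>g\<close> vanishes.\<close>

lemma mixture_eq: "m z = (\<integral>t. K t z \<partial>\<nu>)"
proof -
  have "(\<lambda>t. K t z) \<in> borel_measurable \<mu>"
    using measurable_compose[OF measurable_Pair1' K_swap_measurable, of z] by simp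
  then show ?thesis
    unfolding mixture_def using g_nonneg by (subst integral_density) auto
qed

lemma mixture_measurable[measurable]: "m \<in> borel_measurable borel"
proof -
  have "(\<lambda>z. \<integral>t. K t z \<partial>\<nu>) \<in> borel_measurable lborel"
    by (rule N.borel_measurable_lebesgue_integral[OF K_swap_measurable])
  then show ?thesis by (simp add: mixture_eq[abs_def])
qed

lemma mixture_nonneg: "0 \<le> m z"
  unfolding mixture_eq by (intro integral_nonneg_AE AE_I2) (simp add: K_nonneg)

lemma integrable_K: "integrable (lborel \<Otimes>\<^sub>M \<nu>) (\<lambda>(z, t). K t z)"
proof -
  interpret NL: pair_sigma_finite \<nu> "lborel :: 'a measure" ..
  have "integrable (\<nu> \<Otimes>\<^sub>M lborel) (\<lambda>(t, z). K t z)"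
  proof (rule NL.Fubini_integrable)
    show "(\<lambda>(t, z). K t z) \<in> borel_measurable (\<nu> \<Otimes>\<^sub>M lborel)"
      using measurable_pair_swap[OF K_swap_measurable] by (simp add: case_prod_unfold)
    have "(\<integral>z. norm (case (t, z) of (t, z) \<Rightarrow> K t z) \<partial>lborel) = 1" if "t \<in> space \<nu>" for t
      using that K[of t] K_nonneg[of t] by (simp add: is_pdf_def)
    then show "integrable \<nu> (\<lambda>t. \<integral>z. norm (case (t, z) of (t, z) \<Rightarrow> K t z) \<partial>lborel)"
      by (subst Bochner_Integration.integrable_cong[where g="\<lambda>_. 1"]) auto
    show "AE t in \<nu>. integrable lborel (\<lambda>z. case (t, z) of (t, z) \<Rightarrow> K t z)"
      by (rule AE_I2) (use K in \<open>simp add: is_pdf_def\<close>)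
  qed
  from NL.integrable_product_swap[OF this] show ?thesis by (simp add: case_prod_unfold)
qed

lemma AE_integrable_K: "AE z in lborel. integrable \<nu> (\<lambda>t. K t z)"
  using LN.AE_integrable_fst'[OF integrable_K] by simp

lemma integrable_mixture: "integrable lborel m"
  using LN.integrable_fst'[OF integrable_K] by (simp add: mixture_eq[abs_def])

lemma integral_mixture: "(\<integral>z. m z \<partial>lborel) = 1"
proof -
  have "(\<integral>z. m z \<partial>lborel) = (\<integral>z. (\<integral>t. K t z \<partial>\<nu>) \<partial>lborel)" by (simp add: mixture_eq)
  also have "\<dots> = (\<integral>t. (\<integral>z. K t z \<partial>lborel) \<partial>\<nu>)"
    using LN.Fubini_integral[OF integrable_K] by simp
  also have "\<dots> = (\<integral>t. 1 \<partial>\<nu>)"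
    using K by (intro Bochner_Integration.integral_cong) (auto simp: is_pdf_def)
  finally show ?thesis using N.prob_space by simp
qed

text \<open>As \<open>K\<close> is nonnegative, integrating |K t z * h z| over t gives m z * |h z|,
  so integrability of m h yields joint integrability and Fubini applies. With h = ln m the last
  equation says, up to sign, that the cross entropies average to the entropy of the mixture.\<close>

lemma integrable_K_mult:
  assumes [measurable]: "h \<in> borel_measurable borel" and int: "integrable lborel (\<lambda>z. m z * h z)"
  shows "AE t in \<nu>. integrable lborel (\<lambda>z. K t z * h z)"
    "integrable \<nu> (\<lambda>t. \<integral>z. K t z * h z \<partial>lborel)"
    "(\<integral>t. (\<integral>z. K t z * h z \<partial>lborel) \<partial>\<nu>) = (\<integral>z. m z * h z \<partial>lborel)"
proof -
  have i: "integrable (lborel \<Otimes>\<^sub>M \<nu>) (\<lambda>(z, t). K t z * h z)"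
  proof (rule LN.Fubini_integrable)
    have "(\<lambda>x. (\<lambda>(z, t). K t z) x * h (fst x)) \<in> borel_measurable (lborel \<Otimes>\<^sub>M \<nu>)" by measurable
    then show "(\<lambda>(z, t). K t z * h z) \<in> borel_measurable (lborel \<Otimes>\<^sub>M \<nu>)" by (simp add: case_prod_unfold)
    have "(\<integral>t. norm (case (z, t) of (z, t) \<Rightarrow> K t z * h z) \<partial>\<nu>) = \<bar>m z * h z\<bar>" for z
    proof -
      have "(\<integral>t. norm (case (z, t) of (z, t) \<Rightarrow> K t z * h z) \<partial>\<nu>) = (\<integral>t. K t z * \<bar>h z\<bar> \<partial>\<nu>)"
        by (intro Bochner_Integration.integral_cong) (auto simp: abs_mult K_nonneg)
      then show ?thesis using mixture_nonneg[of z] by (simp add: abs_mult mixture_eq)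
    qed
    then show "integrable lborel (\<lambda>z. \<integral>t. norm (case (z, t) of (z, t) \<Rightarrow> K t z * h z) \<partial>\<nu>)"
      using int by simp
    show "AE z in lborel. integrable \<nu> (\<lambda>t. case (z, t) of (z, t) \<Rightarrow> K t z * h z)"
      using AE_integrable_K by (rule eventually_mono) simp
  qed
  show "AE t in \<nu>. integrable lborel (\<lambda>z. K t z * h z)" by (rule LN.AE_integrable_snd[OF i])
  show "integrable \<nu> (\<lambda>t. \<integral>z. K t z * h z \<partial>lborel)" by (rule LN.integrable_snd[OF i])
  show "(\<integral>t. (\<integral>z. K t z * h z \<partial>lborel) \<partial>\<nu>) = (\<integral>z. m z * h z \<partial>lborel)"
    using LN.Fubini_integral[OF i] by (simp add: mixture_eq)
qed

text \<open>Integrating \<open>K t\<close> over the zero set of the mixture and then over t gives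
  the integral of \<open>m\<close> over that set, which is 0. The inner integrals are nonnegative,
  so almost all of them vanish.\<close>

lemma AE_mixture_pos: "AE t in \<nu>. AE z in lborel. 0 < K t z \<longrightarrow> 0 < m z"
proof -
  define h :: "'a \<Rightarrow> real" where "h z = indicator {z. m z = 0} z" for z
  have [measurable]: "h \<in> borel_measurable borel" unfolding h_def by measurable
  have mh: "m z * h z = 0" for z by (simp add: h_def indicator_def)
  have *: "AE t in \<nu>. integrable lborel (\<lambda>z. K t z * h z)"
    "integrable \<nu> (\<lambda>t. \<integral>z. K t z * h z \<partial>lborel)" "(\<integral>t. (\<integral>z. K t z * h z \<partial>lborel) \<partial>\<nu>) = 0"
    using integrable_K_mult[of h] by (simp_all add: mh)
  have Kh: "0 \<le> K t z * h z" if "t \<in> space \<nu>" for t z using K_nonneg that by (simp add: h_def)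
  have "AE t in \<nu>. (\<integral>z. K t z * h z \<partial>lborel) = 0"
    using *(2,3) Kh by (subst integral_nonneg_eq_0_iff_AE[symmetric]) (auto intro!: AE_I2 integral_nonneg_AE)
  then show ?thesis
    using *(1) AE_space
  proof eventually_elim
    case (elim t)
    then have "AE z in lborel. K t z * h z = 0"
      using Kh by (subst integral_nonneg_eq_0_iff_AE[symmetric]) auto
    then show ?case
    proof (rule eventually_mono)
      fix z assume "K t z * h z = 0"
      then show "0 < K t z \<longrightarrow> 0 < m z" using mixture_nonneg[of z] by (auto simp: h_def indicator_def split: if_splits)
    qed
  qed
qed

end

text \<open>Among the mixtures only the full one is assumed to have finite entropy. A component of
  positive weight inherits this, being dominated by the full mixture divided by the weight. A
  component of weight 0 may fail to have an entropy, but its term vanishes whatever value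
  \<open>diff_entropy\<close> takes.\<close>

theorem corollary3p2:
  fixes M :: "'s measure"
    and \<mu> :: "'t measure"
    and \<theta> :: "'s \<Rightarrow> 't"
    and p :: "'t \<Rightarrow> real"
    and f :: "nat \<Rightarrow> 't \<Rightarrow> real"
    and \<omega> :: "nat \<Rightarrow> real"
    and L :: nat
    and P :: "'t \<Rightarrow> 'w measure"
    and y y' :: "'w \<Rightarrow> 'a::euclidean_space"
    and py pz :: "'t \<Rightarrow> 'a \<Rightarrow> real"
  assumes "prob_space M"
    and "has_pdf M \<mu> \<theta> p"
    and "\<And>t. t \<in> space \<mu> \<Longrightarrow> prob_space (P t)"
    and "\<And>t. t \<in> space \<mu> \<Longrightarrow> prob_space.indep_var (P t) borel y borel y'"
    and "\<And>t. t \<in> space \<mu> \<Longrightarrow> has_pdf (P t) lborel y (py t)"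
    and "\<And>t. t \<in> space \<mu> \<Longrightarrow> has_pdf (P t) lborel y' (py t)"
    and "\<And>t. t \<in> space \<mu> \<Longrightarrow> has_pdf (P t) lborel (\<lambda>w. y w - y' w) (pz t)"
    and "(\<lambda>(t, z). pz t z) \<in> borel_measurable (\<mu> \<Otimes>\<^sub>M lborel)"
    and "\<And>t. t \<in> space \<mu> \<Longrightarrow> p t = (\<Sum>l=1..L. \<omega> l * f l t)"
    and "\<And>l. l \<in> {1..L} \<Longrightarrow> 0 \<le> \<omega> l"
    and "(\<Sum>l=1..L. \<omega> l) = 1"
    and "\<And>l. l \<in> {1..L} \<Longrightarrow> is_pdf \<mu> (f l)"
    and "AE t in \<mu>. 0 < p t \<longrightarrow> finite_diff_entropy (py t)"
    and "integrable \<mu> (\<lambda>t. p t * diff_entropy (py t))"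
    and "finite_diff_entropy (mixture \<mu> p pz)"
  shows "(LINT t|\<mu>. p t * diff_entropy (py t))
           \<le> (\<Sum>l=1..L. \<omega> l * diff_entropy (mixture \<mu> (f l) pz)) - real DIM('a) / 2 * ln 2
       \<and> (\<Sum>l=1..L. \<omega> l * diff_entropy (mixture \<mu> (f l) pz)) - real DIM('a) / 2 * ln 2
           \<le> diff_entropy (mixture \<mu> p pz) - real DIM('a) / 2 * ln 2"
proof -
  define k where "k = real DIM('a) / 2 * ln 2"
  \<comment> \<open>\<open>diff_entropy (py t)\<close> itself need not be measurable in \<open>t\<close> on the zero set of \<open>p\<close>.\<close>
  define h where "h t = p t * diff_entropy (py t) / p t" for t
  have ph: "p t * h t = p t * diff_entropy (py t)" for t by (simp add: h_def)
  have pdf_p: "is_pdf \<mu> p" using assms(2) by (simp add: has_pdf_def)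
  have pdf_pz: "is_pdf lborel (pz t)" if "t \<in> space \<mu>" for t
    using assms(7)[OF that] by (simp add: has_pdf_def)
  have mix: "density_mixture \<mu> g pz" if "is_pdf \<mu> g" for g
    by (rule density_mixture.intro[OF that assms(8) pdf_pz])
  interpret p: density_mixture \<mu> p pz by (rule mix[OF pdf_p])
  have pm: "p \<in> borel_measurable \<mu>" "integrable \<mu> p" using pdf_p by (auto simp: is_pdf_def)
  have hm: "h \<in> borel_measurable \<mu>"
    unfolding h_def using borel_measurable_integrable[OF assms(14)] pm(1) by (rule borel_measurable_divide)
  let ?m = "\<lambda>l. mixture \<mu> (f l) pz" and ?mp = "mixture \<mu> p pz"
  have f0: "0 \<le> f l t" if "l \<in> {1..L}" "t \<in> space \<mu>" for l t
    using assms(12)[OF that(1)] that(2) by (simp add: is_pdf_def)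
  have fm: "f l \<in> borel_measurable \<mu>" if "l \<in> {1..L}" for l
    using assms(12)[OF that] by (auto simp: is_pdf_def)
  \<comment> \<open>All weighted terms are nonnegative, so each is at most \<open>p\<close>. This
    carries integrability and finiteness of the entropies of \<open>py t\<close> from
    \<open>p\<close> over to \<open>f l\<close>.\<close>
  have w_le: "\<omega> l * f l t \<le> p t" if "l \<in> {1..L}" "t \<in> space \<mu>" for l t
    unfolding assms(9)[OF that(2)] using that assms(10) f0
    by (intro member_le_sum[of l "{1..L}" "\<lambda>l. \<omega> l * f l t"]) auto
  have imp: "integrable lborel (\<lambda>z. ?mp z * ln (?mp z))"
    using assms(15) by (simp add: finite_diff_entropy_def mult.commute)
  \<comment> \<open>Only almost everywhere: where the integral of a component diverges it takes the
    default value 0, and linearity may fail.\<close>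
  have mp_sum: "AE z in lborel. ?mp z = (\<Sum>l=1..L. \<omega> l * ?m l z)"
  proof -
    have "AE z in lborel. \<forall>l\<in>{1..L}. integrable (density \<mu> (\<lambda>t. ennreal (f l t))) (\<lambda>t. pz t z)"
      using density_mixture.AE_integrable_K[OF mix[OF assms(12)]] by (intro AE_finite_allI) auto
    then show ?thesis
    proof (rule eventually_mono)
      fix z assume i: "\<forall>l\<in>{1..L}. integrable (density \<mu> (\<lambda>t. ennreal (f l t))) (\<lambda>t. pz t z)"
      have mz: "(\<lambda>t. pz t z) \<in> borel_measurable \<mu>"
        using measurable_compose[OF measurable_Pair2' assms(8), of z] by simp
      have i': "integrable \<mu> (\<lambda>t. f l t * pz t z)" if "l \<in> {1..L}" for l
      proof -
        have "AE t in \<mu>. 0 \<le> f l t" using f0[OF that] by simp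
        then show ?thesis using i that integrable_density[OF mz fm[OF that]] by simp
      qed
      have "?mp z = (\<integral>t. (\<Sum>l=1..L. \<omega> l * (f l t * pz t z)) \<partial>\<mu>)"
        unfolding mixture_def using assms(9)
        by (intro Bochner_Integration.integral_cong) (auto simp: sum_distrib_right mult.assoc)
      also have "\<dots> = (\<Sum>l=1..L. \<omega> l * ?m l z)"
        unfolding mixture_def using i' by (subst Bochner_Integration.integral_sum) auto
      finally show "?mp z = (\<Sum>l=1..L. \<omega> l * ?m l z)" .
    qed
  qed
  have component: "integrable lborel (\<lambda>z. ?m l z * ln (?mp z)) \<and>
      (\<integral>z. ?m l z * ln (?mp z) \<partial>lborel) \<le> - diff_entropy (?m l) \<and>
      integrable \<mu> (\<lambda>t. f l t * h t) \<and>
      (\<integral>t. f l t * h t \<partial>\<mu>) + k \<le> diff_entropy (?m l)"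
    if l: "l \<in> {1..L}" and w: "\<omega> l \<noteq> 0" for l
  proof -
    have w0: "0 < \<omega> l" using assms(10)[OF l] w by simp
    interpret D: density_mixture \<mu> "f l" pz by (rule mix[OF assms(12)[OF l]])
    have "AE z in lborel. ?m l z \<le> (1 / \<omega> l) * ?mp z"
      using mp_sum
    proof (rule eventually_mono)
      fix z assume z: "?mp z = (\<Sum>l=1..L. \<omega> l * ?m l z)"
      have "\<omega> l * ?m l z \<le> ?mp z" unfolding z
        using assms(10) l density_mixture.mixture_nonneg[OF mix[OF assms(12)]]
        by (intro member_le_sum[of l "{1..L}" "\<lambda>l. \<omega> l * ?m l z"]) auto
      then show "?m l z \<le> (1 / \<omega> l) * ?mp z" using w0 by (simp add: field_simps)
    qed
    note G = gibbs_inequality[OF D.integrable_mixture D.mixture_nonneg D.integral_mixture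
        p.integrable_mixture p.mixture_nonneg p.integral_mixture _ this imp]
    have G1: "integrable lborel (\<lambda>z. ?m l z * ln (?m l z))" "integrable lborel (\<lambda>z. ?m l z * ln (?mp z))"
      "(\<integral>z. ?m l z * ln (?mp z) \<partial>lborel) \<le> (\<integral>z. ?m l z * ln (?m l z) \<partial>lborel)"
      using G w0 by simp_all
    have ent: "diff_entropy (?m l) = - (\<integral>z. ?m l z * ln (?m l z) \<partial>lborel)"
      by (simp add: diff_entropy_def mult.commute)
    have ih: "integrable \<mu> (\<lambda>t. f l t * h t)"
    proof (rule Bochner_Integration.integrable_bound)
      show "integrable \<mu> (\<lambda>t. (1 / \<omega> l) * (p t * h t))" unfolding ph using assms(14) by simp
      show "(\<lambda>t. f l t * h t) \<in> borel_measurable \<mu>" using fm[OF l] hm by (rule borel_measurable_times)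
      show "AE t in \<mu>. norm (f l t * h t) \<le> norm ((1 / \<omega> l) * (p t * h t))"
      proof (rule AE_I2)
        fix t assume t: "t \<in> space \<mu>"
        have "\<bar>f l t\<bar> \<le> \<bar>p t / \<omega> l\<bar>"
          using w_le[OF l t] f0[OF l t] w0 by (simp add: field_simps)
        then have "\<bar>f l t\<bar> * \<bar>h t\<bar> \<le> \<bar>p t / \<omega> l\<bar> * \<bar>h t\<bar>" by (intro mult_right_mono) auto
        then show "norm (f l t * h t) \<le> norm ((1 / \<omega> l) * (p t * h t))" by (simp add: abs_mult)
      qed
    qed
    have hN: "integrable D.\<nu> h" "(\<integral>t. h t \<partial>D.\<nu>) = (\<integral>t. f l t * h t \<partial>\<mu>)"
      using ih integrable_density[OF hm fm[OF l]] integral_density[OF hm fm[OF l]] f0[OF l] by simp_all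
    have lnm: "(\<lambda>z. ln (?m l z)) \<in> borel_measurable borel" by measurable
    note KM = D.integrable_K_mult[OF lnm G1(1)]
    \<comment> \<open>Where \<open>f l\<close> is positive so is \<open>p\<close>, hence there
      \<open>h\<close> is the entropy of \<open>py t\<close>, and that entropy is finite for almost
      every such parameter.\<close>
    have "AE t in D.\<nu>. h t = diff_entropy (py t) \<and> finite_diff_entropy (py t)"
    proof (subst AE_density)
      show "AE t in \<mu>. 0 < ennreal (f l t) \<longrightarrow> h t = diff_entropy (py t) \<and> finite_diff_entropy (py t)"
        using assms(13) AE_space
      proof eventually_elim
        case (elim t)
        show ?case
        proof
          assume "0 < ennreal (f l t)"
          then have "0 < \<omega> l * f l t" using w0 by simp
          then have "0 < p t" using w_le[OF l elim(2)] by linarith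
          then show "h t = diff_entropy (py t) \<and> finite_diff_entropy (py t)" using elim(1) by (simp add: h_def)
        qed
      qed
    qed (use fm[OF l] in simp)
    \<comment> \<open>The inequality at a fixed parameter with test density \<open>?m l\<close>, the
      same for all parameters.\<close>
    then have "AE t in D.\<nu>. h t + k \<le> - (\<integral>z. pz t z * ln (?m l z) \<partial>lborel)"
      using KM(1) D.AE_mixture_pos AE_space
    proof eventually_elim
      case (elim t)
      then have t: "t \<in> space \<mu>" by simp
      have hp: "h t = diff_entropy (py t)" and fin: "finite_diff_entropy (py t)" using elim(1) by simp_all
      show ?case unfolding hp k_def
        by (rule entropy_le_cross_entropy_diff[OF assms(3)[OF t] assms(4)[OF t] assms(5)[OF t] assms(6)[OF t]
            assms(7)[OF t] fin D.integrable_mixture D.mixture_nonneg D.integral_mixture elim(3) elim(2)])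
    qed
    then have "(\<integral>t. h t + k \<partial>D.\<nu>) \<le> (\<integral>t. - (\<integral>z. pz t z * ln (?m l z) \<partial>lborel) \<partial>D.\<nu>)"
      using hN(1) KM(2) by (intro integral_mono_AE) auto
    then have "(\<integral>t. f l t * h t \<partial>\<mu>) + k \<le> diff_entropy (?m l)"
      using hN KM(3) D.N.prob_space by (simp add: ent)
    then show ?thesis using G1 ih ent by simp
  qed
  have "(\<integral>t. p t * h t \<partial>\<mu>) = (\<integral>t. (\<Sum>l=1..L. \<omega> l * (f l t * h t)) \<partial>\<mu>)"
    using assms(9) by (intro Bochner_Integration.integral_cong) (auto simp: sum_distrib_right mult.assoc)
  also have "\<dots> = (\<Sum>l=1..L. \<integral>t. \<omega> l * (f l t * h t) \<partial>\<mu>)"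
  proof (rule Bochner_Integration.integral_sum)
    fix l assume "l \<in> {1..L}"
    then show "integrable \<mu> (\<lambda>t. \<omega> l * (f l t * h t))" using component[of l] by (cases "\<omega> l = 0") auto
  qed
  also have "\<dots> = (\<Sum>l=1..L. \<omega> l * (\<integral>t. f l t * h t \<partial>\<mu>))" by simp
  \<comment> \<open>The weights sum to 1, so \<open>k\<close> can be distributed over the
    components.\<close>
  finally have "(\<integral>t. p t * h t \<partial>\<mu>) + k = (\<Sum>l=1..L. \<omega> l * ((\<integral>t. f l t * h t \<partial>\<mu>) + k))"
    using assms(11) by (simp add: distrib_left sum.distrib sum_distrib_right[symmetric])
  also have "\<dots> \<le> (\<Sum>l=1..L. \<omega> l * diff_entropy (?m l))"
  proof (rule sum_mono)
    fix l assume l: "l \<in> {1..L}"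
    then show "\<omega> l * ((\<integral>t. f l t * h t \<partial>\<mu>) + k) \<le> \<omega> l * diff_entropy (?m l)"
      using component[OF l] assms(10)[OF l] by (cases "\<omega> l = 0") (auto intro: mult_left_mono)
  qed
  finally have first: "(\<integral>t. p t * h t \<partial>\<mu>) + k \<le> (\<Sum>l=1..L. \<omega> l * diff_entropy (?m l))" .
  \<comment> \<open>Concavity of the entropy: each component entropy is at most its cross entropy
    relative to \<open>?mp\<close>, and cross entropy is linear in its first argument, so the
    weighted sum is the entropy of \<open>?mp\<close>.\<close>
  have "(\<Sum>l=1..L. \<omega> l * diff_entropy (?m l)) \<le> (\<Sum>l=1..L. \<omega> l * - (\<integral>z. ?m l z * ln (?mp z) \<partial>lborel))"
  proof (rule sum_mono)
    fix l assume l: "l \<in> {1..L}"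
    show "\<omega> l * diff_entropy (?m l) \<le> \<omega> l * - (\<integral>z. ?m l z * ln (?mp z) \<partial>lborel)"
    proof (cases "\<omega> l = 0")
      case False
      then have "diff_entropy (?m l) \<le> - (\<integral>z. ?m l z * ln (?mp z) \<partial>lborel)" using component[OF l] by linarith
      then show ?thesis using assms(10)[OF l] by (rule mult_left_mono)
    qed simp
  qed
  also have "\<dots> = - (\<Sum>l=1..L. \<integral>z. \<omega> l * (?m l z * ln (?mp z)) \<partial>lborel)"
    by (simp add: sum_negf)
  also have "(\<Sum>l=1..L. \<integral>z. \<omega> l * (?m l z * ln (?mp z)) \<partial>lborel)
      = (\<integral>z. (\<Sum>l=1..L. \<omega> l * (?m l z * ln (?mp z))) \<partial>lborel)"
  proof (rule Bochner_Integration.integral_sum[symmetric])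
    fix l assume "l \<in> {1..L}"
    then show "integrable lborel (\<lambda>z. \<omega> l * (?m l z * ln (?mp z)))" using component[of l] by (cases "\<omega> l = 0") auto
  qed
  also have "\<dots> = (\<integral>z. ln (?mp z) * ?mp z \<partial>lborel)"
  proof (rule integral_cong_AE)
    show "AE z in lborel. (\<Sum>l=1..L. \<omega> l * (?m l z * ln (?mp z))) = ln (?mp z) * ?mp z"
      using mp_sum
    proof (rule eventually_mono)
      fix z assume z: "?mp z = (\<Sum>l=1..L. \<omega> l * ?m l z)"
      have "(\<Sum>l=1..L. \<omega> l * (?m l z * ln (?mp z))) = (\<Sum>l=1..L. \<omega> l * ?m l z) * ln (?mp z)"
        by (simp add: sum_distrib_right mult.assoc)
      then show "(\<Sum>l=1..L. \<omega> l * (?m l z * ln (?mp z))) = ln (?mp z) * ?mp z"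
        unfolding z[symmetric] by (simp add: mult.commute)
    qed
    have "?m l \<in> borel_measurable borel" if "l \<in> {1..L}" for l
      by (rule density_mixture.mixture_measurable[OF mix[OF assms(12)[OF that]]])
    then show "(\<lambda>z. \<Sum>l=1..L. \<omega> l * (?m l z * ln (?mp z))) \<in> borel_measurable lborel"
      by (intro borel_measurable_sum borel_measurable_times) simp_all
  qed measurable
  also have "- \<dots> = diff_entropy ?mp" by (simp add: diff_entropy_def)
  finally have second: "(\<Sum>l=1..L. \<omega> l * diff_entropy (?m l)) \<le> diff_entropy ?mp" .
  show ?thesis using first second unfolding k_def ph by simp
qed

end
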